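(* Let $L>0$, $\nu\in(0,1)$ and let $\Omega_\gamma\in\mathcal{O}$ be an admissible domain. There exist $\varepsilon_1,\varepsilon_2,\varepsilon_3>0$ and $\delta>0$ such that the following holds. Let $\mathbf{g}_1\in L^2(\Omega^{\mathrm M};\mathbb{R}^2)$, $g_2\in L^2(\Omega^{\mathrm M})$, and $T_d\in H^1(\Omega^{\mathrm M})\cap C_c(\Omega^{\mathrm M})$. If $$\mathrm{Re}\in(0,\varepsilon_1),\qquad \mathrm{Pr}\in\left(0,\frac{\varepsilon_2}{\mathrm{Re}}\right),\qquad \mathrm{Gr}\in(0,\varepsilon_3\min(\mathrm{Re},\mathrm{Re}^2)),$$ and $\mathbf{g}_1,g_2,T_d$ are sufficiently small, in the sense that $\|\mathbf{g}_1\|_{V(\Omega^{\mathrm M})'}\le\delta$, $\|g_2\|_{H^{-1}(\Omega^{\mathrm M})}\le\delta$, $\|T_d\|_{H^1(\Omega^{\mathrm M})}\le\delta$, then (the Boussinesq system in $\Omega_\gamma$ has a unique weak solution $(\mathbf{v},T)$ and) there exists a unique weak solution $(\mathbf{w},S)\in V(\Omega_\gamma)\times H_0^1(\Omega_\gamma)$ to the adjoint system in $\Omega_\gamma$. Moreover, if in addition $T_d\in H^2(\Omega^{\mathrm M})$ and $\Gamma_\gamma$ is of class $C^2$, then $$\mathbf{w}\big|_{\Gamma_\gamma^\varepsilon}\in H^{3/2}(\Gamma_\gamma^\varepsilon;\mathbb{R}^2),\qquad S\big|_{\Gamma_\gamma^\varepsilon}\in H^{3/2}(\Gamma_\gamma^\varepsilon)$$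 for every relatively open subset $\Gamma_\gamma^\varepsilon$ of $\partial\Omega_\gamma$ strictly contained in $\Gamma_\gamma$ (i.e. $\overline{\Gamma_\gamma^\varepsilon}\subset\Gamma_\gamma$).
   Context: Admissible domains: $\mathcal{O}$ is the class of all $\Omega_\gamma=\{(x_1,x_2)\in\mathbb{R}^2: 0<x_1<1,\ \gamma(x_1)<x_2<1\}$ with $\gamma\in H_0^1(0,1)$, $\gamma\le 1-\nu$ a.e. and $|\gamma'|\le L$ a.e. in $(0,1)$. $\Gamma_\gamma=\{(x_1,x_2)\in\partial\Omega_\gamma: x_2=\gamma(x_1)\}$. $\mathrm M>0$ is fixed so that $\Omega_\gamma\subset\Omega^{\mathrm M}:=(0,1)\times(-\mathrm M,1)$ for every $\Omega_\gamma\in\mathcal{O}$. The data are given on $\Omega^{\mathrm M}$ and restricted to $\Omega_\gamma$. For a domain $\Omega$: $V(\Omega)=\{\boldsymbol\varphi\in H^1(\Omega;\mathbb{R}^2): \operatorname{div}\boldsymbol\varphi=0\text{ a.e.},\ \boldsymbol\varphi=0\text{ on }\partial\Omega\}$ and $H_0^1(\Omega)$, both normed by the $L^2$ norm of the gradient, with duals $V(\Omega)'$, $H^{-1}(\Omega)$ ($L^2$ functions act by integration). $\mathbf{e}=(0,1)$; $\mathrm{Re},\mathrm{Pr},\mathrm{Gr}>0$. Notation: $(\mathbf{v}\cdot\nabla\mathbf{w})_j=\sum_i v_i\partial_iw_j$, and $I(T,\gamma)=\frac1{|\Omega_\gamma|}\int_{\Omega_\gamma}T\,dx$. Weak solution of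 the Boussinesq system in $\Omega_\gamma$: a pair $(\mathbf{v},T)\in V(\Omega_\gamma)\times H^1(\Omega_\gamma)$ with $T-T_d\in H_0^1(\Omega_\gamma)$ such that $$\int_{\Omega_\gamma}(\mathbf{v}\cdot\nabla\mathbf{v})\cdot\boldsymbol\varphi+\frac1{\mathrm{Re}}\int_{\Omega_\gamma}\nabla\mathbf{v}:\nabla\boldsymbol\varphi-\frac{\mathrm{Gr}}{\mathrm{Re}^2}\int_{\Omega_\gamma} T\mathbf{e}\cdot\boldsymbol\varphi=\int_{\Omega_\gamma}\mathbf{g}_1\cdot\boldsymbol\varphi\quad\forall\boldsymbol\varphi\in V(\Omega_\gamma),$$ $$\int_{\Omega_\gamma}(\mathbf{v}\cdot\nabla T)\varphi+\frac1{\mathrm{Re}\,\mathrm{Pr}}\int_{\Omega_\gamma}\nabla T\cdot\nabla\varphi=\int_{\Omega_\gamma}g_2\varphi\quad\forall\varphi\in H_0^1(\Omega_\gamma).$$ Adjoint system in $\Omega_\gamma$ (with $(\mathbf{v},T)$ the weak solution of the Boussinesq system): $-\mathbf{v}\cdot\nabla\mathbf{w}+\mathbf{w}\cdot\nabla\mathbf{v}+S\nabla T-\frac1{\mathrm{Re}}\Delta\mathbf{w}+\nabla q=0$, $\nabla\cdot\mathbf{w}=0$ in $\Omega_\gamma$, $\mathbf{w}=0$ on $\partial\Omega_\gamma$; $-\mathbf{v}\cdot\nabla S-\frac1{\mathrm{Re}\,\mathrm{Pr}}\Delta S-\frac{\mathrm{Gr}}{\mathrm{Re}^2}\mathbf{w}\cdot\mathbf{e}=T-I(T,\gamma)$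 in $\Omega_\gamma$, $S=0$ on $\partial\Omega_\gamma$. A weak solution is $(\mathbf{w},S)\in V(\Omega_\gamma)\times H_0^1(\Omega_\gamma)$ such that for all $(\boldsymbol\varphi,\varphi)\in V(\Omega_\gamma)\times H_0^1(\Omega_\gamma)$ $$-\int_{\Omega_\gamma}(\mathbf{v}\cdot\nabla\mathbf{w})\cdot\boldsymbol\varphi+\int_{\Omega_\gamma}(\mathbf{w}\cdot\nabla\mathbf{v})\cdot\boldsymbol\varphi+\int_{\Omega_\gamma}(\boldsymbol\varphi\cdot\nabla T)S+\frac1{\mathrm{Re}}\int_{\Omega_\gamma}\nabla\mathbf{w}:\nabla\boldsymbol\varphi=0,$$ $$-\int_{\Omega_\gamma}(\mathbf{v}\cdot\nabla S)\varphi+\frac1{\mathrm{Re}\,\mathrm{Pr}}\int_{\Omega_\gamma}\nabla S\cdot\nabla\varphi-\frac{\mathrm{Gr}}{\mathrm{Re}^2}\int_{\Omega_\gamma}(\mathbf{w}\cdot\mathbf{e})\varphi=\int_{\Omega_\gamma}(T-I(T,\gamma))\varphi.$$ *)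

theory Defs
  imports "HOL-Analysis.Analysis"
begin

section \<open>Sobolev spaces on open sets\<close>

text \<open>
  Elements of Lebesgue and Sobolev spaces are represented by functions on the whole space of which
  only the values on the open set \<open>\<Omega>\<close> matter, and these only up to null sets. The definitions are
  generic in the dimension: they are used for plane domains and for open subsets of the real line.
\<close>

text \<open>\<open>C\<^sup>k(U)\<close> for open \<open>U\<close>; the witness \<open>g\<close> is the gradient of \<open>f\<close>.\<close>

primrec Ck_on :: "nat \<Rightarrow> 'a::euclidean_space set \<Rightarrow> ('a \<Rightarrow> real) \<Rightarrow> bool" where
  "Ck_on 0 U f \<longleftrightarrow> continuous_on U f"
| "Ck_on (Suc k) U f \<longleftrightarrow>
     (\<exists>g. (\<forall>x\<in>U. (f has_derivative (\<lambda>h. g x \<bullet> h)) (at x)) \<and>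
          (\<forall>b\<in>Basis. Ck_on k U (\<lambda>x. g x \<bullet> b)))"

definition smooth_fun :: "('a::euclidean_space \<Rightarrow> real) \<Rightarrow> bool" where
  "smooth_fun f \<longleftrightarrow> (\<forall>k. Ck_on k UNIV f)"

definition test_funs :: "'a::euclidean_space set \<Rightarrow> ('a \<Rightarrow> real) set" where
  "test_funs \<Omega> = {\<phi>. smooth_fun \<phi> \<and> (\<exists>K. compact K \<and> K \<subseteq> \<Omega> \<and> (\<forall>x. x \<notin> K \<longrightarrow> \<phi> x = 0))}"

definition L2 :: "'a::euclidean_space set \<Rightarrow> ('a \<Rightarrow> 'b::euclidean_space) set" where
  "L2 \<Omega> = {f. f \<in> borel_measurable (lebesgue_on \<Omega>) \<and>
              integrable (lebesgue_on \<Omega>) (\<lambda>x. (norm (f x))\<^sup>2)}"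

definition L2_norm :: "'a::euclidean_space set \<Rightarrow> ('a \<Rightarrow> 'b::euclidean_space) \<Rightarrow> real" where
  "L2_norm \<Omega> f = sqrt (LINT x|lebesgue_on \<Omega>. (norm (f x))\<^sup>2)"

definition is_weak_grad ::
    "'a::euclidean_space set \<Rightarrow> ('a \<Rightarrow> real) \<Rightarrow> ('a \<Rightarrow> 'a) \<Rightarrow> bool" where
  "is_weak_grad \<Omega> u G \<longleftrightarrow>
     (\<forall>\<phi>\<in>test_funs \<Omega>. \<forall>b\<in>Basis.
        (LINT x|lebesgue_on \<Omega>. u x * frechet_derivative \<phi> (at x) b) =
        - (LINT x|lebesgue_on \<Omega>. (G x \<bullet> b) * \<phi> x))"

definition H1 :: "'a::euclidean_space set \<Rightarrow> ('a \<Rightarrow> real) set" where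
  "H1 \<Omega> = {u \<in> L2 \<Omega>. \<exists>G\<in>L2 \<Omega>. is_weak_grad \<Omega> u G}"

text \<open>A representative of the weak gradient, which is unique up to a null set.\<close>

definition weak_grad :: "'a::euclidean_space set \<Rightarrow> ('a \<Rightarrow> real) \<Rightarrow> 'a \<Rightarrow> 'a" where
  "weak_grad \<Omega> u = (SOME G. G \<in> L2 \<Omega> \<and> is_weak_grad \<Omega> u G)"

definition H1_norm :: "'a::euclidean_space set \<Rightarrow> ('a \<Rightarrow> real) \<Rightarrow> real" where
  "H1_norm \<Omega> u = sqrt ((L2_norm \<Omega> u)\<^sup>2 + (L2_norm \<Omega> (weak_grad \<Omega> u))\<^sup>2)"

definition H01 :: "'a::euclidean_space set \<Rightarrow> ('a \<Rightarrow> real) set" where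
  "H01 \<Omega> = {u \<in> H1 \<Omega>. \<exists>\<phi>. (\<forall>n. \<phi> n \<in> test_funs \<Omega>) \<and>
                          (\<lambda>n. H1_norm \<Omega> (\<lambda>x. u x - \<phi> n x)) \<longlonglongrightarrow> 0}"

definition H2 :: "'a::euclidean_space set \<Rightarrow> ('a \<Rightarrow> real) set" where
  "H2 \<Omega> = {u \<in> H1 \<Omega>. \<forall>b\<in>Basis. (\<lambda>x. weak_grad \<Omega> u x \<bullet> b) \<in> H1 \<Omega>}"

definition Cc :: "'a::euclidean_space set \<Rightarrow> ('a \<Rightarrow> real) set" where
  "Cc \<Omega> = {f. continuous_on \<Omega> f \<and> (\<exists>K. compact K \<and> K \<subseteq> \<Omega> \<and> (\<forall>x\<in>\<Omega> - K. f x = 0))}"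

text \<open>
  \<open>H\<^sup>3\<^sup>/\<^sup>2(J)\<close> for an open \<open>J\<close> in the real line, in the Sobolev--Slobodeckij sense: the derivative
  has a finite Gagliardo seminorm of order \<open>s = 1/2\<close>, where \<open>|t - s|\<close> appears with the exponent
  \<open>1 + 2s = 2\<close>.
\<close>

definition H32 :: "real set \<Rightarrow> (real \<Rightarrow> real) set" where
  "H32 J = {f \<in> H1 J.
     (\<integral>\<^sup>+ t. (\<integral>\<^sup>+ s. ennreal (((weak_grad J f t - weak_grad J f s) / (t - s))\<^sup>2)
        \<partial>lebesgue_on J) \<partial>lebesgue_on J) < \<infinity>}"


section \<open>Vector fields, dual norms\<close>

text \<open>
  \<open>vgrad \<Omega> v x $ j $ i\<close> is the \<open>i\<close>-th partial derivative of \<open>v\<^sub>j\<close>. Hence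
  \<open>vgrad \<Omega> w x *v v x\<close> is \<open>(v \<cdot> \<nabla>w)(x)\<close>, the trace is the divergence, and norm and inner product
  of such matrices are those of Frobenius.
\<close>

definition vgrad :: "(real^2) set \<Rightarrow> (real^2 \<Rightarrow> real^2) \<Rightarrow> real^2 \<Rightarrow> real^2^2" where
  "vgrad \<Omega> v x = (\<chi> j. weak_grad \<Omega> (\<lambda>y. v y $ j) x)"

text \<open>The condition \<open>v = 0\<close> on the boundary is understood as \<open>v\<^sub>j \<in> H\<^sub>0\<^sup>1(\<Omega>)\<close>.\<close>

definition V_space :: "(real^2) set \<Rightarrow> (real^2 \<Rightarrow> real^2) set" where
  "V_space \<Omega> = {v. (\<forall>j. (\<lambda>x. v x $ j) \<in> H01 \<Omega>) \<and>
                  (AE x in lebesgue_on \<Omega>. trace (vgrad \<Omega> v x) = 0)}"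

text \<open>
  Norms of square integrable functions as functionals on the spaces above, these being normed by
  the norm of the gradient.
\<close>

definition V_dual_norm :: "(real^2) set \<Rightarrow> (real^2 \<Rightarrow> real^2) \<Rightarrow> ennreal" where
  "V_dual_norm \<Omega> g =
     (SUP \<phi>\<in>{\<phi> \<in> V_space \<Omega>. L2_norm \<Omega> (vgrad \<Omega> \<phi>) \<le> 1}.
        ennreal \<bar>LINT x|lebesgue_on \<Omega>. g x \<bullet> \<phi> x\<bar>)"

definition Hm1_norm :: "(real^2) set \<Rightarrow> (real^2 \<Rightarrow> real) \<Rightarrow> ennreal" where
  "Hm1_norm \<Omega> g =
     (SUP \<phi>\<in>{\<phi> \<in> H01 \<Omega>. L2_norm \<Omega> (weak_grad \<Omega> \<phi>) \<le> 1}.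
        ennreal \<bar>LINT x|lebesgue_on \<Omega>. g x * \<phi> x\<bar>)"


section \<open>Admissible domains\<close>

text \<open>
  An element of \<open>H\<^sub>0\<^sup>1(0,1)\<close> is identified with its representative that is continuous on \<open>[0,1]\<close>
  (and therefore vanishes at \<open>0\<close> and \<open>1\<close>), since the domain above its graph depends on pointwise values.
\<close>

definition admissible :: "real \<Rightarrow> real \<Rightarrow> (real \<Rightarrow> real) \<Rightarrow> bool" where
  "admissible L \<nu> \<gamma> \<longleftrightarrow>
     \<gamma> \<in> H01 {0<..<1} \<and> continuous_on {0..1} \<gamma> \<and>
     (AE t in lebesgue_on {0<..<1}. \<gamma> t \<le> 1 - \<nu>) \<and>
     (AE t in lebesgue_on {0<..<1}. \<bar>weak_grad {0<..<1} \<gamma> t\<bar> \<le> L)"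

definition Dom :: "(real \<Rightarrow> real) \<Rightarrow> (real^2) set" where
  "Dom \<gamma> = {x. 0 < x$1 \<and> x$1 < 1 \<and> \<gamma> (x$1) < x$2 \<and> x$2 < 1}"

definition DomM :: "real \<Rightarrow> (real^2) set" where
  "DomM M = {x. 0 < x$1 \<and> x$1 < 1 \<and> - M < x$2 \<and> x$2 < 1}"

definition Gam :: "(real \<Rightarrow> real) \<Rightarrow> (real^2) set" where
  "Gam \<gamma> = {x \<in> frontier (Dom \<gamma>). x$2 = \<gamma> (x$1)}"

text \<open>
  A portion \<open>\<Gamma>\<close> of the boundary of \<open>\<Omega>\<close> is of class \<open>C\<^sup>2\<close> if the boundary is locally a regular
  level set of a \<open>C\<^sup>2\<close> function near each relatively interior point of \<open>\<Gamma>\<close>. The end points of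
  \<open>Gam \<gamma>\<close> are corners of \<open>Dom \<gamma>\<close>, so nothing can be required there.
\<close>

definition C2_boundary_portion :: "(real^2) set \<Rightarrow> (real^2) set \<Rightarrow> bool" where
  "C2_boundary_portion \<Omega> \<Gamma> \<longleftrightarrow>
     (\<forall>p \<in> top_of_set (frontier \<Omega>) interior_of \<Gamma>.
        \<exists>U \<Phi>. open U \<and> p \<in> U \<and> Ck_on 2 U \<Phi> \<and>
              (\<forall>x\<in>U. frechet_derivative \<Phi> (at x) \<noteq> (\<lambda>h. 0)) \<and>
              frontier \<Omega> \<inter> U = {x \<in> U. \<Phi> x = 0})"

text \<open>
  Functions on \<open>Gam \<gamma>\<close> are identified with functions of \<open>t \<in> (0,1)\<close> through the chart
  \<open>t \<mapsto> (t, \<gamma> t)\<close>, which is bi-Lipschitz; so arc length and \<open>dt\<close> give the same \<open>L\<^sup>2\<close> space.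
\<close>

definition graph_pt :: "(real \<Rightarrow> real) \<Rightarrow> real \<Rightarrow> real^2" where
  "graph_pt \<gamma> t = vector [t, \<gamma> t]"

text \<open>
  \<open>g\<close> is the trace of \<open>u \<in> H\<^sup>1(Dom \<gamma>)\<close> on \<open>Gam \<gamma>\<close>: the limit of the restrictions to \<open>Gam \<gamma>\<close> of
  functions, smooth up to the boundary, that approximate \<open>u\<close> in \<open>H\<^sup>1\<close>.
\<close>

definition is_trace_on_Gam ::
    "(real \<Rightarrow> real) \<Rightarrow> (real^2 \<Rightarrow> real) \<Rightarrow> (real \<Rightarrow> real) \<Rightarrow> bool" where
  "is_trace_on_Gam \<gamma> u g \<longleftrightarrow>
     u \<in> H1 (Dom \<gamma>) \<and> g \<in> L2 {0<..<1} \<and>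
     (\<exists>\<phi>. (\<forall>n. smooth_fun (\<phi> n)) \<and>
          (\<lambda>n. H1_norm (Dom \<gamma>) (\<lambda>x. u x - \<phi> n x)) \<longlonglongrightarrow> 0 \<and>
          (\<lambda>n. L2_norm {0<..<1} (\<lambda>t. \<phi> n (graph_pt \<gamma> t) - g t)) \<longlonglongrightarrow> 0)"

definition trace_in_H32 ::
    "(real \<Rightarrow> real) \<Rightarrow> (real^2) set \<Rightarrow> (real^2 \<Rightarrow> real) \<Rightarrow> bool" where
  "trace_in_H32 \<gamma> \<Gamma>e u \<longleftrightarrow>
     (\<exists>g. is_trace_on_Gam \<gamma> u g \<and> g \<in> H32 {t \<in> {0<..<1}. graph_pt \<gamma> t \<in> \<Gamma>e})"


section \<open>The Boussinesq system and its adjoint\<close>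

definition e2 :: "real^2" where
  "e2 = vector [0, 1]"

definition mean :: "(real^2) set \<Rightarrow> (real^2 \<Rightarrow> real) \<Rightarrow> real" where
  "mean \<Omega> T = (1 / measure lebesgue \<Omega>) * (LINT x|lebesgue_on \<Omega>. T x)"

definition boussinesq_weak_sol ::
    "(real^2) set \<Rightarrow> real \<Rightarrow> real \<Rightarrow> real \<Rightarrow>
     (real^2 \<Rightarrow> real^2) \<Rightarrow> (real^2 \<Rightarrow> real) \<Rightarrow> (real^2 \<Rightarrow> real) \<Rightarrow>
     (real^2 \<Rightarrow> real^2) \<Rightarrow> (real^2 \<Rightarrow> real) \<Rightarrow> bool" where
  "boussinesq_weak_sol \<Omega> Rey Pra Gra g1 g2 Td v T \<longleftrightarrow>
     v \<in> V_space \<Omega> \<and> T \<in> H1 \<Omega> \<and> (\<lambda>x. T x - Td x) \<in> H01 \<Omega> \<and>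
     (\<forall>\<phi>\<in>V_space \<Omega>.
        (LINT x|lebesgue_on \<Omega>. (vgrad \<Omega> v x *v v x) \<bullet> \<phi> x)
        + 1 / Rey * (LINT x|lebesgue_on \<Omega>. vgrad \<Omega> v x \<bullet> vgrad \<Omega> \<phi> x)
        - Gra / Rey\<^sup>2 * (LINT x|lebesgue_on \<Omega>. (T x *\<^sub>R e2) \<bullet> \<phi> x)
        = (LINT x|lebesgue_on \<Omega>. g1 x \<bullet> \<phi> x)) \<and>
     (\<forall>\<phi>\<in>H01 \<Omega>.
        (LINT x|lebesgue_on \<Omega>. (v x \<bullet> weak_grad \<Omega> T x) * \<phi> x)
        + 1 / (Rey * Pra) * (LINT x|lebesgue_on \<Omega>. weak_grad \<Omega> T x \<bullet> weak_grad \<Omega> \<phi> x)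
        = (LINT x|lebesgue_on \<Omega>. g2 x * \<phi> x))"

definition adjoint_weak_sol ::
    "(real^2) set \<Rightarrow> real \<Rightarrow> real \<Rightarrow> real \<Rightarrow>
     (real^2 \<Rightarrow> real^2) \<Rightarrow> (real^2 \<Rightarrow> real) \<Rightarrow>
     (real^2 \<Rightarrow> real^2) \<Rightarrow> (real^2 \<Rightarrow> real) \<Rightarrow> bool" where
  "adjoint_weak_sol \<Omega> Rey Pra Gra v T w S \<longleftrightarrow>
     w \<in> V_space \<Omega> \<and> S \<in> H01 \<Omega> \<and>
     (\<forall>\<phi>\<in>V_space \<Omega>.
        - (LINT x|lebesgue_on \<Omega>. (vgrad \<Omega> w x *v v x) \<bullet> \<phi> x)
        + (LINT x|lebesgue_on \<Omega>. (vgrad \<Omega> v x *v w x) \<bullet> \<phi> x)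
        + (LINT x|lebesgue_on \<Omega>. (\<phi> x \<bullet> weak_grad \<Omega> T x) * S x)
        + 1 / Rey * (LINT x|lebesgue_on \<Omega>. vgrad \<Omega> w x \<bullet> vgrad \<Omega> \<phi> x)
        = 0) \<and>
     (\<forall>\<phi>\<in>H01 \<Omega>.
        - (LINT x|lebesgue_on \<Omega>. (v x \<bullet> weak_grad \<Omega> S x) * \<phi> x)
        + 1 / (Rey * Pra) * (LINT x|lebesgue_on \<Omega>. weak_grad \<Omega> S x \<bullet> weak_grad \<Omega> \<phi> x)
        - Gra / Rey\<^sup>2 * (LINT x|lebesgue_on \<Omega>. (w x \<bullet> e2) * \<phi> x)
        = (LINT x|lebesgue_on \<Omega>. (T x - mean \<Omega> T) * \<phi> x))"

text \<open>Unique existence of a pair of functions up to equality almost everywhere in \<open>\<Omega>\<close>.\<close>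

definition ex1_ae ::
    "(real^2) set \<Rightarrow> ((real^2 \<Rightarrow> real^2) \<Rightarrow> (real^2 \<Rightarrow> real) \<Rightarrow> bool) \<Rightarrow> bool" where
  "ex1_ae \<Omega> P \<longleftrightarrow>
     (\<exists>u f. P u f \<and>
        (\<forall>u' f'. P u' f' \<longrightarrow> (AE x in lebesgue_on \<Omega>. u' x = u x \<and> f' x = f x)))"

end

(* After multiplication by Re and Re Pr, the Boussinesq system for (v, T - T_d) becomes one equation
   <x, y> + l(x, y) + B(x, x, y) = f(y) in the Hilbert space V x H^1_0, normed by the gradients.
   Poincare's inequality in the strip 0 < x_1 < 1 and Ladyzhenskaya's inequality
   |u w|_2 <= 4 |grad u|_2 |grad w|_2 bound f, l and B by constants that are small under the
   smallness hypotheses. Riesz representation and a contraction in a small ball give a solution;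
   since B(x, y, y) = 0, every solution lies in that ball, which gives uniqueness. The adjoint system
   is the linear case B = 0. The components of w and S lie in H^1_0, so their traces on the graph of
   gamma vanish, hence belong to H^(3/2). *)
theory Submission
  imports Defs "HOL-Computational_Algebra.Polynomial"
begin

section \<open>Smooth functions\<close>

text \<open>The gradient \<open>weak_grad\<close> is picked by a choice operator, so it is linear
  only almost everywhere, and elements of the spaces are functions rather than classes. Two devices
  absorb this: the predicate \<open>h01\<close>, which carries the gradient as an explicit argument
  with approximating test functions, and a Hilbert space theory for a merely semidefinite form.
  Identifying \<open>weak_grad\<close> with the carried gradient is where uniqueness of weak
  gradients, and hence the bump functions, come in. The estimates are made for test functions on the
  whole plane and then passed to limits, so their constants depend only on the width 1 of the strip;
  hence the fixed number 1/100 can serve for all thresholds. The multipliers give both Laplacians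
  the coefficient 1. Buoyancy then carries Gra / Rey in the state system and Gra Pra / Rey in the
  adjoint one; these two coefficients are the origin of min(Re, Re^2). The lift by T_d leaves a term
  that is not antisymmetric, but it is linear and the gradient of T_d keeps it small.\<close>

lemma Ck_on_const: "Ck_on k U (\<lambda>x. c)"
proof (induction k arbitrary: c)
  case (Suc k)
  show ?case
    using Suc[of 0] by (auto intro!: exI[of _ "\<lambda>x. 0"])
qed simp

lemma Ck_on_SucE:
  assumes "Ck_on (Suc k) U f"
  obtains g where "\<And>x. x \<in> U \<Longrightarrow> (f has_derivative (\<lambda>h. g x \<bullet> h)) (at x)"
    "\<And>b. b \<in> Basis \<Longrightarrow> Ck_on k U (\<lambda>x. g x \<bullet> b)"
  using assms unfolding Ck_on.simps by blast

text \<open>The product rule multiplies a function of class C^(k+1) by a derivative of class C^k;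
  lowering the former by one order is what lets the induction for products close.\<close>

lemma Ck_on_Suc_imp: "Ck_on (Suc k) U f \<Longrightarrow> Ck_on k U f"
proof (induction k arbitrary: f)
  case 0
  then show ?case
    by (elim Ck_on_SucE) (auto intro!: continuous_at_imp_continuous_on dest!: has_derivative_continuous)
next
  case (Suc k)
  then obtain g where g: "\<forall>x\<in>U. (f has_derivative (\<lambda>h. g x \<bullet> h)) (at x)"
      "\<forall>b\<in>Basis. Ck_on (Suc k) U (\<lambda>x. g x \<bullet> b)"
    by (metis Ck_on.simps(2))
  then have "\<forall>b\<in>Basis. Ck_on k U (\<lambda>x. g x \<bullet> b)"
    using Suc.IH by blast
  with g(1) show ?case by auto
qed

lemma Ck_on_add: "Ck_on k U f \<Longrightarrow> Ck_on k U g \<Longrightarrow> Ck_on k U (\<lambda>x. f x + g x)"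
proof (induction k arbitrary: f g)
  case 0
  then show ?case by (auto intro: continuous_intros)
next
  case (Suc k)
  obtain F where
    F: "\<And>x. x \<in> U \<Longrightarrow> (f has_derivative (\<lambda>h. F x \<bullet> h)) (at x)" "\<And>b. b \<in> Basis \<Longrightarrow> Ck_on k U (\<lambda>x. F x \<bullet> b)"
    by (rule Ck_on_SucE[OF Suc.prems(1)]) (rule that)
  obtain G where
    G: "\<And>x. x \<in> U \<Longrightarrow> (g has_derivative (\<lambda>h. G x \<bullet> h)) (at x)" "\<And>b. b \<in> Basis \<Longrightarrow> Ck_on k U (\<lambda>x. G x \<bullet> b)"
    by (rule Ck_on_SucE[OF Suc.prems(2)]) (rule that)
  show ?case
    unfolding Ck_on.simps
  proof (intro exI[of _ "\<lambda>x. F x + G x"] conjI ballI)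
    show "((\<lambda>x. f x + g x) has_derivative (\<lambda>h. (F x + G x) \<bullet> h)) (at x)" if "x \<in> U" for x
      using has_derivative_add[OF F(1)[OF that] G(1)[OF that]] by (simp add: inner_add_left)
    show "Ck_on k U (\<lambda>x. (F x + G x) \<bullet> b)" if "b \<in> Basis" for b
      using Suc.IH[OF F(2)[OF that] G(2)[OF that]] by (simp add: inner_add_left)
  qed
qed

lemma Ck_on_mult: "Ck_on k U f \<Longrightarrow> Ck_on k U g \<Longrightarrow> Ck_on k U (\<lambda>x. f x * g x)"
proof (induction k arbitrary: f g)
  case 0
  then show ?case by (auto intro: continuous_intros)
next
  case (Suc k)
  obtain F where
    F: "\<And>x. x \<in> U \<Longrightarrow> (f has_derivative (\<lambda>h. F x \<bullet> h)) (at x)" "\<And>b. b \<in> Basis \<Longrightarrow> Ck_on k U (\<lambda>x. F x \<bullet> b)"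
    by (rule Ck_on_SucE[OF Suc.prems(1)]) (rule that)
  obtain G where
    G: "\<And>x. x \<in> U \<Longrightarrow> (g has_derivative (\<lambda>h. G x \<bullet> h)) (at x)" "\<And>b. b \<in> Basis \<Longrightarrow> Ck_on k U (\<lambda>x. G x \<bullet> b)"
    by (rule Ck_on_SucE[OF Suc.prems(2)]) (rule that)
  have fg: "Ck_on k U f" "Ck_on k U g"
    using Suc.prems by (auto intro: Ck_on_Suc_imp simp del: Ck_on.simps)
  show ?case
    unfolding Ck_on.simps
  proof (intro exI[of _ "\<lambda>x. f x *\<^sub>R G x + g x *\<^sub>R F x"] conjI ballI)
    show "((\<lambda>x. f x * g x) has_derivative (\<lambda>h. (f x *\<^sub>R G x + g x *\<^sub>R F x) \<bullet> h)) (at x)" if "x \<in> U" for x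
      by (rule has_derivative_eq_rhs[OF has_derivative_mult[OF F(1)[OF that] G(1)[OF that]]])
         (simp add: inner_add_left algebra_simps)
    show "Ck_on k U (\<lambda>x. (f x *\<^sub>R G x + g x *\<^sub>R F x) \<bullet> b)" if "b \<in> Basis" for b
      using Ck_on_add[OF Suc.IH[OF fg(1) G(2)[OF that]] Suc.IH[OF fg(2) F(2)[OF that]]]
      by (simp add: inner_add_left)
  qed
qed

lemma Ck_on_prod: "finite I \<Longrightarrow> (\<And>i. i \<in> I \<Longrightarrow> Ck_on k U (f i)) \<Longrightarrow> Ck_on k U (\<lambda>x. \<Prod>i\<in>I. f i x)"
  by (induction I rule: finite_induct) (auto intro: Ck_on_const Ck_on_mult)

lemma smooth_fun_const: "smooth_fun (\<lambda>x. c)"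
  by (simp add: smooth_fun_def Ck_on_const)

lemma smooth_fun_add: "smooth_fun f \<Longrightarrow> smooth_fun g \<Longrightarrow> smooth_fun (\<lambda>x. f x + g x)"
  by (simp add: smooth_fun_def Ck_on_add)

lemma smooth_fun_mult: "smooth_fun f \<Longrightarrow> smooth_fun g \<Longrightarrow> smooth_fun (\<lambda>x. f x * g x)"
  by (simp add: smooth_fun_def Ck_on_mult)

lemma smooth_fun_prod:
  "finite I \<Longrightarrow> (\<And>i. i \<in> I \<Longrightarrow> smooth_fun (f i)) \<Longrightarrow> smooth_fun (\<lambda>x. \<Prod>i\<in>I. f i x)"
  by (simp add: smooth_fun_def Ck_on_prod)

text \<open>A canonical choice of the witness that \<open>Ck_on\<close> only asserts to exist, so
  that linearity and the product rule become equations between functions.\<close>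

definition sgrad :: "('a::euclidean_space \<Rightarrow> real) \<Rightarrow> 'a \<Rightarrow> 'a" where
  "sgrad f x = (\<Sum>b\<in>Basis. frechet_derivative f (at x) b *\<^sub>R b)"

lemma sgrad_eqI: "(f has_derivative (\<lambda>h. g \<bullet> h)) (at x) \<Longrightarrow> sgrad f x = g"
  unfolding sgrad_def by (simp add: frechet_derivative_at[symmetric] euclidean_representation)

lemma smooth_fun_has_derivative:
  assumes "smooth_fun f"
  shows "(f has_derivative (\<lambda>h. sgrad f x \<bullet> h)) (at x)"
proof -
  have "Ck_on 1 UNIV f" using assms by (simp add: smooth_fun_def)
  then obtain g where "(f has_derivative (\<lambda>h. g x \<bullet> h)) (at x)" by auto
  with sgrad_eqI[OF this] show ?thesis by simp
qed

lemma frechet_derivative_smooth: "smooth_fun f \<Longrightarrow> frechet_derivative f (at x) h = sgrad f x \<bullet> h"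
  using frechet_derivative_at[OF smooth_fun_has_derivative] by metis

lemma smooth_fun_continuous: "smooth_fun f \<Longrightarrow> continuous_on A f"
  unfolding smooth_fun_def using Ck_on.simps(1) continuous_on_subset by (metis subset_UNIV)

lemma continuous_on_sgrad:
  assumes "smooth_fun f"
  shows "continuous_on A (sgrad f)"
proof -
  have "Ck_on (Suc 0) UNIV f" using assms by (simp add: smooth_fun_def del: Ck_on.simps)
  then obtain g where g: "\<And>x. (f has_derivative (\<lambda>h. g x \<bullet> h)) (at x)"
     "\<And>b. b \<in> Basis \<Longrightarrow> continuous_on UNIV (\<lambda>x. g x \<bullet> b)"
    by auto
  have "sgrad f = g" using sgrad_eqI[OF g(1)] by auto
  moreover have "continuous_on UNIV g"
    using g(2) by (subst continuous_on_componentwise) auto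
  ultimately show ?thesis using continuous_on_subset by blast
qed

lemma sgrad_lincomb:
  assumes "smooth_fun f" "smooth_fun g"
  shows "sgrad (\<lambda>x. a * f x + b * g x) x = a *\<^sub>R sgrad f x + b *\<^sub>R sgrad g x"
  by (rule sgrad_eqI, rule has_derivative_eq_rhs,
      rule has_derivative_add[OF has_derivative_mult_right has_derivative_mult_right],
      (rule smooth_fun_has_derivative, rule assms)+) (simp add: inner_add_left)

lemma sgrad_mult:
  assumes "smooth_fun f" "smooth_fun g"
  shows "sgrad (\<lambda>x. f x * g x) x = f x *\<^sub>R sgrad g x + g x *\<^sub>R sgrad f x"
  by (rule sgrad_eqI, rule has_derivative_eq_rhs, rule has_derivative_mult,
      (rule smooth_fun_has_derivative, rule assms)+) (simp add: inner_add_left algebra_simps)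

lemma smooth_fun_lincomb:
  "smooth_fun f \<Longrightarrow> smooth_fun g \<Longrightarrow> smooth_fun (\<lambda>x. a * f x + b * g x)"
  by (intro smooth_fun_add smooth_fun_mult smooth_fun_const)

lemma test_funs_smooth: "\<phi> \<in> test_funs S \<Longrightarrow> smooth_fun \<phi>"
  by (simp add: test_funs_def)

text \<open>One compact set serves for the function and its gradient: its complement is open and the
  function vanishes identically there.\<close>

lemma test_funsE:
  assumes "\<phi> \<in> test_funs S"
  obtains K where "compact K" "K \<subseteq> S" "\<And>x. x \<notin> K \<Longrightarrow> \<phi> x = 0" "\<And>x. x \<notin> K \<Longrightarrow> sgrad \<phi> x = 0"
proof -
  from assms obtain K where K: "compact K" "K \<subseteq> S" "\<And>x. x \<notin> K \<Longrightarrow> \<phi> x = 0"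
    by (auto simp: test_funs_def)
  have "sgrad \<phi> x = 0" if "x \<notin> K" for x
  proof (rule sgrad_eqI)
    have "((\<lambda>x. 0) has_derivative (\<lambda>h. 0 \<bullet> h)) (at x)" by simp
    moreover have "open (- K)" "x \<in> - K" using K that by (auto simp: compact_imp_closed)
    ultimately show "(\<phi> has_derivative (\<lambda>h. 0 \<bullet> h)) (at x)"
      by (rule has_derivative_transform_within_open) (use K(3) in auto)
  qed
  with K that show ?thesis by blast
qed

lemma test_funs_outside: "\<phi> \<in> test_funs S \<Longrightarrow> x \<notin> S \<Longrightarrow> \<phi> x = 0"
  by (erule test_funsE) blast

lemma sgrad_outside: "\<phi> \<in> test_funs S \<Longrightarrow> x \<notin> S \<Longrightarrow> sgrad \<phi> x = 0"
  by (erule test_funsE) blast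

lemma test_funs_mono: "S \<subseteq> S' \<Longrightarrow> \<phi> \<in> test_funs S \<Longrightarrow> \<phi> \<in> test_funs S'"
  unfolding test_funs_def by blast

lemma test_funs_zero: "(\<lambda>x. 0) \<in> test_funs S"
  unfolding test_funs_def using smooth_fun_const by (auto intro: exI[of _ "{}"])

lemma test_funs_lincomb:
  assumes "\<phi> \<in> test_funs S" "\<psi> \<in> test_funs S"
  shows "(\<lambda>x. a * \<phi> x + b * \<psi> x) \<in> test_funs S"
proof -
  obtain K K' where "compact K" "K \<subseteq> S" "\<And>x. x \<notin> K \<Longrightarrow> \<phi> x = 0"
    and "compact K'" "K' \<subseteq> S" "\<And>x. x \<notin> K' \<Longrightarrow> \<psi> x = 0"
    using assms by (meson test_funsE)
  then show ?thesis
    using assms by (auto simp: test_funs_def smooth_fun_lincomb intro!: exI[of _ "K \<union> K'"] compact_Un)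
qed

lemma test_funs_mult:
  assumes "\<phi> \<in> test_funs S" "smooth_fun \<psi>"
  shows "(\<lambda>x. \<phi> x * \<psi> x) \<in> test_funs S"
proof -
  obtain K where "compact K" "K \<subseteq> S" "\<And>x. x \<notin> K \<Longrightarrow> \<phi> x = 0"
    using assms(1) by (meson test_funsE)
  then show ?thesis
    using assms by (auto simp: test_funs_def smooth_fun_mult intro!: exI[of _ K])
qed


subsection \<open>Bump functions\<close>

text \<open>Carrying a polynomial in 1/t makes the family closed under differentiation, so that
  smoothness of exp(-1/t) follows by an induction with \<open>p\<close> arbitrary.\<close>

definition flat :: "real poly \<Rightarrow> real \<Rightarrow> real" where
  "flat p t = (if t > 0 then poly p (1 / t) * exp (- (1 / t)) else 0)"

lemma tendsto_poly_exp: "((\<lambda>s. poly p s * exp (- s)) \<longlongrightarrow> (0::real)) at_top"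
proof -
  have "((\<lambda>s. \<Sum>i\<le>degree p. coeff p i * (s ^ i / exp s)) \<longlongrightarrow> (\<Sum>i\<le>degree p. coeff p i * 0)) at_top"
    by (intro tendsto_sum tendsto_mult tendsto_const tendsto_power_div_exp_0)
  then show ?thesis
    by (simp add: poly_altdef exp_minus field_simps sum_divide_distrib)
qed

text \<open>With s = 1/t one has ds/dt = -s^2, so p(s) exp(-s) has the derivative s^2 (p - p')(s)
  exp(-s); the factor \<open>[:0, 0, 1:]\<close> is s^2. Only t = 0 needs a limit.\<close>

lemma flat_has_real_derivative:
  "(flat p has_real_derivative flat ([:0, 0, 1:] * (p - pderiv p)) t) (at t)"
proof -
  consider "t > 0" | "t < 0" | "t = 0" by linarith
  then show ?thesis
  proof cases
    case 1
    have "((\<lambda>t. poly p (1 / t) * exp (- (1 / t))) has_real_derivative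
        flat ([:0, 0, 1:] * (p - pderiv p)) t) (at t)"
      using 1 by (auto intro!: derivative_eq_intros DERIV_chain2[OF poly_DERIV]
          simp: flat_def field_simps power2_eq_square)
    then show ?thesis
      by (rule has_field_derivative_transform_within_open[of _ _ _ "{0<..}"]) (use 1 in \<open>auto simp: flat_def\<close>)
  next
    case 2
    have "((\<lambda>t. 0) has_real_derivative flat ([:0, 0, 1:] * (p - pderiv p)) t) (at t)"
      using 2 by (simp add: flat_def)
    then show ?thesis
      by (rule has_field_derivative_transform_within_open[of _ _ _ "{..<0}"]) (use 2 in \<open>auto simp: flat_def\<close>)
  next
    case 3
    \<comment> \<open>For h > 0 and s = 1/h the quotient is s p(s) exp(-s), and s p(s) is
      \<open>pCons 0 p\<close>: again a polynomial times a decaying exponential.\<close>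
    have "((\<lambda>h. flat p h / h) \<longlongrightarrow> 0) (at_right 0)"
    proof (rule Lim_transform_eventually)
      show "((\<lambda>h. poly (pCons 0 p) (inverse h) * exp (- inverse h)) \<longlongrightarrow> 0) (at_right (0::real))"
        by (rule filterlim_compose[OF tendsto_poly_exp filterlim_inverse_at_top_right])
      show "\<forall>\<^sub>F h in at_right 0. poly (pCons 0 p) (inverse h) * exp (- inverse h) = flat p h / h"
        using eventually_at_right_less[of 0]
        by eventually_elim (simp add: flat_def field_simps)
    qed
    moreover have "((\<lambda>h. flat p h / h) \<longlongrightarrow> 0) (at_left 0)"
      by (rule tendsto_eventually) (simp add: eventually_at_filter flat_def)
    ultimately have "((\<lambda>h. flat p h / h) \<longlongrightarrow> 0) (at 0)"
      by (simp add: filterlim_at_split)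
    then show ?thesis
      using 3 by (simp add: has_field_derivative_def DERIV_def[unfolded has_field_derivative_def] flat_def)
  qed
qed

text \<open>Affine inner functions keep the chain rule trivial: the gradient is another member of
  the family times the constant vector \<open>a\<close>, so the induction hypothesis applies to
  it.\<close>

lemma smooth_fun_flat: "smooth_fun (\<lambda>x. flat p (x \<bullet> a + c))"
proof -
  have "Ck_on k UNIV (\<lambda>x. flat p (x \<bullet> a + c))" for k
  proof (induction k arbitrary: p)
    case 0
    have "continuous_on UNIV (flat p)"
      using flat_has_real_derivative DERIV_continuous_on by (metis DERIV_isCont continuous_at_imp_continuous_on)
    then show ?case
      by (auto intro!: continuous_on_compose2[of UNIV "flat p"] continuous_intros)
  next
    case (Suc k)
    let ?q = "[:0, 0, 1:] * (p - pderiv p)"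
    show ?case
      unfolding Ck_on.simps
    proof (intro exI[of _ "\<lambda>x. flat ?q (x \<bullet> a + c) *\<^sub>R a"] conjI ballI)
      fix x :: 'a
      have "((\<lambda>x. x \<bullet> a + c) has_derivative (\<lambda>h. h \<bullet> a)) (at x)"
        by (auto intro!: derivative_eq_intros)
      from has_derivative_compose[OF this flat_has_real_derivative[of p "x \<bullet> a + c", unfolded has_field_derivative_def]]
      show "((\<lambda>x. flat p (x \<bullet> a + c)) has_derivative (\<lambda>h. (flat ?q (x \<bullet> a + c) *\<^sub>R a) \<bullet> h)) (at x)"
        by (simp add: inner_commute)
    next
      fix b :: 'a
      show "Ck_on k UNIV (\<lambda>x. (flat ?q (x \<bullet> a + c) *\<^sub>R a) \<bullet> b)"
        using Ck_on_mult[OF Suc[of ?q] Ck_on_const[of k UNIV "a \<bullet> b"]] by simp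
    qed
  qed
  then show ?thesis by (simp add: smooth_fun_def)
qed

text \<open>Each coordinate contributes exp(-1/(n (x_b - l_b))) exp(-1/(n (u_b - x_b))). The zero
  set does not change with n, whereas growing n lifts the values inside the box towards 1.\<close>

definition bump :: "'a::euclidean_space \<Rightarrow> 'a \<Rightarrow> nat \<Rightarrow> 'a \<Rightarrow> real" where
  "bump l u n x = (\<Prod>b\<in>Basis. flat 1 (x \<bullet> (real n *\<^sub>R b) + - real n * (l \<bullet> b)) *
                              flat 1 (x \<bullet> (- real n *\<^sub>R b) + real n * (u \<bullet> b)))"

lemma flat_1: "flat 1 t = (if t > 0 then exp (- (1 / t)) else 0)"
  by (simp add: flat_def)

lemma flat_1_bounds: "0 \<le> flat 1 t" "flat 1 t \<le> 1"
  by (auto simp: flat_1)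

lemma bump_bounds: "0 \<le> bump l u n x" "bump l u n x \<le> 1"
  unfolding bump_def
  by (auto intro!: prod_nonneg prod_le_1 mult_nonneg_nonneg mult_le_one flat_1_bounds)

lemma bump_outside: "x \<notin> box l u \<Longrightarrow> bump l u n x = 0"
  by (auto simp: bump_def mem_box flat_1 not_less right_diff_distrib[symmetric] zero_less_mult_iff
      intro!: prod_zero bexI)

lemma bump_test_funs:
  assumes "cbox l u \<subseteq> S"
  shows "bump l u n \<in> test_funs S"
proof -
  have "smooth_fun (bump l u n)"
    unfolding bump_def by (intro smooth_fun_prod smooth_fun_mult smooth_fun_flat) auto
  moreover have "bump l u n x = 0" if "x \<notin> cbox l u" for x
    using bump_outside that box_subset_cbox by blast
  ultimately show ?thesis
    using assms unfolding test_funs_def by (auto intro!: exI[of _ "cbox l u"])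
qed

lemma flat_1_tendsto:
  assumes "t > 0"
  shows "(\<lambda>n. flat 1 (real n * t)) \<longlonglongrightarrow> 1"
proof (rule Lim_transform_eventually)
  show "(\<lambda>n. exp (- (1 / t * inverse (real n)))) \<longlonglongrightarrow> 1"
    by (rule tendsto_eq_intros LIMSEQ_inverse_real_of_nat lim_inverse_n tendsto_const refl | simp)+
  show "\<forall>\<^sub>F n in sequentially. exp (- (1 / t * inverse (real n))) = flat 1 (real n * t)"
    using eventually_gt_at_top[of 0] by eventually_elim (use assms in \<open>simp add: flat_1 field_simps\<close>)
qed

text \<open>With the bounds 0 and 1 this lets dominated convergence replace smooth test functions by
  indicators of boxes.\<close>

lemma bump_tendsto: "(\<lambda>n. bump l u n x) \<longlonglongrightarrow> indicator (box l u) x"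
proof (cases "x \<in> box l u")
  case True
  have "(\<lambda>n. \<Prod>b\<in>Basis. flat 1 (real n * ((x - l) \<bullet> b)) * flat 1 (real n * ((u - x) \<bullet> b))) \<longlonglongrightarrow> (\<Prod>b\<in>(Basis::'a set). 1 * 1)"
    using True by (intro tendsto_prod tendsto_mult flat_1_tendsto) (auto simp: mem_box inner_diff_left)
  then show ?thesis
    using True by (simp add: bump_def inner_diff_left algebra_simps)
next
  case False
  then show ?thesis by (simp add: bump_outside)
qed

section \<open>The space of square integrable functions\<close>

lemma L2_measurable: "f \<in> L2 S \<Longrightarrow> f \<in> borel_measurable (lebesgue_on S)"
  by (simp add: L2_def)

lemma L2_integrable_norm: "f \<in> L2 S \<Longrightarrow> integrable (lebesgue_on S) (\<lambda>x. (norm (f x))\<^sup>2)"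
  by (simp add: L2_def)

lemma L2_norm_nonneg [simp]: "0 \<le> L2_norm S f"
  by (simp add: L2_norm_def)

lemma L2_norm_sq: "(L2_norm S f)\<^sup>2 = (LINT x|lebesgue_on S. (norm (f x))\<^sup>2)"
  by (simp add: L2_norm_def)

lemma L2_norm_leI: "(LINT x|lebesgue_on S. (norm (f x))\<^sup>2) \<le> C\<^sup>2 \<Longrightarrow> 0 \<le> C \<Longrightarrow> L2_norm S f \<le> C"
  unfolding L2_norm_def by (rule real_le_lsqrt) auto

lemma L2I_dominated:
  assumes "f \<in> borel_measurable (lebesgue_on S)" and "integrable (lebesgue_on S) g"
    and "\<And>x. (norm (f x))\<^sup>2 \<le> g x"
  shows "f \<in> L2 S"
  unfolding L2_def
proof safe
  show "integrable (lebesgue_on S) (\<lambda>x. (norm (f x))\<^sup>2)"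
  proof (rule Bochner_Integration.integrable_bound[OF assms(2)])
    show "(\<lambda>x. (norm (f x))\<^sup>2) \<in> borel_measurable (lebesgue_on S)"
      using assms(1) by measurable
    show "AE x in lebesgue_on S. norm ((norm (f x))\<^sup>2) \<le> norm (g x)"
      using assms(3) by (intro AE_I2) (smt (verit) real_norm_def zero_le_power2)
  qed
qed (use assms(1) in simp)

lemma L2_zero [simp]: "(\<lambda>x. 0) \<in> L2 S"
  by (simp add: L2_def)

lemma L2_scaleR:
  assumes "f \<in> L2 S"
  shows "(\<lambda>x. c *\<^sub>R f x) \<in> L2 S"
  by (rule L2I_dominated[of _ _ "\<lambda>x. c\<^sup>2 * (norm (f x))\<^sup>2"])
     (use L2_measurable[OF assms] L2_integrable_norm[OF assms] in \<open>auto simp: power_mult_distrib\<close>)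

lemma L2_add:
  assumes "f \<in> L2 S" "g \<in> L2 S"
  shows "(\<lambda>x. f x + g x) \<in> L2 S"
proof (rule L2I_dominated[of _ _ "\<lambda>x. 2 * (norm (f x))\<^sup>2 + 2 * (norm (g x))\<^sup>2"])
  show "(norm (f x + g x))\<^sup>2 \<le> 2 * (norm (f x))\<^sup>2 + 2 * (norm (g x))\<^sup>2" for x
  proof -
    have "(norm (f x + g x))\<^sup>2 \<le> (norm (f x) + norm (g x))\<^sup>2"
      by (intro power_mono norm_triangle_ineq) auto
    also have "\<dots> \<le> 2 * (norm (f x))\<^sup>2 + 2 * (norm (g x))\<^sup>2"
      using sum_squares_bound[of "norm (f x)" "norm (g x)"] by (simp add: power2_sum)
    finally show ?thesis .
  qed
  show "(\<lambda>x. f x + g x) \<in> borel_measurable (lebesgue_on S)"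
    by (intro borel_measurable_add L2_measurable assms)
  show "integrable (lebesgue_on S) (\<lambda>x. 2 * (norm (f x))\<^sup>2 + 2 * (norm (g x))\<^sup>2)"
    by (intro Bochner_Integration.integrable_add integrable_mult_right L2_integrable_norm assms)
qed

lemma L2_diff:
  assumes "f \<in> L2 S" "g \<in> L2 S"
  shows "(\<lambda>x. f x - g x) \<in> L2 S"
  using L2_add[OF assms(1) L2_scaleR[OF assms(2), of "-1"]] by simp

lemma L2_cmult:
  fixes f :: "'a::euclidean_space \<Rightarrow> real"
  shows "f \<in> L2 S \<Longrightarrow> (\<lambda>x. c * f x) \<in> L2 S"
  using L2_scaleR[of f S c] by simp

lemma L2_le:
  assumes "f \<in> borel_measurable (lebesgue_on S)" "g \<in> L2 S" "\<And>x. norm (f x) \<le> norm (g x)"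
  shows "f \<in> L2 S"
  using L2I_dominated[OF assms(1) L2_integrable_norm[OF assms(2)]] assms(3)
  by (simp add: power_mono)

lemma L2_component:
  assumes "f \<in> L2 S"
  shows "(\<lambda>x. f x \<bullet> b) \<in> L2 S"
proof (rule L2_le[OF _ L2_scaleR[OF assms, of "norm b"]])
  show "(\<lambda>x. f x \<bullet> b) \<in> borel_measurable (lebesgue_on S)"
    using L2_measurable[OF assms] by measurable
qed (auto intro: order_trans[OF Cauchy_Schwarz_ineq2] simp: mult.commute)

lemma L2_integrable_mult_norm:
  assumes "f \<in> L2 S" "g \<in> L2 S"
  shows "integrable (lebesgue_on S) (\<lambda>x. norm (f x) * norm (g x))"
proof (rule Bochner_Integration.integrable_bound)
  show "integrable (lebesgue_on S) (\<lambda>x. (norm (f x))\<^sup>2 + (norm (g x))\<^sup>2)"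
    using assms by (simp add: L2_integrable_norm)
  show "(\<lambda>x. norm (f x) * norm (g x)) \<in> borel_measurable (lebesgue_on S)"
    using assms[THEN L2_measurable] by measurable
  show "AE x in lebesgue_on S. norm (norm (f x) * norm (g x)) \<le> norm ((norm (f x))\<^sup>2 + (norm (g x))\<^sup>2)"
  proof (rule AE_I2)
    fix x
    have "0 \<le> norm (f x) * norm (g x)" by simp
    then show "norm (norm (f x) * norm (g x)) \<le> norm ((norm (f x))\<^sup>2 + (norm (g x))\<^sup>2)"
      using sum_squares_bound[of "norm (f x)" "norm (g x)"] unfolding real_norm_def by linarith
  qed
qed

lemma L2_integrable_inner:
  assumes "f \<in> L2 S" "g \<in> L2 S"
  shows "integrable (lebesgue_on S) (\<lambda>x. f x \<bullet> g x)"
  by (rule Bochner_Integration.integrable_bound[OF L2_integrable_mult_norm[OF assms]])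
     (use assms[THEN L2_measurable] Cauchy_Schwarz_ineq2 in \<open>auto\<close>)

lemma L2_integrable_mult:
  fixes f g :: "'a::euclidean_space \<Rightarrow> real"
  assumes "f \<in> L2 S" "g \<in> L2 S"
  shows "integrable (lebesgue_on S) (\<lambda>x. f x * g x)"
  using L2_integrable_inner[OF assms] by simp

lemma L2_norm_eq_0_iff:
  assumes "f \<in> L2 S"
  shows "L2_norm S f = 0 \<longleftrightarrow> (AE x in lebesgue_on S. f x = 0)"
  using integral_nonneg_eq_0_iff_AE[OF L2_integrable_norm[OF assms]] by (simp add: L2_norm_def)

lemma L2_norm_cong_AE:
  assumes "f \<in> L2 S" "g \<in> L2 S" "AE x in lebesgue_on S. f x = g x"
  shows "L2_norm S f = L2_norm S g"
  unfolding L2_norm_def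
  by (intro arg_cong[where f=sqrt] integral_cong_AE borel_measurable_integrable L2_integrable_norm assms)
     (use assms(3) in auto)

text \<open>Young's inequality with weights made from the two norms. Since the weights divide by the
  norms, a vanishing norm is treated first, through almost everywhere vanishing.\<close>

lemma L2_Cauchy_Schwarz_norm:
  assumes "f \<in> L2 S" "g \<in> L2 S"
  shows "(LINT x|lebesgue_on S. norm (f x) * norm (g x)) \<le> L2_norm S f * L2_norm S g"
proof (cases "L2_norm S f = 0 \<or> L2_norm S g = 0")
  case True
  then have "(AE x in lebesgue_on S. f x = 0) \<or> (AE x in lebesgue_on S. g x = 0)"
    by (simp add: L2_norm_eq_0_iff assms)
  then have "AE x in lebesgue_on S. norm (f x) * norm (g x) = 0"
    by auto
  then have "(LINT x|lebesgue_on S. norm (f x) * norm (g x)) = 0"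
    by (rule integral_eq_zero_AE)
  then show ?thesis by simp
next
  case False
  define A where "A = L2_norm S f"
  define B where "B = L2_norm S g"
  have pos: "A > 0" "B > 0"
    using False by (auto simp: A_def B_def less_le)
  \<comment> \<open>The weights are chosen so that both summands integrate to A B / 2.\<close>
  have sq: "norm (f x) * norm (g x) \<le> (B / A) / 2 * (norm (f x))\<^sup>2 + (A / B) / 2 * (norm (g x))\<^sup>2" for x
  proof -
    have "0 \<le> (B * norm (f x) - A * norm (g x))\<^sup>2 / (2 * A * B)"
      using pos by simp
    also have "\<dots> = (B / A) / 2 * (norm (f x))\<^sup>2 + (A / B) / 2 * (norm (g x))\<^sup>2 - norm (f x) * norm (g x)"
      using pos by (simp add: field_simps power2_eq_square)
    finally show ?thesis by simp
  qed
  have "(LINT x|lebesgue_on S. norm (f x) * norm (g x)) \<le>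
      (LINT x|lebesgue_on S. (B / A) / 2 * (norm (f x))\<^sup>2 + (A / B) / 2 * (norm (g x))\<^sup>2)"
    using assms by (intro integral_mono L2_integrable_mult_norm sq)
      (auto intro!: Bochner_Integration.integrable_add integrable_mult_right simp: L2_integrable_norm)
  also have "\<dots> = (B / A) / 2 * A\<^sup>2 + (A / B) / 2 * B\<^sup>2"
    using assms by (subst Bochner_Integration.integral_add)
      (auto intro!: integrable_mult_right simp: A_def B_def L2_norm_sq L2_integrable_norm)
  also have "\<dots> = A * B"
    using pos by (simp add: field_simps power2_eq_square)
  finally show ?thesis by (simp add: A_def B_def)
qed

lemma L2_Cauchy_Schwarz:
  assumes "f \<in> L2 S" "g \<in> L2 S"
  shows "\<bar>LINT x|lebesgue_on S. f x \<bullet> g x\<bar> \<le> L2_norm S f * L2_norm S g"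
proof -
  have "\<bar>LINT x|lebesgue_on S. f x \<bullet> g x\<bar> \<le> (LINT x|lebesgue_on S. \<bar>f x \<bullet> g x\<bar>)"
    by (rule integral_abs_bound)
  also have "\<dots> \<le> (LINT x|lebesgue_on S. norm (f x) * norm (g x))"
    using assms by (intro integral_mono integrable_abs L2_integrable_inner L2_integrable_mult_norm Cauchy_Schwarz_ineq2)
  finally show ?thesis using L2_Cauchy_Schwarz_norm[OF assms] by simp
qed

lemma L2_Cauchy_Schwarz_mult:
  fixes f g :: "'a::euclidean_space \<Rightarrow> real"
  assumes "f \<in> L2 S" "g \<in> L2 S"
  shows "\<bar>LINT x|lebesgue_on S. f x * g x\<bar> \<le> L2_norm S f * L2_norm S g"
  using L2_Cauchy_Schwarz[OF assms] by simp

lemma L2_norm_scaleR: "L2_norm S (\<lambda>x. c *\<^sub>R f x) = \<bar>c\<bar> * L2_norm S f"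
  by (simp add: L2_norm_def power_mult_distrib real_sqrt_mult)

lemma L2_norm_minus_commute: "L2_norm S (\<lambda>x. f x - g x) = L2_norm S (\<lambda>x. g x - f x)"
  by (simp add: L2_norm_def norm_minus_commute)

lemma L2_norm_triangle:
  assumes "f \<in> L2 S" "g \<in> L2 S"
  shows "L2_norm S (\<lambda>x. f x + g x) \<le> L2_norm S f + L2_norm S g"
proof (rule L2_norm_leI)
  have "(LINT x|lebesgue_on S. (norm (f x + g x))\<^sup>2) =
      (LINT x|lebesgue_on S. (norm (f x))\<^sup>2 + 2 * (f x \<bullet> g x) + (norm (g x))\<^sup>2)"
    by (intro Bochner_Integration.integral_cong) (auto simp: power2_norm_eq_inner inner_simps inner_commute)
  also have "\<dots> = (L2_norm S f)\<^sup>2 + 2 * (LINT x|lebesgue_on S. f x \<bullet> g x) + (L2_norm S g)\<^sup>2"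
    using assms by (simp add: L2_norm_sq L2_integrable_norm L2_integrable_inner)
  also have "\<dots> \<le> (L2_norm S f + L2_norm S g)\<^sup>2"
    using L2_Cauchy_Schwarz[OF assms] by (simp add: power2_sum)
  finally show "(LINT x|lebesgue_on S. (norm (f x + g x))\<^sup>2) \<le> (L2_norm S f + L2_norm S g)\<^sup>2" .
qed auto

lemma L2_norm_triangle_diff:
  assumes "f \<in> L2 S" "g \<in> L2 S" "h \<in> L2 S"
  shows "L2_norm S (\<lambda>x. f x - h x) \<le> L2_norm S (\<lambda>x. f x - g x) + L2_norm S (\<lambda>x. g x - h x)"
  using L2_norm_triangle[OF L2_diff[OF assms(1,2)] L2_diff[OF assms(2,3)]] by simp

lemma L2_norm_mono:
  assumes "f \<in> borel_measurable (lebesgue_on S)" "g \<in> L2 S" "\<And>x. norm (f x) \<le> norm (g x)"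
  shows "L2_norm S f \<le> L2_norm S g"
  unfolding L2_norm_def
  by (intro real_sqrt_le_mono integral_mono L2_integrable_norm power_mono L2_le[OF assms] assms) auto

section \<open>Limits in L2, Fatou's lemma and completeness\<close>

lemma L2_tendsto_integral:
  assumes f: "\<And>n. f n \<in> L2 S" "g \<in> L2 S" "(\<lambda>n. L2_norm S (\<lambda>x. f n x - g x)) \<longlonglongrightarrow> 0"
    and h: "h \<in> L2 S"
  shows "(\<lambda>n. LINT x|lebesgue_on S. f n x \<bullet> h x) \<longlonglongrightarrow> (LINT x|lebesgue_on S. g x \<bullet> h x)"
proof -
  have "(\<lambda>n. (LINT x|lebesgue_on S. f n x \<bullet> h x) - (LINT x|lebesgue_on S. g x \<bullet> h x)) \<longlonglongrightarrow> 0"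
  proof (rule Lim_null_comparison)
    show "(\<lambda>n. L2_norm S (\<lambda>x. f n x - g x) * L2_norm S h) \<longlonglongrightarrow> 0"
      using tendsto_mult_right[OF f(3), of "L2_norm S h"] by simp
    show "\<forall>\<^sub>F n in sequentially. norm ((LINT x|lebesgue_on S. f n x \<bullet> h x) - (LINT x|lebesgue_on S. g x \<bullet> h x))
        \<le> L2_norm S (\<lambda>x. f n x - g x) * L2_norm S h"
    proof (rule eventuallyI)
      fix n
      have "(LINT x|lebesgue_on S. f n x \<bullet> h x) - (LINT x|lebesgue_on S. g x \<bullet> h x) =
          (LINT x|lebesgue_on S. (f n x - g x) \<bullet> h x)"
        using f h by (simp add: inner_diff_left L2_integrable_inner)
      then show "norm ((LINT x|lebesgue_on S. f n x \<bullet> h x) - (LINT x|lebesgue_on S. g x \<bullet> h x))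
        \<le> L2_norm S (\<lambda>x. f n x - g x) * L2_norm S h"
        using L2_Cauchy_Schwarz[OF L2_diff[OF f(1)[of n] f(2)] h] by simp
    qed
  qed
  then show ?thesis by (simp add: LIM_zero_cancel)
qed

lemma L2_norm_tendsto:
  assumes f: "\<And>n. f n \<in> L2 S" "g \<in> L2 S" "(\<lambda>n. L2_norm S (\<lambda>x. f n x - g x)) \<longlonglongrightarrow> 0"
  shows "(\<lambda>n. L2_norm S (f n)) \<longlonglongrightarrow> L2_norm S g"
proof -
  have "(\<lambda>n. L2_norm S (f n) - L2_norm S g) \<longlonglongrightarrow> 0"
  proof (rule Lim_null_comparison[OF eventuallyI f(3)])
    fix n
    show "norm (L2_norm S (f n) - L2_norm S g) \<le> L2_norm S (\<lambda>x. f n x - g x)"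
      using L2_norm_triangle_diff[OF f(1)[of n] f(2) L2_zero]
        L2_norm_triangle_diff[OF f(2) f(1)[of n] L2_zero] L2_norm_minus_commute[of S g "f n"]
      by simp
  qed
  then show ?thesis by (simp add: LIM_zero_cancel)
qed

text \<open>Norm bounds survive a limit that is known only almost everywhere. Completeness and the
  product estimate both rest on this, since neither has norm convergence at its disposal.\<close>

lemma L2_Fatou:
  assumes f: "\<And>n. f n \<in> L2 S" "\<And>n. L2_norm S (f n) \<le> C n" and C: "C \<longlonglongrightarrow> c"
    and g: "g \<in> borel_measurable (lebesgue_on S)" "AE x in lebesgue_on S. (\<lambda>n. f n x) \<longlonglongrightarrow> g x"
  shows "g \<in> L2 S \<and> L2_norm S g \<le> c"
proof -
  have C0: "0 \<le> C n" for n using f(2)[of n] L2_norm_nonneg order_trans by blast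
  then have c0: "0 \<le> c" using C by (meson LIMSEQ_le_const)
  note [measurable] = L2_measurable[OF f(1)] g(1)
  have "(\<integral>\<^sup>+x. ennreal ((norm (g x))\<^sup>2) \<partial>lebesgue_on S) =
      (\<integral>\<^sup>+x. liminf (\<lambda>n. ennreal ((norm (f n x))\<^sup>2)) \<partial>lebesgue_on S)"
  proof (rule nn_integral_cong_AE)
    show "AE x in lebesgue_on S. ennreal ((norm (g x))\<^sup>2) = liminf (\<lambda>n. ennreal ((norm (f n x))\<^sup>2))"
      using g(2)
    proof eventually_elim
      case (elim x)
      have "(\<lambda>n. ennreal ((norm (f n x))\<^sup>2)) \<longlonglongrightarrow> ennreal ((norm (g x))\<^sup>2)"
        using elim by (intro tendsto_intros)
      then show ?case by (intro lim_imp_Liminf[symmetric]) auto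
    qed
  qed
  also have "\<dots> \<le> liminf (\<lambda>n. \<integral>\<^sup>+x. ennreal ((norm (f n x))\<^sup>2) \<partial>lebesgue_on S)"
    by (rule nn_integral_liminf) measurable
  also have "\<dots> = liminf (\<lambda>n. ennreal ((L2_norm S (f n))\<^sup>2))"
    by (simp add: L2_norm_sq nn_integral_eq_integral L2_integrable_norm f)
  also have "\<dots> \<le> liminf (\<lambda>n. ennreal ((C n)\<^sup>2))"
    by (intro Liminf_mono eventuallyI ennreal_leI power_mono f(2)) auto
  also have "\<dots> = ennreal (c\<^sup>2)"
    using C by (intro lim_imp_Liminf tendsto_intros) auto
  finally have *: "(\<integral>\<^sup>+x. ennreal ((norm (g x))\<^sup>2) \<partial>lebesgue_on S) \<le> ennreal (c\<^sup>2)" .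
  then have int: "integrable (lebesgue_on S) (\<lambda>x. (norm (g x))\<^sup>2)"
    by (intro integrableI_bounded) (auto simp: order_le_less_trans)
  have "ennreal (LINT x|lebesgue_on S. (norm (g x))\<^sup>2) \<le> ennreal (c\<^sup>2)"
    using * by (simp add: nn_integral_eq_integral[OF int])
  then have "(LINT x|lebesgue_on S. (norm (g x))\<^sup>2) \<le> c\<^sup>2"
    by (simp add: ennreal_le_iff)
  then show ?thesis
    using int g(1) c0 by (auto simp: L2_def intro: L2_norm_leI)
qed

lemma L2_AE_subseq:
  assumes f: "\<And>n. f n \<in> L2 S" "(\<lambda>n. L2_norm S (f n)) \<longlonglongrightarrow> 0"
  obtains r :: "nat \<Rightarrow> nat" where "strict_mono r" "AE x in lebesgue_on S. (\<lambda>n. f (r n) x) \<longlonglongrightarrow> 0"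
proof -
  have "(\<lambda>n. (L2_norm S (f n))\<^sup>2) \<longlonglongrightarrow> 0"
    using tendsto_power[OF f(2), of 2] by simp
  then have "(\<lambda>n. LINT x|lebesgue_on S. norm ((norm (f n x))\<^sup>2)) \<longlonglongrightarrow> 0"
    by (simp add: L2_norm_sq)
  from tendsto_L1_AE_subseq[OF L2_integrable_norm[OF f(1)] this]
  obtain r :: "nat \<Rightarrow> nat" where r: "strict_mono r" "AE x in lebesgue_on S. (\<lambda>n. (norm (f (r n) x))\<^sup>2) \<longlonglongrightarrow> 0"
    by auto
  have "AE x in lebesgue_on S. (\<lambda>n. f (r n) x) \<longlonglongrightarrow> 0"
    using r(2)
  proof eventually_elim
    case (elim x)
    from tendsto_real_sqrt[OF this] show ?case
      by (simp add: tendsto_norm_zero_iff)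
  qed
  with r(1) show ?thesis using that by blast
qed

text \<open>Along a fast subsequence the sum of \<open>2\<^sup>n |f\<^sub>n\<^sub>+\<^sub>1 - f\<^sub>n|\<^sup>2\<close> is integrable, so the subsequence
  converges geometrically almost everywhere.\<close>

lemma L2_complete:
  fixes f :: "nat \<Rightarrow> 'a::euclidean_space \<Rightarrow> 'b::euclidean_space"
  assumes f: "\<And>n. f n \<in> L2 S"
    and cauchy: "\<And>e. e > 0 \<Longrightarrow> \<exists>N. \<forall>m\<ge>N. \<forall>n\<ge>N. L2_norm S (\<lambda>x. f m x - f n x) < e"
  obtains g where "g \<in> L2 S" "(\<lambda>n. L2_norm S (\<lambda>x. f n x - g x)) \<longlonglongrightarrow> 0"
proof -
  have "\<forall>k. \<exists>N. \<forall>m\<ge>N. \<forall>n\<ge>N. L2_norm S (\<lambda>x. f m x - f n x) < (1/2)^k"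
    using cauchy by simp
  then obtain N where N: "\<And>k m n. m \<ge> N k \<Longrightarrow> n \<ge> N k \<Longrightarrow> L2_norm S (\<lambda>x. f m x - f n x) < (1/2)^k"
    by metis
  \<comment> \<open>Partial sums turn \<open>N\<close> into a monotone sequence that still dominates
    it at every index.\<close>
  define r where "r k = (\<Sum>i\<le>k. N i) + k" for k
  have rN: "r k \<ge> N k" for k
    unfolding r_def by (simp add: trans_le_add1 member_le_sum)
  have r_mono: "mono r"
    unfolding r_def by (intro monoI add_mono sum_mono2) auto
  define d where "d k x = f (r (Suc k)) x - f (r k) x" for k x
  have d: "d k \<in> L2 S" for k
    unfolding d_def using f by (intro L2_diff)
  have dn: "L2_norm S (d k) \<le> (1/2)^k" for k
    unfolding d_def using N[of k "r (Suc k)" "r k"] rN[of k] monoD[OF r_mono, of k "Suc k"] by simp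
  note [measurable] = L2_measurable[OF f] L2_measurable[OF d]
  have "(\<integral>\<^sup>+x. (\<Sum>k. ennreal (2^k * (norm (d k x))\<^sup>2)) \<partial>lebesgue_on S) =
      (\<Sum>k. \<integral>\<^sup>+x. ennreal (2^k * (norm (d k x))\<^sup>2) \<partial>lebesgue_on S)"
    by (rule nn_integral_suminf) measurable
  also have "\<dots> = (\<Sum>k. ennreal (2^k * (L2_norm S (d k))\<^sup>2))"
    by (intro suminf_cong, subst nn_integral_eq_integral)
       (auto simp: L2_norm_sq L2_integrable_norm d)
  also have "\<dots> \<le> (\<Sum>k. ennreal ((1/2)^k))"
  proof (intro suminf_le ennreal_leI)
    fix k
    have "2^k * (L2_norm S (d k))\<^sup>2 \<le> 2^k * ((1/2)^k)\<^sup>2"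
      by (intro mult_left_mono power_mono dn) auto
    also have "\<dots> = (1/2::real)^k"
      by (simp add: power2_eq_square power_mult_distrib[symmetric] flip: mult.assoc)
    finally show "2^k * (L2_norm S (d k))\<^sup>2 \<le> (1/2)^k" .
  qed auto
  also have "\<dots> = ennreal (\<Sum>k. (1/2)^k)"
    by (rule suminf_ennreal2) auto
  also have "\<dots> < \<infinity>" by simp
  finally have "(\<integral>\<^sup>+x. (\<Sum>k. ennreal (2^k * (norm (d k x))\<^sup>2)) \<partial>lebesgue_on S) \<noteq> \<infinity>" by simp
  then have "AE x in lebesgue_on S. (\<Sum>k. ennreal (2^k * (norm (d k x))\<^sup>2)) \<noteq> \<infinity>"
    by (intro nn_integral_noteq_infinite) measurable
  then have conv: "AE x in lebesgue_on S. convergent (\<lambda>k. f (r k) x)"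
  proof eventually_elim
    case (elim x)
    define a where "a k = 2^k * (norm (d k x))\<^sup>2" for k
    have "(\<Sum>k. ennreal (a k)) \<noteq> \<infinity>"
      using elim by (simp add: a_def)
    then have "summable a"
      by (intro summable_suminf_not_top) (auto simp: a_def)
    then have "Bseq a"
      using convergent_imp_Bseq summable_LIMSEQ_zero convergentI by blast
    then obtain K where K: "K > 0" "\<And>k. norm (a k) \<le> K" by (auto elim: BseqE)
    have "norm (d k x) \<le> sqrt K * (1 / sqrt 2)^k" for k
    proof -
      have "(norm (d k x))\<^sup>2 \<le> K / 2^k"
        using K(2)[of k] by (simp add: a_def field_simps)
      then have "norm (d k x) \<le> sqrt (K / 2^k)"
        by (rule real_le_rsqrt)
      then show ?thesis by (simp add: real_sqrt_divide real_sqrt_power power_divide)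
    qed
    moreover have "summable (\<lambda>k. sqrt K * (1 / sqrt 2)^k)"
      by (intro summable_mult summable_geometric) simp
    ultimately have "summable (\<lambda>k. d k x)"
      by (meson summable_comparison_test')
    then have "convergent (\<lambda>n. \<Sum>k<n. d k x)"
      by (simp add: summable_iff_convergent)
    then have "convergent (\<lambda>n. f (r n) x - f (r 0) x)"
      unfolding d_def by (subst (asm) sum_lessThan_telescope)
    then obtain l where "(\<lambda>n. f (r n) x - f (r 0) x) \<longlonglongrightarrow> l"
      by (auto simp: convergent_def)
    from tendsto_add[OF this tendsto_const[of "f (r 0) x"]] show ?case
      by (simp add: convergent_def) blast
  qed
  define g where "g x = lim (\<lambda>k. f (r k) x)" for x
  have gm [measurable]: "g \<in> borel_measurable (lebesgue_on S)"
    unfolding g_def by measurable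
  have gl: "AE x in lebesgue_on S. (\<lambda>k. f (r k) x) \<longlonglongrightarrow> g x"
    using conv unfolding g_def by eventually_elim (simp add: convergent_LIMSEQ_iff)
  \<comment> \<open>Fatou's lemma is applied in the second index of the differences, with n fixed.
    It yields membership and the rate at once, and for the full sequence rather than for the
    subsequence.\<close>
  have main: "(\<lambda>x. f n x - g x) \<in> L2 S \<and> L2_norm S (\<lambda>x. f n x - g x) \<le> (1/2)^k" if "n \<ge> N k" for n k
  proof (rule L2_Fatou)
    show "(\<lambda>x. f n x - f (r (i + k)) x) \<in> L2 S" for i by (intro L2_diff f)
    show "L2_norm S (\<lambda>x. f n x - f (r (i + k)) x) \<le> (1/2)^k" for i
      using N[of k n "r (i + k)"] that rN[of k] monoD[OF r_mono, of k "i + k"] by simp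
    show "AE x in lebesgue_on S. (\<lambda>i. f n x - f (r (i + k)) x) \<longlonglongrightarrow> f n x - g x"
      using gl by eventually_elim (intro tendsto_intros, rule LIMSEQ_ignore_initial_segment)
  qed auto
  have g: "g \<in> L2 S"
    using L2_diff[OF f[of "N 0"] main[of 0 "N 0", THEN conjunct1]] by simp
  have "(\<lambda>n. L2_norm S (\<lambda>x. f n x - g x)) \<longlonglongrightarrow> 0"
  proof (rule LIMSEQ_I)
    fix e :: real assume "e > 0"
    then obtain k where "(1/2)^k < e"
      using real_arch_pow_inv[of e "1/2"] by auto
    then show "\<exists>no. \<forall>n\<ge>no. norm (L2_norm S (\<lambda>x. f n x - g x) - 0) < e"
      using main[of k] by (intro exI[of _ "N k"]) fastforce
  qed
  with g show ?thesis using that by blast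
qed

section \<open>Quadratic perturbations of the Riesz representation theorem\<close>

text \<open>Spaces of functions modulo null sets are treated as spaces with a positive semidefinite
  inner product. Only linear combinations \<open>lc a x b y\<close> (in place of \<open>a x + b y\<close>) are needed, and
  no vector space laws, since elements are compared through \<open>ip\<close> alone.\<close>

locale semi_hilbert =
  fixes X :: "'h set" and lc :: "real \<Rightarrow> 'h \<Rightarrow> real \<Rightarrow> 'h \<Rightarrow> 'h" and ip :: "'h \<Rightarrow> 'h \<Rightarrow> real"
  assumes nonempty: "X \<noteq> {}"
    and lc_in: "x \<in> X \<Longrightarrow> y \<in> X \<Longrightarrow> lc a x b y \<in> X"
    and ip_lc: "x \<in> X \<Longrightarrow> y \<in> X \<Longrightarrow> z \<in> X \<Longrightarrow> ip (lc a x b y) z = a * ip x z + b * ip y z"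
    and ip_commute: "x \<in> X \<Longrightarrow> y \<in> X \<Longrightarrow> ip x y = ip y x"
    and ip_nonneg: "x \<in> X \<Longrightarrow> 0 \<le> ip x x"
    and complete: "(\<And>n. s n \<in> X) \<Longrightarrow>
      (\<And>e. e > 0 \<Longrightarrow> \<exists>N. \<forall>m\<ge>N. \<forall>n\<ge>N. ip (lc 1 (s m) (-1) (s n)) (lc 1 (s m) (-1) (s n)) < e) \<Longrightarrow>
      \<exists>x\<in>X. (\<lambda>n. ip (lc 1 (s n) (-1) x) (lc 1 (s n) (-1) x)) \<longlonglongrightarrow> 0"
begin

section \<open>Geometry of a semidefinite inner product\<close>

definition nm :: "'h \<Rightarrow> real" where "nm x = sqrt (ip x x)"

lemma nm_nonneg [simp]: "x \<in> X \<Longrightarrow> 0 \<le> nm x"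
  by (simp add: nm_def ip_nonneg)

lemma nm_sq: "x \<in> X \<Longrightarrow> (nm x)\<^sup>2 = ip x x"
  by (simp add: nm_def ip_nonneg)

lemma ip_lc_right: "x \<in> X \<Longrightarrow> y \<in> X \<Longrightarrow> z \<in> X \<Longrightarrow> ip z (lc a x b y) = a * ip z x + b * ip z y"
  by (metis ip_commute ip_lc lc_in)

lemma ip_lc_lc:
  assumes "x \<in> X" "y \<in> X"
  shows "ip (lc a x b y) (lc a x b y) = a\<^sup>2 * ip x x + 2 * a * b * ip x y + b\<^sup>2 * ip y y"
  using assms by (simp add: ip_lc ip_lc_right lc_in ip_commute[of y x] power2_eq_square algebra_simps)

text \<open>The form is nonnegative on all combinations a x + b y. Null vectors may be nonzero
  elements here, so \<open>ip y y = 0\<close> is a genuine case.\<close>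

lemma ip_Cauchy_Schwarz:
  assumes "x \<in> X" "y \<in> X"
  shows "\<bar>ip x y\<bar> \<le> nm x * nm y"
proof -
  have *: "0 \<le> ip x x * a\<^sup>2 + 2 * a * b * ip x y + b\<^sup>2 * ip y y" for a b
    using ip_nonneg[OF lc_in[OF assms, of a b]] ip_lc_lc[OF assms, of a b] by (simp add: mult.commute)
  have "(ip x y)\<^sup>2 \<le> ip x x * ip y y"
  proof (cases "ip y y = 0")
    case True
    have "ip x y = 0"
    proof (rule ccontr)
      assume "ip x y \<noteq> 0"
      then show False
        \<comment> \<open>If y is null and a = 1, the form is affine in b; this b gives it the value
          -1.\<close>
        using *[of 1 "- (ip x x + 1) / (2 * ip x y)"] True by (simp add: field_simps)
    qed
    then show ?thesis using True by simp
  next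
    case False
    then have pos: "ip y y > 0" using ip_nonneg[OF assms(2)] by simp
    have "0 \<le> ip y y * (ip x x * ip y y - (ip x y)\<^sup>2)"
      \<comment> \<open>These coefficients turn the form into \<open>ip y y\<close> times the
        discriminant and so avoid a division.\<close>
      using *[of "ip y y" "- ip x y"] by (simp add: power2_eq_square algebra_simps)
    then show ?thesis using pos by (simp add: zero_le_mult_iff)
  qed
  then have "sqrt ((ip x y)\<^sup>2) \<le> sqrt (ip x x * ip y y)" by (rule real_sqrt_le_mono)
  then show ?thesis by (simp add: nm_def real_sqrt_mult)
qed

text \<open>Without vector space laws x - z cannot be rewritten as (x - y) + (y - z); the two are
  compared through the expansion of \<open>ip\<close>. The same holds for
  \<open>nm_le_diff\<close>.\<close>

lemma nm_triangle_diff: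
  assumes "x \<in> X" "y \<in> X" "z \<in> X"
  shows "nm (lc 1 x (-1) z) \<le> nm (lc 1 x (-1) y) + nm (lc 1 y (-1) z)"
proof -
  let ?u = "lc 1 x (-1) y" and ?w = "lc 1 y (-1) z"
  have uw: "?u \<in> X" "?w \<in> X" using assms by (auto intro: lc_in)
  have "ip (lc 1 x (-1) z) (lc 1 x (-1) z) = ip ?u ?u + 2 * ip ?u ?w + ip ?w ?w"
    using assms by (simp add: ip_lc ip_lc_right lc_in ip_commute algebra_simps)
  also have "\<dots> \<le> (nm ?u + nm ?w)\<^sup>2"
    using ip_Cauchy_Schwarz[OF uw] by (simp add: power2_sum nm_sq uw)
  finally show ?thesis
    unfolding nm_def[of "lc 1 x (-1) z"] using uw by (intro real_le_lsqrt) auto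
qed

lemma nm_le_diff:
  assumes "x \<in> X" "y \<in> X"
  shows "nm x \<le> nm (lc 1 x (-1) y) + nm y"
proof -
  let ?u = "lc 1 x (-1) y"
  have u: "?u \<in> X" using assms by (auto intro: lc_in)
  have "ip x x = ip ?u ?u + 2 * ip ?u y + ip y y"
    using assms by (simp add: ip_lc ip_lc_right lc_in ip_commute algebra_simps)
  also have "\<dots> \<le> (nm ?u + nm y)\<^sup>2"
    using ip_Cauchy_Schwarz[OF u assms(2)] by (simp add: power2_sum nm_sq u assms)
  finally show ?thesis
    unfolding nm_def[of x] using u assms by (intro real_le_lsqrt) auto
qed

lemma nm_diff_commute:
  "x \<in> X \<Longrightarrow> y \<in> X \<Longrightarrow> nm (lc 1 x (-1) y) = nm (lc 1 y (-1) x)"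
  by (simp add: nm_def ip_lc_lc ip_commute)

lemma complete_nm:
  assumes s: "\<And>n. s n \<in> X"
    and c: "\<And>e. e > 0 \<Longrightarrow> \<exists>N. \<forall>m\<ge>N. \<forall>n\<ge>N. nm (lc 1 (s m) (-1) (s n)) < e"
  obtains x where "x \<in> X" "(\<lambda>n. nm (lc 1 (s n) (-1) x)) \<longlonglongrightarrow> 0"
proof -
  have "\<exists>x\<in>X. (\<lambda>n. ip (lc 1 (s n) (-1) x) (lc 1 (s n) (-1) x)) \<longlonglongrightarrow> 0"
  proof (rule complete[OF s])
    fix e :: real assume "e > 0"
    then obtain N where N: "\<forall>m\<ge>N. \<forall>n\<ge>N. nm (lc 1 (s m) (-1) (s n)) < sqrt e"
      using c[of "sqrt e"] by auto
    then show "\<exists>N. \<forall>m\<ge>N. \<forall>n\<ge>N. ip (lc 1 (s m) (-1) (s n)) (lc 1 (s m) (-1) (s n)) < e"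
      by (auto simp: nm_def)
  qed
  then obtain x where x: "x \<in> X" "(\<lambda>n. ip (lc 1 (s n) (-1) x) (lc 1 (s n) (-1) x)) \<longlonglongrightarrow> 0" by blast
  from tendsto_real_sqrt[OF x(2)] have "(\<lambda>n. nm (lc 1 (s n) (-1) x)) \<longlonglongrightarrow> 0"
    by (simp add: nm_def)
  with x(1) that show ?thesis by blast
qed

definition linear_form :: "('h \<Rightarrow> real) \<Rightarrow> bool" where
  "linear_form f \<longleftrightarrow> (\<forall>x\<in>X. \<forall>y\<in>X. \<forall>a b. f (lc a x b y) = a * f x + b * f y)"

lemma linear_formD: "linear_form f \<Longrightarrow> x \<in> X \<Longrightarrow> y \<in> X \<Longrightarrow> f (lc a x b y) = a * f x + b * f y"
  by (simp add: linear_form_def)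

text \<open>The representing element minimizes \<open>ip x x - 2 f x\<close>; by the parallelogram law minimizing
  sequences are Cauchy sequences.\<close>

lemma Riesz:
  assumes f: "linear_form f" and bd: "\<And>x. x \<in> X \<Longrightarrow> \<bar>f x\<bar> \<le> C * nm x"
  obtains x where "x \<in> X" "\<And>y. y \<in> X \<Longrightarrow> ip x y = f y"
proof -
  define J where "J x = ip x x - 2 * f x" for x
  \<comment> \<open>Completing the square: \<open>J x\<close> is at least (nm x - C)^2 -
    C^2.\<close>
  have bdd: "- (C\<^sup>2) \<le> J x" if "x \<in> X" for x
  proof -
    have "0 \<le> (nm x - C)\<^sup>2" by simp
    also have "\<dots> = ip x x - 2 * (C * nm x) + C\<^sup>2"
      by (simp add: power2_diff nm_sq that)
    also have "\<dots> \<le> J x + C\<^sup>2"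
      using bd[OF that] by (simp add: J_def)
    finally show ?thesis by simp
  qed
  define d where "d = Inf (J ` X)"
  have bb: "bdd_below (J ` X)" using bdd by (auto intro!: bdd_belowI)
  have dle: "d \<le> J x" if "x \<in> X" for x
    unfolding d_def using that bb by (intro cInf_lower) auto
  have "\<exists>x\<in>X. J x < d + e" if "e > 0" for e
  proof -
    have "Inf (J ` X) < d + e" using that by (simp add: d_def)
    then show ?thesis using cInf_lessD[of "J ` X"] nonempty by auto
  qed
  then have "\<forall>n. \<exists>x\<in>X. J x < d + inverse (real (Suc n))" by simp
  then obtain s where s: "\<And>n. s n \<in> X" "\<And>n. J (s n) < d + inverse (real (Suc n))" by metis
  \<comment> \<open>The contributions of f cancel by linearity, so the parallelogram law of
    \<open>ip\<close> passes to J.\<close>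
  have par: "ip (lc 1 x (-1) y) (lc 1 x (-1) y) = 2 * J x + 2 * J y - 4 * J (lc (1/2) x (1/2) y)"
    if "x \<in> X" "y \<in> X" for x y
    using that by (simp add: J_def ip_lc_lc linear_formD[OF f] field_simps power2_eq_square)
  obtain x where x: "x \<in> X" "(\<lambda>n. nm (lc 1 (s n) (-1) x)) \<longlonglongrightarrow> 0"
  proof (rule complete_nm[OF s(1)])
    fix e :: real assume e: "e > 0"
    \<comment> \<open>With J below d + e^2/4 at both points and at least d at the midpoint, the
      identity \<open>par\<close> leaves less than e^2.\<close>
    then obtain N where N: "inverse (real (Suc N)) < e\<^sup>2 / 4"
      using reals_Archimedean[of "e\<^sup>2 / 4"] by auto
    have "nm (lc 1 (s m) (-1) (s n)) < e" if "m \<ge> N" "n \<ge> N" for m n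
    proof -
      have inv: "inverse (real (Suc k)) \<le> inverse (real (Suc N))" if "k \<ge> N" for k
        using that by (intro le_imp_inverse_le) auto
      then have *: "J (s k) < d + e\<^sup>2 / 4" if "k \<ge> N" for k
        using s(2)[of k] N inv[OF that] by linarith
      have "2 * J (s m) + 2 * J (s n) - 4 * J (lc (1/2) (s m) (1/2) (s n)) < e\<^sup>2"
        using dle[OF lc_in[OF s(1)[of m] s(1)[of n]], of "1/2" "1/2"] *[OF that(1)] *[OF that(2)]
        by linarith
      then have "ip (lc 1 (s m) (-1) (s n)) (lc 1 (s m) (-1) (s n)) < e\<^sup>2"
        by (simp add: par s)
      then show ?thesis using e by (simp add: nm_def real_less_lsqrt ip_nonneg lc_in s)
    qed
    then show "\<exists>N. \<forall>m\<ge>N. \<forall>n\<ge>N. nm (lc 1 (s m) (-1) (s n)) < e" by blast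
  qed
  have Jx: "J x \<le> d"
  proof -
    have *: "J x \<le> d + inverse (real (Suc n)) + 2 * (C + nm x) * nm (lc 1 (s n) (-1) x)" for n
    proof -
      let ?u = "lc 1 (s n) (-1) x"
      have u: "?u \<in> X" using s x lc_in by blast
      have "J x = J (s n) - ip ?u ?u - 2 * ip ?u x + 2 * f ?u"
        using s x by (simp add: J_def ip_lc ip_lc_right lc_in linear_formD[OF f] ip_commute[of x "s n"] algebra_simps)
      moreover have "\<bar>ip ?u x\<bar> \<le> nm ?u * nm x" using ip_Cauchy_Schwarz u x by blast
      moreover have "\<bar>f ?u\<bar> \<le> C * nm ?u" using bd u by blast
      ultimately show ?thesis using ip_nonneg[OF u] s(2)[of n] by (simp add: algebra_simps)
    qed
    have "(\<lambda>n. d + inverse (real (Suc n)) + 2 * (C + nm x) * nm (lc 1 (s n) (-1) x)) \<longlonglongrightarrow> d + 0 + 2 * (C + nm x) * 0"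
      by (intro tendsto_intros LIMSEQ_inverse_real_of_nat x)
    then show ?thesis using * LIMSEQ_le_const by fastforce
  qed
  have "ip x y = f y" if y: "y \<in> X" for y
  proof -
    define g where "g = ip x y - f y"
    have *: "0 \<le> 2 * t * g + t\<^sup>2 * ip y y" for t
    proof -
      have "J x \<le> J (lc 1 x t y)" using Jx dle[OF lc_in[OF x(1) y]] by (rule order_trans)
      then show ?thesis
        using x y by (simp add: J_def g_def ip_lc_lc linear_formD[OF f] algebra_simps)
    qed
    have "g = 0"
    proof (rule ccontr)
      assume g: "g \<noteq> 0"
      \<comment> \<open>At t = -g/k the first variation is negative as soon as k exceeds
        \<open>ip y y\<close>; adding 1 also keeps k positive for a null vector y.\<close>
      define k where "k = ip y y + 1"
      have k: "k > 0" "ip y y < k" using ip_nonneg[OF y] by (auto simp: k_def)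
      have "2 * (- g / k) * g + (- g / k)\<^sup>2 * ip y y < 2 * (- g / k) * g + (- g / k)\<^sup>2 * k"
        using g k by (intro add_strict_left_mono mult_strict_left_mono) auto
      also have "\<dots> = - (g\<^sup>2) / k"
        using k by (simp add: field_simps power2_eq_square)
      also have "\<dots> \<le> 0" using k by simp
      finally show False using *[of "- g / k"] by simp
    qed
    then show ?thesis by (simp add: g_def)
  qed
  with x(1) that show ?thesis by blast
qed

text \<open>Contraction on the ball of radius \<open>2\<rho>\<close>; uniqueness in the whole space comes from the
  antisymmetry of \<open>B\<close>.\<close>

theorem quadratic_perturbation:
  assumes f: "linear_form f" "\<And>y. y \<in> X \<Longrightarrow> \<bar>f y\<bar> \<le> \<rho> * nm y"
    and l: "\<And>x. x \<in> X \<Longrightarrow> linear_form (l x)" "\<And>y. y \<in> X \<Longrightarrow> linear_form (\<lambda>x. l x y)"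
      "\<And>x y. x \<in> X \<Longrightarrow> y \<in> X \<Longrightarrow> \<bar>l x y\<bar> \<le> \<kappa> * nm x * nm y"
    and B: "\<And>x y. x \<in> X \<Longrightarrow> y \<in> X \<Longrightarrow> linear_form (B x y)"
      "\<And>x y. x \<in> X \<Longrightarrow> y \<in> X \<Longrightarrow> linear_form (\<lambda>z. B x z y)"
      "\<And>x y. x \<in> X \<Longrightarrow> y \<in> X \<Longrightarrow> linear_form (\<lambda>z. B z x y)"
      "\<And>x y z. x \<in> X \<Longrightarrow> y \<in> X \<Longrightarrow> z \<in> X \<Longrightarrow> \<bar>B x y z\<bar> \<le> \<beta> * nm x * nm y * nm z"
      "\<And>x y. x \<in> X \<Longrightarrow> y \<in> X \<Longrightarrow> B x y y = 0"
    and small: "\<kappa> \<le> 1/4" "0 \<le> \<beta>" "0 \<le> \<rho>" "8 * \<beta> * \<rho> \<le> 1"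
  obtains x where "x \<in> X" "\<And>y. y \<in> X \<Longrightarrow> ip x y + l x y + B x x y = f y"
    "\<And>x'. x' \<in> X \<Longrightarrow> (\<And>y. y \<in> X \<Longrightarrow> ip x' y + l x' y + B x' x' y = f y) \<Longrightarrow>
       nm x' \<le> 2 * \<rho> \<and> nm (lc 1 x' (-1) x) = 0"
proof -
  have apriori: "nm x \<le> 2 * \<rho>"
    if x: "x \<in> X" and eq: "\<And>y. y \<in> X \<Longrightarrow> ip x y + l x y + B x x y = f y" for x
  proof (cases "nm x = 0")
    case False
    then have pos: "nm x > 0" using nm_nonneg[OF x] by simp
    have "(nm x)\<^sup>2 = f x - l x x"
      using eq[OF x] B(5)[OF x x] x by (simp add: nm_sq)
    also have "\<dots> \<le> \<rho> * nm x + \<kappa> * nm x * nm x"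
      using f(2)[OF x] l(3)[OF x x] by linarith
    also have "\<dots> \<le> \<rho> * nm x + 1/4 * nm x * nm x"
      using small pos by (intro add_left_mono mult_right_mono) auto
    finally have "nm x * nm x \<le> nm x * (\<rho> + 1/4 * nm x)"
      by (simp add: power2_eq_square algebra_simps)
    then have "nm x \<le> \<rho> + 1/4 * nm x" using pos by simp
    then show ?thesis using pos small by simp
  qed (use small in simp)
  have unique: "nm (lc 1 x' (-1) x) = 0"
    if x: "x \<in> X" and eq: "\<And>y. y \<in> X \<Longrightarrow> ip x y + l x y + B x x y = f y"
      and x': "x' \<in> X" and eq': "\<And>y. y \<in> X \<Longrightarrow> ip x' y + l x' y + B x' x' y = f y" for x x'
  proof -
    define d where "d = lc 1 x' (-1) x"
    have d: "d \<in> X" unfolding d_def using x x' by (rule lc_in[rotated])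
    \<comment> \<open>The difference of the quadratic terms splits as B(d, x, .) + B(x', d, .);
      tested with d, the second part vanishes by antisymmetry. What remains contains only x, which
      the a priori bound controls.\<close>
    have "ip d d + l d d + B d x d = 0"
    proof -
      have "ip d d = ip x' d - ip x d" unfolding d_def using x x' by (simp add: ip_lc lc_in)
      moreover have "l d d = l x' d - l x d"
        using linear_formD[OF l(2)[OF d] x' x, of 1 "-1"] by (simp add: d_def)
      moreover have "B d x d = B x' x d - B x x d"
        using linear_formD[OF B(3)[OF x d] x' x, of 1 "-1"] by (simp add: d_def)
      moreover have "B x' d d = B x' x' d - B x' x d"
        using linear_formD[OF B(2)[OF x' d] x' x, of 1 "-1"] by (simp add: d_def)
      ultimately show ?thesis using eq[OF d] eq'[OF d] B(5)[OF x' d] by simp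
    qed
    then have "(nm d)\<^sup>2 \<le> \<kappa> * nm d * nm d + \<beta> * nm d * nm x * nm d"
      using l(3)[OF d d] B(4)[OF d x d] by (simp add: nm_sq d)
    also have "\<dots> = (\<kappa> + \<beta> * nm x) * (nm d)\<^sup>2" by (simp add: power2_eq_square algebra_simps)
    also have "\<dots> \<le> (1/4 + 1/4) * (nm d)\<^sup>2"
    proof (intro mult_right_mono add_mono)
      have "\<beta> * nm x \<le> \<beta> * (2 * \<rho>)" using apriori[OF x eq] small by (intro mult_left_mono) auto
      then show "\<beta> * nm x \<le> 1/4" using small by simp
    qed (use small in auto)
    finally have "(nm d)\<^sup>2 \<le> 0" by simp
    then show ?thesis by (simp add: d_def)
  qed
  have "\<exists>z\<in>X. \<forall>y\<in>X. ip z y = f y - l x y - B x x y" if x: "x \<in> X" for x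
  proof -
    have "linear_form (\<lambda>y. f y - l x y - B x x y)"
      using f(1) l(1)[OF x] B(1)[OF x x] unfolding linear_form_def by (simp add: algebra_simps)
    moreover have "\<bar>f y - l x y - B x x y\<bar> \<le> (\<rho> + \<kappa> * nm x + \<beta> * nm x * nm x) * nm y" if "y \<in> X" for y
      using f(2)[OF that] l(3)[OF x that] B(4)[OF x x that] unfolding distrib_right by linarith
    ultimately show ?thesis by (rule Riesz) blast+
  qed
  then obtain F where F: "\<And>x. x \<in> X \<Longrightarrow> F x \<in> X"
      "\<And>x y. x \<in> X \<Longrightarrow> y \<in> X \<Longrightarrow> ip (F x) y = f y - l x y - B x x y"
    by metis
  have ball: "nm (F x) \<le> 2 * \<rho>" if x: "x \<in> X" and r: "nm x \<le> 2 * \<rho>" for x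
  proof (cases "nm (F x) = 0")
    case False
    let ?y = "F x"
    have y: "?y \<in> X" using F x by blast
    then have pos: "nm ?y > 0" using False nm_nonneg[OF y] by linarith
    have "nm ?y * nm ?y = f ?y - l x ?y - B x x ?y"
      using F(2)[OF x y] y by (simp add: nm_sq[symmetric] power2_eq_square)
    also have "\<dots> \<le> \<rho> * nm ?y + \<kappa> * nm x * nm ?y + \<beta> * nm x * nm x * nm ?y"
      using f(2)[OF y] l(3)[OF x y] B(4)[OF x x y] by linarith
    also have "\<dots> = nm ?y * (\<rho> + \<kappa> * nm x + \<beta> * nm x * nm x)" by (simp add: algebra_simps)
    finally have "nm ?y \<le> \<rho> + \<kappa> * nm x + \<beta> * nm x * nm x" using pos by simp
    \<comment> \<open>On the ball of radius 2 \<rho> the linear part adds at most \<rho>/2, and 8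
      \<beta> \<rho> \<le> 1 holds the quadratic part to another \<rho>/2; the sum is again 2
      \<rho>.\<close>
    also have "\<dots> \<le> \<rho> + 1/4 * (2 * \<rho>) + (\<beta> * (2 * \<rho>)) * (2 * \<rho>)"
    proof (intro add_mono order_refl)
      show "\<kappa> * nm x \<le> 1/4 * (2 * \<rho>)"
        using mult_right_mono[OF small(1) nm_nonneg[OF x]] r by simp
      show "\<beta> * nm x * nm x \<le> (\<beta> * (2 * \<rho>)) * (2 * \<rho>)"
        using small r nm_nonneg[OF x] by (intro mult_mono) auto
    qed
    also have "\<dots> \<le> \<rho> + 1/4 * (2 * \<rho>) + 1/4 * (2 * \<rho>)"
      using small by (intro add_left_mono mult_right_mono) auto
    finally show ?thesis by simp
  qed (use small in simp)
  have contr: "nm (lc 1 (F x) (-1) (F x')) \<le> 3/4 * nm (lc 1 x (-1) x')"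
    if x: "x \<in> X" and r: "nm x \<le> 2 * \<rho>" and x': "x' \<in> X" and r': "nm x' \<le> 2 * \<rho>" for x x'
  proof -
    let ?y = "lc 1 (F x) (-1) (F x')" and ?d = "lc 1 x (-1) x'"
    have y: "?y \<in> X" and d: "?d \<in> X" using F x x' lc_in by blast+
    show ?thesis
    proof (cases "nm ?y = 0")
      case False
      then have pos: "nm ?y > 0" using nm_nonneg[OF y] by simp
      have "nm ?y * nm ?y = ip (F x) ?y - ip (F x') ?y"
        using y F x x' by (simp add: nm_sq[symmetric] power2_eq_square[symmetric] ip_lc[symmetric])
          (simp add: nm_sq ip_lc)
      also have "\<dots> = - l ?d ?y - B ?d x ?y - B x' ?d ?y"
        using F(2)[OF x y] F(2)[OF x' y] linear_formD[OF l(2)[OF y] x x', of 1 "-1"]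
          linear_formD[OF B(3)[OF x y] x x', of 1 "-1"] linear_formD[OF B(2)[OF x' y] x x', of 1 "-1"]
        by simp
      also have "\<dots> \<le> \<kappa> * nm ?d * nm ?y + \<beta> * nm ?d * nm x * nm ?y + \<beta> * nm x' * nm ?d * nm ?y"
        using l(3)[OF d y] B(4)[OF d x y] B(4)[OF x' d y] by linarith
      also have "\<dots> = nm ?y * ((\<kappa> + \<beta> * nm x + \<beta> * nm x') * nm ?d)" by (simp add: algebra_simps)
      finally have "nm ?y \<le> (\<kappa> + \<beta> * nm x + \<beta> * nm x') * nm ?d" using pos by simp
      \<comment> \<open>One quarter from l and one from each of the two parts of the quadratic
        difference. Antisymmetry does not help here, because \<open>F\<close> differs from the
        identity and the test element is not ?d.\<close>
      also have "\<dots> \<le> (1/4 + 1/4 + 1/4) * nm ?d"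
      proof (intro mult_right_mono add_mono)
        have "\<beta> * nm u \<le> 1/4" if "nm u \<le> 2 * \<rho>" for u
        proof -
          have "\<beta> * nm u \<le> \<beta> * (2 * \<rho>)" using that small by (intro mult_left_mono) auto
          then show ?thesis using small by simp
        qed
        then show "\<beta> * nm x \<le> 1/4" "\<beta> * nm x' \<le> 1/4" using r r' by auto
      qed (use small d in auto)
      finally show ?thesis by simp
    qed (use d in simp)
  qed
  obtain o' where o': "o' \<in> X" using nonempty by blast
  \<comment> \<open>The locale has no zero vector; \<open>lc 0 o' 0 o'\<close> has norm 0 and takes
    its place as starting point.\<close>
  define s where "s n = (F ^^ n) (lc 0 o' 0 o')" for n
  have s: "s n \<in> X \<and> nm (s n) \<le> 2 * \<rho>" for n
  proof (induction n)
    case 0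
    show ?case using o' small by (simp add: s_def lc_in nm_def ip_lc_lc)
  next
    case (Suc n)
    then show ?case using ball F(1) by (simp add: s_def)
  qed
  then have sX: "s n \<in> X" and sr: "nm (s n) \<le> 2 * \<rho>" for n by auto
  have step: "nm (lc 1 (s (Suc n)) (-1) (s n)) \<le> (3/4)^n * (4 * \<rho>)" for n
  proof (induction n)
    case 0
    let ?u = "lc 1 (s (Suc 0)) (-1) (s 0)" and ?z = "lc 0 o' 0 o'"
    have z: "?z \<in> X" "nm ?z = 0" using o' by (auto simp: lc_in nm_def ip_lc_lc)
    have "nm ?u \<le> nm (lc 1 (s (Suc 0)) (-1) ?z) + nm (lc 1 ?z (-1) (s 0))"
      using nm_triangle_diff sX z by blast
    also have "\<dots> = nm (s (Suc 0)) + nm (s 0)"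
      using sX z o' by (simp add: nm_def ip_lc_lc ip_lc ip_lc_right)
    finally show ?case using sr[of "Suc 0"] sr[of 0] by simp
  next
    case (Suc n)
    have "nm (lc 1 (s (Suc (Suc n))) (-1) (s (Suc n))) \<le> 3/4 * nm (lc 1 (s (Suc n)) (-1) (s n))"
      using contr[OF sX[of "Suc n"] sr[of "Suc n"] sX[of n] sr[of n]] by (simp add: s_def)
    also have "\<dots> \<le> 3/4 * ((3/4)^n * (4 * \<rho>))"
      using Suc by (intro mult_left_mono) auto
    finally show ?case by simp
  qed
  \<comment> \<open>16 \<rho> is the sum of the geometric series with ratio 3/4 and first term 4
    \<rho>; the factor 1 - (3/4)^k keeps the exact partial sum, which is what the induction
    needs.\<close>
  have tail: "nm (lc 1 (s (n + k)) (-1) (s n)) \<le> (3/4)^n * (16 * \<rho>) * (1 - (3/4)^k)" for n k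
  proof (induction k)
    case 0
    show ?case using sX by (simp add: nm_def ip_lc_lc)
  next
    case (Suc k)
    have "nm (lc 1 (s (n + Suc k)) (-1) (s n)) \<le>
        nm (lc 1 (s (Suc (n + k))) (-1) (s (n + k))) + nm (lc 1 (s (n + k)) (-1) (s n))"
      using nm_triangle_diff sX by simp
    also have "\<dots> \<le> (3/4)^(n + k) * (4 * \<rho>) + (3/4)^n * (16 * \<rho>) * (1 - (3/4)^k)"
      using step[of "n + k"] Suc by simp
    also have "\<dots> = (3/4)^n * (16 * \<rho>) * (1 - (3/4)^Suc k)"
      by (simp add: power_add algebra_simps)
    finally show ?case .
  qed
  obtain x where x: "x \<in> X" "(\<lambda>n. nm (lc 1 (s n) (-1) x)) \<longlonglongrightarrow> 0"
  proof (rule complete_nm[OF sX])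
    fix e :: real assume e: "e > 0"
    have "(\<lambda>n. (3/4)^n * (16 * \<rho>)) \<longlonglongrightarrow> 0 * (16 * \<rho>)"
      by (intro tendsto_intros LIMSEQ_power_zero) simp
    then have "\<forall>\<^sub>F n in sequentially. (3/4)^n * (16 * \<rho>) < e / 2"
      using e by (intro order_tendstoD) auto
    then obtain N where N: "(3/4)^N * (16 * \<rho>) < e / 2"
      by (auto simp: eventually_sequentially)
    have *: "nm (lc 1 (s m) (-1) (s N)) < e / 2" if "m \<ge> N" for m
    proof -
      have "nm (lc 1 (s m) (-1) (s N)) \<le> (3/4)^N * (16 * \<rho>) * (1 - (3/4)^(m - N))"
        using tail[of N "m - N"] that by simp
      also have "\<dots> \<le> (3/4)^N * (16 * \<rho>) * 1"
        using small by (intro mult_left_mono) auto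
      finally show ?thesis using N by simp
    qed
    have "nm (lc 1 (s m) (-1) (s n)) < e" if "m \<ge> N" "n \<ge> N" for m n
      using nm_triangle_diff[OF sX[of m] sX[of N] sX[of n]] *[OF that(1)] *[OF that(2)]
        nm_diff_commute[OF sX[of n] sX[of N]] by simp
    then show "\<exists>N. \<forall>m\<ge>N. \<forall>n\<ge>N. nm (lc 1 (s m) (-1) (s n)) < e" by blast
  qed
  have xr: "nm x \<le> 2 * \<rho>"
  proof -
    have "nm x \<le> nm (lc 1 (s n) (-1) x) + 2 * \<rho>" for n
      using nm_le_diff[OF x(1) sX[of n]] nm_diff_commute[OF x(1) sX[of n]] sr[of n] by simp
    moreover have "(\<lambda>n. nm (lc 1 (s n) (-1) x) + 2 * \<rho>) \<longlonglongrightarrow> 0 + 2 * \<rho>"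
      by (intro tendsto_intros x)
    ultimately show ?thesis using LIMSEQ_le_const by fastforce
  qed
  \<comment> \<open>The limit is a fixed point only up to a null vector. Cauchy-Schwarz makes this
    enough: in the equation for \<open>F x\<close>, only \<open>ip (F x) y\<close> has to be
    exchanged for \<open>ip x y\<close>.\<close>
  have "nm (lc 1 (F x) (-1) x) = 0"
  proof -
    have "nm (lc 1 (F x) (-1) x) \<le> 3/4 * nm (lc 1 (s n) (-1) x) + nm (lc 1 (s (Suc n)) (-1) x)" for n
    proof -
      have "nm (lc 1 (F x) (-1) x) \<le> nm (lc 1 (F x) (-1) (s (Suc n))) + nm (lc 1 (s (Suc n)) (-1) x)"
        using nm_triangle_diff F x sX by blast
      moreover have "nm (lc 1 (F x) (-1) (s (Suc n))) \<le> 3/4 * nm (lc 1 x (-1) (s n))"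
        using contr[OF x(1) xr sX[of n] sr[of n]] by (simp add: s_def)
      ultimately show ?thesis using nm_diff_commute[OF x(1) sX[of n]] by simp
    qed
    moreover have "(\<lambda>n. 3/4 * nm (lc 1 (s n) (-1) x) + nm (lc 1 (s (Suc n)) (-1) x)) \<longlonglongrightarrow> 3/4 * 0 + 0"
      by (intro tendsto_intros x LIMSEQ_Suc)
    ultimately have "nm (lc 1 (F x) (-1) x) \<le> 3/4 * 0 + 0" using LIMSEQ_le_const by fastforce
    then show ?thesis using nm_nonneg[OF lc_in[OF F(1)[OF x(1)] x(1), of 1 "-1"]] by simp
  qed
  then have "ip (F x) y = ip x y" if "y \<in> X" for y
    using ip_Cauchy_Schwarz[OF lc_in[OF F(1)[OF x(1)] x(1), of 1 "-1"] that] F(1) x(1) that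
    by (simp add: ip_lc)
  then have sol: "ip x y + l x y + B x x y = f y" if "y \<in> X" for y
    using F(2)[OF x(1) that] that by simp
  show ?thesis
    using that[OF x(1) sol] apriori unique[OF x(1) sol] by blast
qed

end

section \<open>Weak gradients\<close>

lemma integrable_lebesgue_on:
  fixes f :: "'a::euclidean_space \<Rightarrow> 'b::{banach, second_countable_topology}"
  shows "S \<in> sets lebesgue \<Longrightarrow> integrable lebesgue f \<Longrightarrow> integrable (lebesgue_on S) f"
  by (simp add: integrable_restrict_space integrable_mult_indicator)

lemma L2_continuous_compact_support:
  assumes "S \<in> sets lebesgue" "continuous_on UNIV f" "compact K" "\<And>x. x \<notin> K \<Longrightarrow> f x = 0"
  shows "f \<in> L2 S"
proof -
  have m [measurable]: "f \<in> borel_measurable lborel"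
    using assms(2) by (simp add: borel_measurable_continuous_onI)
  have "integrable lborel (\<lambda>x. indicator K x *\<^sub>R (norm (f x))\<^sup>2)"
    by (rule borel_integrable_compact[OF assms(3)])
       (intro continuous_intros continuous_on_subset[OF assms(2)] subset_UNIV)
  moreover have "(\<lambda>x. indicator K x *\<^sub>R (norm (f x))\<^sup>2) = (\<lambda>x. (norm (f x))\<^sup>2)"
    using assms(4) by (auto simp: fun_eq_iff split: split_indicator)
  ultimately have "integrable lebesgue (\<lambda>x. (norm (f x))\<^sup>2)"
    by (simp add: integrable_completion)
  then have "integrable (lebesgue_on S) (\<lambda>x. (norm (f x))\<^sup>2)"
    by (rule integrable_lebesgue_on[OF assms(1)])
  moreover have "f \<in> borel_measurable (lebesgue_on S)"
    using m by (intro measurable_restrict_space1 measurable_completion) simp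
  ultimately show ?thesis by (simp add: L2_def)
qed

lemma test_funs_L2:
  assumes "S \<in> sets lebesgue" "\<phi> \<in> test_funs S'"
  shows "\<phi> \<in> L2 S" "sgrad \<phi> \<in> L2 S"
proof -
  obtain K where K: "compact K" "\<And>x. x \<notin> K \<Longrightarrow> \<phi> x = 0" "\<And>x. x \<notin> K \<Longrightarrow> sgrad \<phi> x = 0"
    using assms(2) by (meson test_funsE)
  have s: "smooth_fun \<phi>" using assms(2) by (rule test_funs_smooth)
  show "\<phi> \<in> L2 S"
    by (rule L2_continuous_compact_support[OF assms(1) smooth_fun_continuous[OF s] K(1,2)])
  show "sgrad \<phi> \<in> L2 S"
    by (rule L2_continuous_compact_support[OF assms(1) continuous_on_sgrad[OF s] K(1,3)])
qed

text \<open>The spaces live on \<open>lebesgue_on\<close>, whereas translation invariance is at hand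
  for \<open>lborel\<close>; for Borel functions vanishing off S the two integrals coincide.\<close>

lemma integral_lebesgue_on_eq_lborel:
  fixes f :: "'a::euclidean_space \<Rightarrow> 'b::{banach, second_countable_topology}"
  assumes "S \<in> sets lebesgue" "f \<in> borel_measurable borel" "\<And>x. x \<notin> S \<Longrightarrow> f x = 0"
  shows "(LINT x|lebesgue_on S. f x) = (LINT x|lborel. f x)"
proof -
  have "(LINT x|lebesgue_on S. f x) = (LINT x|lebesgue. indicator S x *\<^sub>R f x)"
    using assms(1) by (simp add: integral_restrict_space)
  also have "(\<lambda>x. indicator S x *\<^sub>R f x) = f"
    using assms(3) by (auto simp: indicator_def)
  finally show ?thesis using assms(2) by (simp add: integral_completion)
qed

text \<open>By translation invariance all difference quotients have integral zero.\<close>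

lemma integral_directional_derivative_test:
  fixes \<phi> :: "'a::euclidean_space \<Rightarrow> real"
  assumes "\<phi> \<in> test_funs UNIV"
  shows "(LINT x|lborel. sgrad \<phi> x \<bullet> h) = 0"
proof -
  obtain K where K: "compact K" "\<And>x. x \<notin> K \<Longrightarrow> \<phi> x = 0" "\<And>x. x \<notin> K \<Longrightarrow> sgrad \<phi> x = 0"
    using assms by (meson test_funsE)
  have s: "smooth_fun \<phi>" using assms by (rule test_funs_smooth)
  note deriv = smooth_fun_has_derivative[OF s]
  have contg: "continuous_on A (sgrad \<phi>)" for A by (rule continuous_on_sgrad[OF s])
  have [measurable]: "\<phi> \<in> borel_measurable borel" "sgrad \<phi> \<in> borel_measurable borel"
    using contg smooth_fun_continuous[OF s] by (auto intro: borel_measurable_continuous_onI)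
  have "bounded (sgrad \<phi> ` K)"
    by (intro compact_imp_bounded compact_continuous_image contg K)
  then obtain B where B: "B > 0" "\<And>x. x \<in> K \<Longrightarrow> norm (sgrad \<phi> x) \<le> B"
    by (auto simp: bounded_pos)
  then have B': "norm (sgrad \<phi> x) \<le> B" for x
    using K(3)[of x] by (cases "x \<in> K") auto
  have lip: "norm (\<phi> x - \<phi> y) \<le> B * norm (x - y)" for x y
  proof (rule differentiable_bound[of UNIV \<phi> "\<lambda>x h. sgrad \<phi> x \<bullet> h"])
    show "onorm (\<lambda>h. sgrad \<phi> x \<bullet> h) \<le> B" for x
      by (rule onorm_le, unfold real_norm_def)
         (rule order_trans[OF Cauchy_Schwarz_ineq2 mult_right_mono[OF B' norm_ge_zero]])
  qed (use deriv in auto)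
  obtain R where R: "R > 0" "\<And>x. x \<in> K \<Longrightarrow> norm x \<le> R"
    using compact_imp_bounded[OF K(1)] by (auto simp: bounded_pos)
  define t where "t n = inverse (real (Suc n))" for n
  have t: "0 < t n" "t n \<le> 1" for n by (auto simp: t_def inverse_le_1_iff)
  define q where "q n x = (\<phi> (t n *\<^sub>R h + x) - \<phi> x) / t n" for n x
  have int\<phi>: "integrable lborel \<phi>"
  proof -
    have "integrable lborel (\<lambda>x. indicator K x *\<^sub>R \<phi> x)"
      by (rule borel_integrable_compact[OF K(1) smooth_fun_continuous[OF s]])
    moreover have "(\<lambda>x. indicator K x *\<^sub>R \<phi> x) = \<phi>" using K(2) by (auto simp: fun_eq_iff split: split_indicator)
    ultimately show ?thesis by simp
  qed
  have shift: "has_bochner_integral lborel (\<lambda>x. \<phi> (c + x)) (LINT x|lborel. \<phi> x)" for c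
  proof -
    have "has_bochner_integral (distr lborel borel ((+) c)) \<phi> (LINT x|lborel. \<phi> x)"
      using int\<phi> by (simp add: lborel_distr_plus has_bochner_integral_integrable)
    then show ?thesis
      by (simp add: has_bochner_integral_iff integrable_distr_eq integral_distr)
  qed
  have q0: "(LINT x|lborel. q n x) = 0" for n
    using shift[of "t n *\<^sub>R h"] int\<phi> unfolding q_def has_bochner_integral_iff by simp
  have "(\<lambda>n. LINT x|lborel. q n x) \<longlonglongrightarrow> (LINT x|lborel. sgrad \<phi> x \<bullet> h)"
  \<comment> \<open>Shifts by at most |h| keep the support in the ball of radius R + |h|, and the
    Lipschitz constant B bounds the quotients by B |h|.\<close>
  proof (rule integral_dominated_convergence[where w="\<lambda>x. indicator (cball 0 (R + norm h)) x *\<^sub>R (B * norm h)"])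
    show "integrable lborel (\<lambda>x. indicator (cball 0 (R + norm h)) x *\<^sub>R (B * norm h))"
      by (rule borel_integrable_compact) auto
    show "AE x in lborel. norm (q n x) \<le> indicator (cball 0 (R + norm h)) x *\<^sub>R (B * norm h)" for n
    proof (rule AE_I2)
      fix x
      show "norm (q n x) \<le> indicator (cball 0 (R + norm h)) x *\<^sub>R (B * norm h)"
      proof (cases "x \<in> cball 0 (R + norm h)")
        case True
        have "\<bar>\<phi> (t n *\<^sub>R h + x) - \<phi> x\<bar> \<le> B * norm h * t n"
          using lip[of "t n *\<^sub>R h + x" x] t[of n] by (simp add: mult_ac)
        then have "norm (q n x) \<le> B * norm h"
          unfolding q_def using t(1)[of n] by (simp add: pos_divide_le_eq)
        then show ?thesis using True by simp
      next
        case False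
        have "x \<notin> K" using False R(2)[of x] norm_ge_zero[of h] by auto
        moreover have "t n *\<^sub>R h + x \<notin> K"
        proof
          assume "t n *\<^sub>R h + x \<in> K"
          then have "norm (t n *\<^sub>R h + x) \<le> R" by (rule R)
          moreover have "norm x \<le> norm (t n *\<^sub>R h + x) + norm (t n *\<^sub>R h)"
            using norm_triangle_ineq4[of "t n *\<^sub>R h + x" "t n *\<^sub>R h"] by simp
          moreover have "norm (t n *\<^sub>R h) \<le> norm h"
            using mult_left_le_one_le[OF norm_ge_zero, of "t n" h] t[of n] by simp
          ultimately show False using False by simp
        qed
        ultimately show ?thesis using False K(2) by (simp add: q_def)
      qed
    qed
    show "AE x in lborel. (\<lambda>n. q n x) \<longlonglongrightarrow> sgrad \<phi> x \<bullet> h"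
    proof (rule AE_I2)
      fix x
      have "((\<lambda>s. \<phi> (s *\<^sub>R h + x)) has_derivative (\<lambda>s. sgrad \<phi> x \<bullet> (s *\<^sub>R h))) (at 0)"
      proof (rule has_derivative_compose[of "\<lambda>s. s *\<^sub>R h + x" "\<lambda>s. s *\<^sub>R h"])
        show "((\<lambda>s. s *\<^sub>R h + x) has_derivative (\<lambda>s. s *\<^sub>R h)) (at 0)"
          by (auto intro!: derivative_eq_intros)
      qed (use deriv[of x] in simp)
      then have "((\<lambda>s. \<phi> (s *\<^sub>R h + x)) has_field_derivative (sgrad \<phi> x \<bullet> h)) (at 0)"
        by (simp add: has_field_derivative_def mult_commute_abs)
      then have "((\<lambda>s. (\<phi> (s *\<^sub>R h + x) - \<phi> x) / s) \<longlongrightarrow> sgrad \<phi> x \<bullet> h) (at 0)"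
        by (simp add: DERIV_def)
      moreover have "filterlim t (at 0) sequentially"
        unfolding filterlim_at using t(1) LIMSEQ_inverse_real_of_nat
        by (auto simp: t_def[abs_def] intro!: eventuallyI)
      ultimately show "(\<lambda>n. q n x) \<longlonglongrightarrow> sgrad \<phi> x \<bullet> h"
        unfolding q_def by (rule filterlim_compose)
    qed
  qed (auto simp: q_def[abs_def])
  then show ?thesis using q0 LIMSEQ_unique[OF _ tendsto_const] by simp
qed

section \<open>Integration by parts, the fundamental lemma of the calculus of variations and
  uniqueness of weak gradients\<close>

lemma is_weak_grad_iff:
  "is_weak_grad S u G \<longleftrightarrow> (\<forall>\<phi>\<in>test_funs S. \<forall>b\<in>Basis.
     (LINT x|lebesgue_on S. u x * (sgrad \<phi> x \<bullet> b)) = - (LINT x|lebesgue_on S. (G x \<bullet> b) * \<phi> x))"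
  unfolding is_weak_grad_def
  by (intro ball_cong refl) (simp add: frechet_derivative_smooth[OF test_funs_smooth])

lemma is_weak_gradD:
  "is_weak_grad S u G \<Longrightarrow> \<phi> \<in> test_funs S \<Longrightarrow> b \<in> Basis \<Longrightarrow>
     (LINT x|lebesgue_on S. u x * (sgrad \<phi> x \<bullet> b)) = - (LINT x|lebesgue_on S. (G x \<bullet> b) * \<phi> x)"
  by (simp add: is_weak_grad_iff)

text \<open>The product with a test function of S is a test function on the whole space, so its
  directional derivatives integrate to zero; the product rule then gives integration by parts with
  no boundary term.\<close>

lemma is_weak_grad_test_funs:
  assumes "S \<in> sets lebesgue" "\<phi> \<in> test_funs S'"
  shows "is_weak_grad S \<phi> (sgrad \<phi>)"
  unfolding is_weak_grad_iff
proof (intro ballI)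
  fix \<psi> b assume \<psi>: "\<psi> \<in> test_funs S" and b: "b \<in> (Basis::'a set)"
  note s = test_funs_smooth[OF assms(2)] test_funs_smooth[OF \<psi>]
  note [measurable] = s[THEN smooth_fun_continuous, THEN borel_measurable_continuous_onI]
    s[THEN continuous_on_sgrad, THEN borel_measurable_continuous_onI]
  have "(\<lambda>x. \<psi> x * \<phi> x) \<in> test_funs UNIV"
    using test_funs_mult[OF \<psi> s(1)] test_funs_mono by blast
  from integral_directional_derivative_test[OF this, of b]
  have "(LINT x|lborel. \<psi> x * (sgrad \<phi> x \<bullet> b) + \<phi> x * (sgrad \<psi> x \<bullet> b)) = 0"
    by (simp add: sgrad_mult s inner_add_left)
  also have "(LINT x|lborel. \<psi> x * (sgrad \<phi> x \<bullet> b) + \<phi> x * (sgrad \<psi> x \<bullet> b)) =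
      (LINT x|lebesgue_on S. \<psi> x * (sgrad \<phi> x \<bullet> b) + \<phi> x * (sgrad \<psi> x \<bullet> b))"
    by (rule integral_lebesgue_on_eq_lborel[symmetric, OF assms(1)])
       (use test_funs_outside[OF \<psi>] sgrad_outside[OF \<psi>] in auto)
  also have "\<dots> = (LINT x|lebesgue_on S. \<psi> x * (sgrad \<phi> x \<bullet> b)) + (LINT x|lebesgue_on S. \<phi> x * (sgrad \<psi> x \<bullet> b))"
    using test_funs_L2[OF assms] test_funs_L2[OF assms(1) \<psi>]
    by (intro Bochner_Integration.integral_add L2_integrable_mult L2_component)
  finally show "(LINT x|lebesgue_on S. \<phi> x * (sgrad \<psi> x \<bullet> b)) = - (LINT x|lebesgue_on S. (sgrad \<phi> x \<bullet> b) * \<psi> x)"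
    by (simp add: mult.commute)
qed

text \<open>The positive and the negative part of f are densities of two measures that agree on
  boxes, an intersection-stable generator of the Borel sets. The measures therefore coincide, and so
  do their densities.\<close>

lemma AE_zero_if_integral_boxes_zero:
  fixes f :: "'a::euclidean_space \<Rightarrow> real"
  assumes f: "integrable lborel f"
    and box: "\<And>l u. (LINT x|lborel. f x * indicator (box l u) x) = 0"
  shows "AE x in lborel. f x = 0"
proof -
  have [measurable]: "f \<in> borel_measurable borel" using f by auto
  have "density lborel (\<lambda>x. ennreal (f x)) = density lborel (\<lambda>x. ennreal (- f x))" (is "?M = ?N")
  proof (rule measure_eqI_generator_eq)
    let ?E = "range (\<lambda>(a, b). box a b::'a set)"
    show "Int_stable ?E"
      by (auto simp: Int_stable_def box_Int_box)
    show "?E \<subseteq> Pow UNIV" "sets ?M = sigma_sets UNIV ?E" "sets ?N = sigma_sets UNIV ?E"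
      by (simp_all add: borel_eq_box)
    let ?A = "\<lambda>n::nat. box (- (real n *\<^sub>R One)) (real n *\<^sub>R One) :: 'a set"
    show "range ?A \<subseteq> ?E" "(\<Union>i. ?A i) = UNIV"
      unfolding UN_box_eq_UNIV by auto
    have eq: "emeasure ?M (box l u) = (\<integral>\<^sup>+x. ennreal (f x * indicator (box l u) x) \<partial>lborel)"
      "emeasure ?N (box l u) = (\<integral>\<^sup>+x. ennreal (- (f x * indicator (box l u) x)) \<partial>lborel)" for l u
      by (auto simp: emeasure_density intro!: nn_integral_cong split: split_indicator)
    have int: "integrable lborel (\<lambda>x. f x * indicator (box l u) x)" for l u
      using f by (intro integrable_real_mult_indicator) auto
    have fin: "(\<integral>\<^sup>+x. ennreal (f x * indicator (box l u) x) \<partial>lborel) \<noteq> \<infinity>"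
      "(\<integral>\<^sup>+x. ennreal (- (f x * indicator (box l u) x)) \<partial>lborel) \<noteq> \<infinity>" for l u
      using int[of l u] unfolding real_integrable_def by auto
    show "emeasure ?M (?A i) \<noteq> \<infinity>" for i
      unfolding eq by (rule fin)
    show "emeasure ?M X = emeasure ?N X" if "X \<in> ?E" for X
    proof -
      from that obtain l u where X: "X = box l u" by auto
      have "enn2real (emeasure ?M X) = enn2real (emeasure ?N X)"
        using box[of l u] real_lebesgue_integral_def[OF int[of l u]] unfolding X eq by simp
      moreover have "emeasure ?M X < top" "emeasure ?N X < top"
        using fin[of l u] unfolding X eq by (auto simp: less_top)
      ultimately show ?thesis
        by (metis ennreal_enn2real)
    qed
  qed
  then have "AE x in lborel. ennreal (f x) = ennreal (- f x)"
    by (intro sigma_finite_measure.density_unique[OF sigma_finite_lborel]) auto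
  then show ?thesis
  proof eventually_elim
    case (elim x)
    then show ?case
      by (cases "0 \<le> f x") (simp_all add: ennreal_neg ennreal_eq_0_iff eq_commute[of 0])
  qed
qed

text \<open>Bump functions converge to indicators, so g has integral zero over every box well inside
  S. As g is only square integrable on S, the box lemma is applied to g cut off to one closed box at
  a time, and countably many such boxes cover S.\<close>

lemma fundamental_lemma:
  fixes g :: "'a::euclidean_space \<Rightarrow> real"
  assumes "open S" and g: "g \<in> L2 S"
    and zero: "\<And>\<phi>. \<phi> \<in> test_funs S \<Longrightarrow> (LINT x|lebesgue_on S. g x * \<phi> x) = 0"
  shows "AE x in lebesgue_on S. g x = 0"
proof -
  have S: "S \<in> sets lebesgue" using \<open>open S\<close> by simp
  have gm [measurable]: "g \<in> borel_measurable (lebesgue_on S)" by (rule L2_measurable[OF g])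
  have ind_L2: "(\<lambda>x. indicator (cbox l u) x :: real) \<in> L2 S" for l u :: 'a
  proof (rule L2I_dominated)
    have "integrable lebesgue (\<lambda>x. indicator (cbox l u) x :: real)"
      by (intro integrable_real_indicator) (simp_all add: emeasure_lborel_cbox_finite[unfolded infinity_ennreal_def])
    then show "integrable (lebesgue_on S) (\<lambda>x. indicator (cbox l u) x :: real)"
      by (rule integrable_lebesgue_on[OF S])
    then show "(\<lambda>x. indicator (cbox l u) x :: real) \<in> borel_measurable (lebesgue_on S)" by auto
  qed (auto simp: indicator_def)
  have int: "integrable (lebesgue_on S) (\<lambda>x. \<bar>g x\<bar> * indicator (cbox l u) x)" for l u
    using L2_integrable_mult_norm[OF g ind_L2[of l u]] by simp
  have box0: "(LINT x|lebesgue_on S. g x * indicator (box l u) x) = 0" if sub: "box l u \<subseteq> cbox a b" "cbox a b \<subseteq> S" for l u a b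
  proof (cases "box l u = {}")
    case False
    \<comment> \<open>The closure of a nonempty open box is its closed box, which therefore lies in
      S and admits bump functions. An empty open box is set apart because its closed box may be
      nonempty.\<close>
    have cb: "cbox l u \<subseteq> S"
      using closure_box[OF False] closure_minimal[OF sub(1) closed_cbox] sub(2) by auto
    have "(\<lambda>n. LINT x|lebesgue_on S. g x * bump l u n x) \<longlonglongrightarrow> (LINT x|lebesgue_on S. g x * indicator (box l u) x)"
    proof (rule integral_dominated_convergence)
      show "integrable (lebesgue_on S) (\<lambda>x. \<bar>g x\<bar> * indicator (cbox l u) x)" by (rule int)
      have "box l u \<in> sets (lebesgue_on S)"
        using cb box_subset_cbox[of l u] S by (auto simp: sets_restrict_space_iff)
      then show "(\<lambda>x. g x * indicator (box l u) x) \<in> borel_measurable (lebesgue_on S)" by measurable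
      show "(\<lambda>x. g x * bump l u n x) \<in> borel_measurable (lebesgue_on S)" for n
        using L2_measurable[OF test_funs_L2(1)[OF S bump_test_funs[OF cb]]] by measurable
      show "AE x in lebesgue_on S. (\<lambda>n. g x * bump l u n x) \<longlonglongrightarrow> g x * indicator (box l u) x"
        by (intro AE_I2 tendsto_intros bump_tendsto)
      show "AE x in lebesgue_on S. norm (g x * bump l u n x) \<le> \<bar>g x\<bar> * indicator (cbox l u) x" for n
      proof (intro AE_I2)
        fix x
        show "norm (g x * bump l u n x) \<le> \<bar>g x\<bar> * indicator (cbox l u) x"
        proof (cases "x \<in> cbox l u")
          case True
          then show ?thesis using bump_bounds[of l u n x] by (simp add: abs_mult mult_left_le)
        next
          case False
          then have "x \<notin> box l u" using box_subset_cbox by blast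
          then show ?thesis by (simp add: bump_outside)
        qed
      qed
    qed
    moreover have "(LINT x|lebesgue_on S. g x * bump l u n x) = 0" for n
      by (rule zero[OF bump_test_funs[OF cb]])
    ultimately show ?thesis using LIMSEQ_unique[OF _ tendsto_const] by simp
  qed simp
  have local: "AE x in lebesgue. x \<in> cbox a b \<longrightarrow> g x = 0" if sub: "cbox a b \<subseteq> S" for a b
  proof -
    define f where "f x = indicator S x *\<^sub>R (g x * indicator (cbox a b) x)" for x
    have "integrable (lebesgue_on S) (\<lambda>x. g x * indicator (cbox a b) x)"
      by (rule L2_integrable_mult[OF g ind_L2])
    then have fi: "integrable lebesgue f"
      using S unfolding f_def by (simp add: integrable_restrict_space)
    \<comment> \<open>g is merely Lebesgue measurable; a Borel representative is needed to apply the
      lemma about \<open>lborel\<close>.\<close>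
    obtain f' where f' [measurable]: "f' \<in> borel_measurable lborel" and ff': "AE x in lborel. f x = f' x"
      using completion_ex_borel_measurable_real[of f lborel] fi by auto
    have ff'': "AE x in lebesgue. f x = f' x" using ff' by (simp add: AE_completion_iff)
    have f'm: "f' \<in> borel_measurable lebesgue" using f' by (intro measurable_completion)
    have "integrable lebesgue f'"
      by (rule integrable_cong_AE_imp[OF fi f'm]) (use ff'' in eventually_elim, simp)
    then have f'i: "integrable lborel f'"
      by (simp add: integrable_completion)
    have "AE x in lborel. f' x = 0"
    proof (rule AE_zero_if_integral_boxes_zero[OF f'i])
      fix l u
      obtain l' u' where lu: "box l u \<inter> box a b = box l' u'" using box_Int_box by blast
      have "(LINT x|lborel. f' x * indicator (box l u) x) = (LINT x|lebesgue. f' x * indicator (box l u) x)"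
        by (simp add: integral_completion)
      also have "\<dots> = (LINT x|lebesgue. indicator S x *\<^sub>R (g x * indicator (box l' u') x))"
      proof (rule integral_cong_AE)
        show "(\<lambda>x. f' x * indicator (box l u) x) \<in> borel_measurable lebesgue"
          using f'm by (intro borel_measurable_times borel_measurable_indicator) auto
        have "(\<lambda>x. f x * indicator (box l' u') x) \<in> borel_measurable lebesgue"
          using fi by (intro borel_measurable_times borel_measurable_indicator) auto
        moreover have "(\<lambda>x. f x * indicator (box l' u') x) = (\<lambda>x. indicator S x *\<^sub>R (g x * indicator (box l' u') x))"
          using lu box_subset_cbox[of a b] by (auto simp: f_def indicator_def fun_eq_iff)
        ultimately show "(\<lambda>x. indicator S x *\<^sub>R (g x * indicator (box l' u') x)) \<in> borel_measurable lebesgue" by simp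
        \<comment> \<open>f is cut off to the closed box, but the intersection with an open test box
          must be an open box; the difference lies in a null set.\<close>
        have "AE x in lebesgue. x \<notin> cbox a b - box a b"
          using negligible_frontier_interval[of a b] by (intro AE_not_in) (simp add: negligible_iff_null_sets)
        with ff'' show "AE x in lebesgue. f' x * indicator (box l u) x = indicator S x *\<^sub>R (g x * indicator (box l' u') x)"
        proof eventually_elim
          case (elim x)
          then show ?case unfolding lu[symmetric] using box_subset_cbox[of a b]
            by (auto simp: f_def indicator_def split: if_splits)
        qed
      qed
      also have "\<dots> = (LINT x|lebesgue_on S. g x * indicator (box l' u') x)"
        using S by (simp add: integral_restrict_space)
      also have "\<dots> = 0"
        by (rule box0[OF _ sub]) (use lu box_subset_cbox[of a b] in blast)
      finally show "(LINT x|lborel. f' x * indicator (box l u) x) = 0" .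
    qed
    then have "AE x in lebesgue. f' x = 0" by (simp add: AE_completion_iff)
    with ff'' show ?thesis
    proof eventually_elim
      case (elim x)
      then show ?case using sub by (auto simp: f_def)
    qed
  qed
  obtain D where D: "countable D" "\<And>X. X \<in> D \<Longrightarrow> X \<subseteq> S" "\<And>X. X \<in> D \<Longrightarrow> \<exists>a b. X = cbox a b" "\<Union>D = S"
    by (rule open_countable_Union_open_cbox[OF \<open>open S\<close>]) blast
  have "AE x in lebesgue. \<forall>X\<in>D. x \<in> X \<longrightarrow> g x = 0"
    unfolding AE_ball_countable[OF D(1)]
  proof
    fix X assume X: "X \<in> D"
    then obtain a b where "X = cbox a b" using D(3) by blast
    with D(2)[OF X] local show "AE x in lebesgue. x \<in> X \<longrightarrow> g x = 0" by simp
  qed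
  then have "AE x in lebesgue. x \<in> S \<longrightarrow> g x = 0"
    by eventually_elim (use D(4) in blast)
  then show ?thesis
    using S by (subst AE_restrict_space_iff) auto
qed

lemma weak_grad_unique:
  fixes G H :: "'a::euclidean_space \<Rightarrow> 'a"
  assumes "open S" "G \<in> L2 S" "H \<in> L2 S" "is_weak_grad S u G" "is_weak_grad S u H"
  shows "AE x in lebesgue_on S. G x = H x"
proof -
  have "AE x in lebesgue_on S. (G x - H x) \<bullet> b = 0" if b: "b \<in> Basis" for b
  proof (rule fundamental_lemma[OF assms(1)])
    show "(\<lambda>x. (G x - H x) \<bullet> b) \<in> L2 S" by (intro L2_component L2_diff assms)
    fix \<phi> assume \<phi>: "\<phi> \<in> test_funs S"
    have "\<phi> \<in> L2 S" using test_funs_L2(1)[OF _ \<phi>] assms(1) by simp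
    then have "(LINT x|lebesgue_on S. (G x - H x) \<bullet> b * \<phi> x) =
        (LINT x|lebesgue_on S. (G x \<bullet> b) * \<phi> x) - (LINT x|lebesgue_on S. (H x \<bullet> b) * \<phi> x)"
      using assms by (simp add: inner_diff_left left_diff_distrib L2_integrable_mult L2_component)
    then show "(LINT x|lebesgue_on S. (G x - H x) \<bullet> b * \<phi> x) = 0"
      using is_weak_gradD[OF assms(4) \<phi> b] is_weak_gradD[OF assms(5) \<phi> b] by simp
  qed
  then have "AE x in lebesgue_on S. \<forall>b\<in>Basis. (G x - H x) \<bullet> b = 0"
    by (subst AE_finite_all) auto
  then show ?thesis
  proof eventually_elim
    case (elim x)
    then have "G x - H x = 0" by (subst euclidean_all_zero_iff[symmetric]) 
    then show ?case by simp
  qed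
qed

section \<open>Sobolev functions vanishing on the boundary\<close>

lemma L2_scaleR_const:
  fixes f :: "'a::euclidean_space \<Rightarrow> real"
  assumes "f \<in> L2 S"
  shows "(\<lambda>x. f x *\<^sub>R e) \<in> L2 S"
  by (rule L2I_dominated[of _ _ "\<lambda>x. (norm e)\<^sup>2 * (norm (f x))\<^sup>2"])
     (use L2_measurable[OF assms] L2_integrable_norm[OF assms] in \<open>auto simp: power_mult_distrib\<close>)

lemma weak_grad_spec:
  assumes "u \<in> H1 S"
  shows "weak_grad S u \<in> L2 S" "is_weak_grad S u (weak_grad S u)"
proof -
  have "\<exists>G. G \<in> L2 S \<and> is_weak_grad S u G" using assms by (auto simp: H1_def)
  from someI_ex[OF this] show "weak_grad S u \<in> L2 S" "is_weak_grad S u (weak_grad S u)"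
    by (auto simp: weak_grad_def)
qed

lemma weak_grad_eq_AE:
  assumes "open S" "u \<in> L2 S" "G \<in> L2 S" "is_weak_grad S u G"
  shows "u \<in> H1 S" "AE x in lebesgue_on S. weak_grad S u x = G x"
proof -
  show u: "u \<in> H1 S" using assms by (auto simp: H1_def)
  show "AE x in lebesgue_on S. weak_grad S u x = G x"
    using weak_grad_unique[OF assms(1) weak_grad_spec(1)[OF u] assms(3) weak_grad_spec(2)[OF u] assms(4)] .
qed

lemma H1_L2: "u \<in> H1 S \<Longrightarrow> u \<in> L2 S"
  by (simp add: H1_def)

lemma is_weak_grad_lincomb:
  assumes S: "S \<in> sets lebesgue" and u: "u \<in> L2 S" "w \<in> L2 S" and G: "G \<in> L2 S" "H \<in> L2 S"
    and wk: "is_weak_grad S u G" "is_weak_grad S w H"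
  shows "is_weak_grad S (\<lambda>x. a * u x + b * w x) (\<lambda>x. a *\<^sub>R G x + b *\<^sub>R H x)"
  unfolding is_weak_grad_iff
proof (intro ballI)
  fix \<phi> and e :: 'a assume \<phi>: "\<phi> \<in> test_funs S" and e: "e \<in> Basis"
  note \<phi>2 = test_funs_L2[OF S \<phi>]
  have i: "integrable (lebesgue_on S) (\<lambda>x. u x * (sgrad \<phi> x \<bullet> e))"
      "integrable (lebesgue_on S) (\<lambda>x. w x * (sgrad \<phi> x \<bullet> e))"
      "integrable (lebesgue_on S) (\<lambda>x. (G x \<bullet> e) * \<phi> x)"
      "integrable (lebesgue_on S) (\<lambda>x. (H x \<bullet> e) * \<phi> x)"
    using u G \<phi>2 by (auto intro: L2_integrable_mult L2_component)
  have "(LINT x|lebesgue_on S. (a * u x + b * w x) * (sgrad \<phi> x \<bullet> e)) =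
      (LINT x|lebesgue_on S. a * (u x * (sgrad \<phi> x \<bullet> e)) + b * (w x * (sgrad \<phi> x \<bullet> e)))"
    by (simp add: algebra_simps)
  also have "\<dots> = a * (LINT x|lebesgue_on S. u x * (sgrad \<phi> x \<bullet> e)) + b * (LINT x|lebesgue_on S. w x * (sgrad \<phi> x \<bullet> e))"
    using i by simp
  also have "\<dots> = - (a * (LINT x|lebesgue_on S. (G x \<bullet> e) * \<phi> x) + b * (LINT x|lebesgue_on S. (H x \<bullet> e) * \<phi> x))"
    using is_weak_gradD[OF wk(1) \<phi> e] is_weak_gradD[OF wk(2) \<phi> e] by simp
  also have "\<dots> = - (LINT x|lebesgue_on S. a * ((G x \<bullet> e) * \<phi> x) + b * ((H x \<bullet> e) * \<phi> x))"
    using i by simp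
  finally show "(LINT x|lebesgue_on S. (a * u x + b * w x) * (sgrad \<phi> x \<bullet> e)) =
      - (LINT x|lebesgue_on S. ((a *\<^sub>R G x + b *\<^sub>R H x) \<bullet> e) * \<phi> x)"
    by (simp add: inner_add_left algebra_simps)
qed

text \<open>Both sides of the defining identity are L2 pairings with a fixed function, hence
  continuous along the sequence.\<close>

lemma is_weak_grad_limit:
  assumes S: "S \<in> sets lebesgue"
    and u: "\<And>n. f n \<in> L2 S" "u \<in> L2 S" "(\<lambda>n. L2_norm S (\<lambda>x. f n x - u x)) \<longlonglongrightarrow> 0"
    and G: "\<And>n. F n \<in> L2 S" "G \<in> L2 S" "(\<lambda>n. L2_norm S (\<lambda>x. F n x - G x)) \<longlonglongrightarrow> 0"
    and wk: "\<And>n. is_weak_grad S (f n) (F n)"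
  shows "is_weak_grad S u G"
  unfolding is_weak_grad_iff
proof (intro ballI)
  fix \<phi> and e :: 'a assume \<phi>: "\<phi> \<in> test_funs S" and e: "e \<in> Basis"
  note \<phi>2 = test_funs_L2[OF S \<phi>]
  have "(\<lambda>n. LINT x|lebesgue_on S. f n x * (sgrad \<phi> x \<bullet> e)) \<longlonglongrightarrow> (LINT x|lebesgue_on S. u x * (sgrad \<phi> x \<bullet> e))"
    using L2_tendsto_integral[OF u L2_component[OF \<phi>2(2), of e]] by simp
  moreover have "(\<lambda>n. - (LINT x|lebesgue_on S. (F n x \<bullet> e) * \<phi> x)) \<longlonglongrightarrow> - (LINT x|lebesgue_on S. (G x \<bullet> e) * \<phi> x)"
    using tendsto_minus[OF L2_tendsto_integral[OF G L2_scaleR_const[OF \<phi>2(1), of e]]] by (simp add: mult.commute)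
  ultimately show "(LINT x|lebesgue_on S. u x * (sgrad \<phi> x \<bullet> e)) = - (LINT x|lebesgue_on S. (G x \<bullet> e) * \<phi> x)"
    using is_weak_gradD[OF wk \<phi> e] LIMSEQ_unique by simp
qed

lemma L2_norm_lincomb_le:
  assumes "f \<in> L2 S" "g \<in> L2 S"
  shows "L2_norm S (\<lambda>x. a *\<^sub>R f x + b *\<^sub>R g x) \<le> \<bar>a\<bar> * L2_norm S f + \<bar>b\<bar> * L2_norm S g"
  using L2_norm_triangle[OF L2_scaleR[OF assms(1), of a] L2_scaleR[OF assms(2), of b]]
  by (simp add: L2_norm_scaleR)

lemma L2_tendsto_lincomb:
  assumes "\<And>n. f n \<in> L2 S" "u \<in> L2 S" "\<And>n. g n \<in> L2 S" "w \<in> L2 S"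
    and "(\<lambda>n. L2_norm S (\<lambda>x. u x - f n x)) \<longlonglongrightarrow> 0" "(\<lambda>n. L2_norm S (\<lambda>x. w x - g n x)) \<longlonglongrightarrow> 0"
  shows "(\<lambda>n. L2_norm S (\<lambda>x. (a *\<^sub>R u x + b *\<^sub>R w x) - (a *\<^sub>R f n x + b *\<^sub>R g n x))) \<longlonglongrightarrow> 0"
proof (rule Lim_null_comparison[OF eventuallyI])
  show "norm (L2_norm S (\<lambda>x. (a *\<^sub>R u x + b *\<^sub>R w x) - (a *\<^sub>R f n x + b *\<^sub>R g n x))) \<le>
      \<bar>a\<bar> * L2_norm S (\<lambda>x. u x - f n x) + \<bar>b\<bar> * L2_norm S (\<lambda>x. w x - g n x)" for n
    using L2_norm_lincomb_le[OF L2_diff[OF assms(2) assms(1)[of n]] L2_diff[OF assms(4) assms(3)[of n]], of a b]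
    by (simp add: algebra_simps)
  show "(\<lambda>n. \<bar>a\<bar> * L2_norm S (\<lambda>x. u x - f n x) + \<bar>b\<bar> * L2_norm S (\<lambda>x. w x - g n x)) \<longlonglongrightarrow> 0"
    using tendsto_add[OF tendsto_mult_left[OF assms(5), of "\<bar>a\<bar>"] tendsto_mult_left[OF assms(6), of "\<bar>b\<bar>"]] by simp
qed

section \<open>The closure of the test functions, with the gradient carried along\<close>

definition h01_seq :: "'a::euclidean_space set \<Rightarrow> ('a \<Rightarrow> real) \<Rightarrow> ('a \<Rightarrow> 'a) \<Rightarrow> (nat \<Rightarrow> 'a \<Rightarrow> real) \<Rightarrow> bool" where
  "h01_seq S u G \<phi> \<longleftrightarrow> u \<in> L2 S \<and> G \<in> L2 S \<and> (\<forall>n. \<phi> n \<in> test_funs S) \<and>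
     (\<lambda>n. L2_norm S (\<lambda>x. u x - \<phi> n x)) \<longlonglongrightarrow> 0 \<and>
     (\<lambda>n. L2_norm S (\<lambda>x. G x - sgrad (\<phi> n) x)) \<longlonglongrightarrow> 0"

text \<open>The pairs \<open>(u, G)\<close> with \<open>u \<in> H\<^sub>0\<^sup>1(S)\<close> and \<open>G = \<nabla>u\<close>, in a form that does not refer to the
  choice operator behind \<open>weak_grad\<close>.\<close>

definition h01 :: "'a::euclidean_space set \<Rightarrow> ('a \<Rightarrow> real) \<Rightarrow> ('a \<Rightarrow> 'a) \<Rightarrow> bool" where
  "h01 S u G \<longleftrightarrow> (\<exists>\<phi>. h01_seq S u G \<phi>)"

lemma h01_seqD:
  assumes "h01_seq S u G \<phi>"
  shows "u \<in> L2 S" "G \<in> L2 S" "\<phi> n \<in> test_funs S"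
    "(\<lambda>n. L2_norm S (\<lambda>x. u x - \<phi> n x)) \<longlonglongrightarrow> 0" "(\<lambda>n. L2_norm S (\<lambda>x. G x - sgrad (\<phi> n) x)) \<longlonglongrightarrow> 0"
  using assms by (simp_all add: h01_seq_def)

lemma h01I:
  "u \<in> L2 S \<Longrightarrow> G \<in> L2 S \<Longrightarrow> (\<And>n. \<phi> n \<in> test_funs S) \<Longrightarrow>
    (\<lambda>n. L2_norm S (\<lambda>x. u x - \<phi> n x)) \<longlonglongrightarrow> 0 \<Longrightarrow> (\<lambda>n. L2_norm S (\<lambda>x. G x - sgrad (\<phi> n) x)) \<longlonglongrightarrow> 0 \<Longrightarrow> h01 S u G"
  unfolding h01_def h01_seq_def by blast

lemma h01_L2: "h01 S u G \<Longrightarrow> u \<in> L2 S" "h01 S u G \<Longrightarrow> G \<in> L2 S"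
  by (auto simp: h01_def h01_seq_def)

lemma h01_is_weak_grad:
  assumes "S \<in> sets lebesgue" "h01 S u G"
  shows "is_weak_grad S u G"
proof -
  obtain \<phi> where "h01_seq S u G \<phi>" using assms(2) unfolding h01_def by blast
  note \<phi> = h01_seqD[OF this]
  show ?thesis
    by (rule is_weak_grad_limit[OF assms(1) test_funs_L2(1)[OF assms(1) \<phi>(3)] \<phi>(1) _
          test_funs_L2(2)[OF assms(1) \<phi>(3)] \<phi>(2) _ is_weak_grad_test_funs[OF assms(1) \<phi>(3)]])
       (use \<phi>(4,5) in \<open>simp_all add: L2_norm_minus_commute[of _ u] L2_norm_minus_commute[of _ G]\<close>)
qed

lemma h01_weak_grad_AE:
  assumes "open S" "h01 S u G"
  shows "u \<in> H1 S" "AE x in lebesgue_on S. weak_grad S u x = G x"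
proof -
  have "is_weak_grad S u G" using assms by (intro h01_is_weak_grad) auto
  then show "u \<in> H1 S" "AE x in lebesgue_on S. weak_grad S u x = G x"
    using weak_grad_eq_AE[OF assms(1) h01_L2[OF assms(2)]] by auto
qed

text \<open>The left side involves a gradient chosen afresh for the difference; uniqueness allows it
  to be replaced by the difference of the gradients.\<close>

lemma H1_norm_diff_test:
  assumes "open S" "u \<in> H1 S" "\<phi> \<in> test_funs S"
  shows "H1_norm S (\<lambda>x. u x - \<phi> x) =
    sqrt ((L2_norm S (\<lambda>x. u x - \<phi> x))\<^sup>2 + (L2_norm S (\<lambda>x. weak_grad S u x - sgrad \<phi> x))\<^sup>2)"
proof -
  have S: "S \<in> sets lebesgue" using assms(1) by simp
  note \<phi>2 = test_funs_L2[OF S assms(3)]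
  note u = H1_L2[OF assms(2)] weak_grad_spec[OF assms(2)]
  have wk: "is_weak_grad S (\<lambda>x. u x - \<phi> x) (\<lambda>x. weak_grad S u x - sgrad \<phi> x)"
    using is_weak_grad_lincomb[OF S u(1) \<phi>2(1) u(2) \<phi>2(2) u(3) is_weak_grad_test_funs[OF S assms(3)], of 1 "-1"]
    by simp
  note d = weak_grad_eq_AE[OF assms(1) L2_diff[OF u(1) \<phi>2(1)] L2_diff[OF u(2) \<phi>2(2)] wk]
  have "L2_norm S (weak_grad S (\<lambda>x. u x - \<phi> x)) = L2_norm S (\<lambda>x. weak_grad S u x - sgrad \<phi> x)"
    by (rule L2_norm_cong_AE[OF weak_grad_spec(1)[OF d(1)] L2_diff[OF u(2) \<phi>2(2)] d(2)])
  then show ?thesis by (simp add: H1_norm_def)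
qed

lemma L2_norm_le_H1_norm: "L2_norm S u \<le> H1_norm S u" "L2_norm S (weak_grad S u) \<le> H1_norm S u"
  by (simp_all add: H1_norm_def real_le_rsqrt)

text \<open>The passage between \<open>H01\<close> of the problem statement and the choice-free
  predicate on which all limit arguments are run.\<close>

lemma H01_iff_h01:
  assumes "open S"
  shows "u \<in> H01 S \<longleftrightarrow> h01 S u (weak_grad S u)"
proof
  assume "u \<in> H01 S"
  then obtain \<phi> where u: "u \<in> H1 S" and \<phi>: "\<And>n. \<phi> n \<in> test_funs S"
      and lim: "(\<lambda>n. H1_norm S (\<lambda>x. u x - \<phi> n x)) \<longlonglongrightarrow> 0"
    unfolding H01_def by blast
  have "(\<lambda>n. L2_norm S (\<lambda>x. u x - \<phi> n x)) \<longlonglongrightarrow> 0"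
    by (rule Lim_null_comparison[OF eventuallyI lim]) (simp add: L2_norm_le_H1_norm)
  moreover have "(\<lambda>n. L2_norm S (\<lambda>x. weak_grad S u x - sgrad (\<phi> n) x)) \<longlonglongrightarrow> 0"
    by (rule Lim_null_comparison[OF eventuallyI lim])
       (simp add: H1_norm_diff_test[OF assms u \<phi>] real_le_rsqrt)
  ultimately show "h01 S u (weak_grad S u)"
    by (intro h01I[of _ _ _ \<phi>] H1_L2[OF u] weak_grad_spec(1)[OF u] \<phi>)
next
  assume "h01 S u (weak_grad S u)"
  note h = this
  obtain \<phi> where "h01_seq S u (weak_grad S u) \<phi>" using h unfolding h01_def by blast
  note \<phi> = h01_seqD[OF this]
  have u: "u \<in> H1 S" by (rule h01_weak_grad_AE(1)[OF assms h])
  have "(\<lambda>n. H1_norm S (\<lambda>x. u x - \<phi> n x)) \<longlonglongrightarrow> 0"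
    unfolding H1_norm_diff_test[OF assms u \<phi>(3)]
    using tendsto_real_sqrt[OF tendsto_add[OF tendsto_power[OF \<phi>(4), of 2] tendsto_power[OF \<phi>(5), of 2]]] by simp
  then show "u \<in> H01 S" unfolding H01_def using u \<phi>(3) by blast
qed

text \<open>The approximating sequence is unchanged, since L2 norms ignore null sets. It serves to
  exchange a gradient found by a construction for the chosen \<open>weak_grad\<close>.\<close>

lemma h01_cong_AE:
  assumes h: "h01 S u G" and w: "w \<in> L2 S" "H \<in> L2 S"
    and ae: "AE x in lebesgue_on S. w x = u x" "AE x in lebesgue_on S. H x = G x" and S: "S \<in> sets lebesgue"
  shows "h01 S w H"
proof -
  obtain \<phi> where "h01_seq S u G \<phi>" using h unfolding h01_def by blast
  note \<phi> = h01_seqD[OF this]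
  have "L2_norm S (\<lambda>x. w x - \<phi> n x) = L2_norm S (\<lambda>x. u x - \<phi> n x)"
     "L2_norm S (\<lambda>x. H x - sgrad (\<phi> n) x) = L2_norm S (\<lambda>x. G x - sgrad (\<phi> n) x)" for n
    by (rule L2_norm_cong_AE, (intro L2_diff w \<phi> test_funs_L2[OF S \<phi>(3)])+, use ae in auto)+
  then show ?thesis using \<phi>(3-5) w by (intro h01I[of _ _ _ \<phi>]) simp_all
qed

lemma h01_imp_H01:
  assumes "open S" "h01 S u G"
  shows "u \<in> H01 S"
  unfolding H01_iff_h01[OF assms(1)]
  by (rule h01_cong_AE[OF assms(2)])
     (use assms h01_L2[OF assms(2)] h01_weak_grad_AE[OF assms] weak_grad_spec in auto)

lemma h01_test_funs: "S \<in> sets lebesgue \<Longrightarrow> \<phi> \<in> test_funs S \<Longrightarrow> h01 S \<phi> (sgrad \<phi>)"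
  using test_funs_L2[of S \<phi> S] by (intro h01I[of _ _ _ "\<lambda>n. \<phi>"]) (auto simp: L2_norm_def)

lemma h01_lincomb:
  assumes S: "S \<in> sets lebesgue" and "h01 S u G" "h01 S w H"
  shows "h01 S (\<lambda>x. a * u x + b * w x) (\<lambda>x. a *\<^sub>R G x + b *\<^sub>R H x)"
proof -
  obtain \<phi> where "h01_seq S u G \<phi>" using assms(2) unfolding h01_def by blast
  note \<phi> = h01_seqD[OF this]
  obtain \<psi> where "h01_seq S w H \<psi>" using assms(3) unfolding h01_def by blast
  note \<psi> = h01_seqD[OF this]
  note t = test_funs_L2[OF S \<phi>(3)] test_funs_L2[OF S \<psi>(3)]
  have "(\<lambda>n. L2_norm S (\<lambda>x. (a * u x + b * w x) - (a * \<phi> n x + b * \<psi> n x))) \<longlonglongrightarrow> 0"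
    using L2_tendsto_lincomb[OF t(1) \<phi>(1) t(3) \<psi>(1) \<phi>(4) \<psi>(4), of a b] by simp
  moreover have "(\<lambda>n. L2_norm S (\<lambda>x. (a *\<^sub>R G x + b *\<^sub>R H x) - sgrad (\<lambda>x. a * \<phi> n x + b * \<psi> n x) x)) \<longlonglongrightarrow> 0"
    using L2_tendsto_lincomb[OF t(2) \<phi>(2) t(4) \<psi>(2) \<phi>(5) \<psi>(5), of a b]
    by (simp add: sgrad_lincomb test_funs_smooth[OF \<phi>(3)] test_funs_smooth[OF \<psi>(3)])
  moreover have "(\<lambda>x. a * u x + b * w x) \<in> L2 S" "(\<lambda>x. a *\<^sub>R G x + b *\<^sub>R H x) \<in> L2 S"
    using \<phi> \<psi> by (auto intro: L2_add L2_cmult L2_scaleR)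
  ultimately show ?thesis
    using test_funs_lincomb[OF \<phi>(3) \<psi>(3)] by (intro h01I[of _ _ _ "\<lambda>n x. a * \<phi> n x + b * \<psi> n x"])
qed

text \<open>Diagonal argument: the n-th pair is replaced by a test function within 1/(n+1) of it, in
  value and in gradient.\<close>

lemma h01_limit:
  assumes S: "S \<in> sets lebesgue" and h: "\<And>n. h01 S (f n) (F n)"
    and u: "u \<in> L2 S" "G \<in> L2 S"
    and lim: "(\<lambda>n. L2_norm S (\<lambda>x. f n x - u x)) \<longlonglongrightarrow> 0" "(\<lambda>n. L2_norm S (\<lambda>x. F n x - G x)) \<longlonglongrightarrow> 0"
  shows "h01 S u G"
proof -
  have "\<exists>\<phi>\<in>test_funs S. L2_norm S (\<lambda>x. f n x - \<phi> x) < inverse (real (Suc n)) \<and>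
      L2_norm S (\<lambda>x. F n x - sgrad \<phi> x) < inverse (real (Suc n))" for n
  proof -
    obtain \<phi> where "h01_seq S (f n) (F n) \<phi>" using h[of n] unfolding h01_def by blast
    note \<phi> = h01_seqD(3-5)[OF this]
    have e: "0 < inverse (real (Suc n))" by simp
    have "\<forall>\<^sub>F k in sequentially. L2_norm S (\<lambda>x. f n x - \<phi> k x) < inverse (real (Suc n)) \<and>
      L2_norm S (\<lambda>x. F n x - sgrad (\<phi> k) x) < inverse (real (Suc n))"
      by (intro eventually_conj order_tendstoD(2)[OF \<phi>(2) e] order_tendstoD(2)[OF \<phi>(3) e])
    then show ?thesis using \<phi>(1) by (auto simp: eventually_sequentially)
  qed
  then obtain \<phi> where \<phi>: "\<And>n. \<phi> n \<in> test_funs S"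
      "\<And>n. L2_norm S (\<lambda>x. f n x - \<phi> n x) < inverse (real (Suc n))"
      "\<And>n. L2_norm S (\<lambda>x. F n x - sgrad (\<phi> n) x) < inverse (real (Suc n))"
    by metis
  note t = test_funs_L2[OF S \<phi>(1)]
  note hL = h01_L2[OF h]
  have "(\<lambda>n. L2_norm S (\<lambda>x. u x - \<phi> n x)) \<longlonglongrightarrow> 0"
  proof (rule Lim_null_comparison[OF eventuallyI])
    show "norm (L2_norm S (\<lambda>x. u x - \<phi> n x)) \<le> L2_norm S (\<lambda>x. f n x - u x) + inverse (real (Suc n))" for n
      using L2_norm_triangle_diff[OF u(1) hL(1)[of n] t(1)[of n]] \<phi>(2)[of n] L2_norm_minus_commute[of S u "f n"] by simp
    show "(\<lambda>n. L2_norm S (\<lambda>x. f n x - u x) + inverse (real (Suc n))) \<longlonglongrightarrow> 0"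
      using tendsto_add[OF lim(1) LIMSEQ_inverse_real_of_nat] by simp
  qed
  moreover have "(\<lambda>n. L2_norm S (\<lambda>x. G x - sgrad (\<phi> n) x)) \<longlonglongrightarrow> 0"
  proof (rule Lim_null_comparison[OF eventuallyI])
    show "norm (L2_norm S (\<lambda>x. G x - sgrad (\<phi> n) x)) \<le> L2_norm S (\<lambda>x. F n x - G x) + inverse (real (Suc n))" for n
      using L2_norm_triangle_diff[OF u(2) hL(2)[of n] t(2)[of n]] \<phi>(3)[of n] L2_norm_minus_commute[of S G "F n"] by simp
    show "(\<lambda>n. L2_norm S (\<lambda>x. F n x - G x) + inverse (real (Suc n))) \<longlonglongrightarrow> 0"
      using tendsto_add[OF lim(2) LIMSEQ_inverse_real_of_nat] by simp
  qed
  ultimately show ?thesis by (intro h01I[of _ _ _ \<phi>] u \<phi>(1))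
qed


subsection \<open>Restriction and extension by zero\<close>

lemma lebesgue_integral_extend:
  fixes f :: "'a::euclidean_space \<Rightarrow> real"
  assumes "S \<in> sets lebesgue" "S' \<in> sets lebesgue" "S \<subseteq> S'" "\<And>x. x \<notin> S \<Longrightarrow> f x = 0"
  shows "integrable (lebesgue_on S') f \<longleftrightarrow> integrable (lebesgue_on S) f"
    "(LINT x|lebesgue_on S'. f x) = (LINT x|lebesgue_on S. f x)"
proof -
  have "(\<lambda>x. indicator S' x *\<^sub>R f x) = (\<lambda>x. indicator S x *\<^sub>R f x)"
    using assms(3,4) by (auto simp: fun_eq_iff split: split_indicator)
  then show "integrable (lebesgue_on S') f \<longleftrightarrow> integrable (lebesgue_on S) f"
    "(LINT x|lebesgue_on S'. f x) = (LINT x|lebesgue_on S. f x)"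
    using assms(1,2) by (simp_all add: integrable_restrict_space integral_restrict_space del: real_scaleR_def)
qed

lemma L2_restrict:
  fixes f :: "'a::euclidean_space \<Rightarrow> 'b::euclidean_space"
  assumes "S \<in> sets lebesgue" "S' \<in> sets lebesgue" "S \<subseteq> S'" "f \<in> L2 S'"
  shows "f \<in> L2 S" "L2_norm S f \<le> L2_norm S' f"
proof -
  let ?g = "\<lambda>x. indicator S x * (norm (f x))\<^sup>2"
  have i: "integrable (lebesgue_on S') ?g"
    using integrable_mult_indicator[OF _ L2_integrable_norm[OF assms(4)], of S] assms
    by (simp add: sets_restrict_space_iff)
  have "integrable (lebesgue_on S) ?g"
    using lebesgue_integral_extend(1)[OF assms(1-3), of ?g] i by simp
  then have "integrable (lebesgue_on S) (\<lambda>x. (norm (f x))\<^sup>2)"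
    by (rule Bochner_Integration.integrable_cong[THEN iffD1, rotated -1]) auto
  moreover have "f \<in> borel_measurable (lebesgue_on S)"
    using L2_measurable[OF assms(4)] assms(3) by (rule measurable_restrict_mono)
  ultimately show "f \<in> L2 S" by (simp add: L2_def)
  have "(LINT x|lebesgue_on S. (norm (f x))\<^sup>2) = (LINT x|lebesgue_on S. ?g x)"
    by (rule Bochner_Integration.integral_cong) auto
  also have "\<dots> = (LINT x|lebesgue_on S'. ?g x)"
    using lebesgue_integral_extend(2)[OF assms(1-3), of ?g] by simp
  also have "\<dots> \<le> (LINT x|lebesgue_on S'. (norm (f x))\<^sup>2)"
    by (rule integral_mono[OF i L2_integrable_norm[OF assms(4)]]) (simp split: split_indicator)
  finally show "L2_norm S f \<le> L2_norm S' f" by (simp add: L2_norm_def)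
qed

lemma is_weak_grad_restrict:
  assumes "S \<in> sets lebesgue" "S' \<in> sets lebesgue" "S \<subseteq> S'" "is_weak_grad S' u G"
  shows "is_weak_grad S u G"
  unfolding is_weak_grad_iff
proof (intro ballI)
  fix \<phi> and b :: 'a assume \<phi>: "\<phi> \<in> test_funs S" and b: "b \<in> Basis"
  have "(LINT x|lebesgue_on S'. u x * (sgrad \<phi> x \<bullet> b)) = (LINT x|lebesgue_on S. u x * (sgrad \<phi> x \<bullet> b))"
    by (rule lebesgue_integral_extend(2)[OF assms(1-3)]) (simp add: sgrad_outside[OF \<phi>])
  moreover have "(LINT x|lebesgue_on S'. (G x \<bullet> b) * \<phi> x) = (LINT x|lebesgue_on S. (G x \<bullet> b) * \<phi> x)"
    by (rule lebesgue_integral_extend(2)[OF assms(1-3)]) (simp add: test_funs_outside[OF \<phi>])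
  ultimately show "(LINT x|lebesgue_on S. u x * (sgrad \<phi> x \<bullet> b)) = - (LINT x|lebesgue_on S. (G x \<bullet> b) * \<phi> x)"
    using is_weak_gradD[OF assms(4) test_funs_mono[OF assms(3) \<phi>] b] by simp
qed

definition zext :: "'a set \<Rightarrow> ('a \<Rightarrow> 'b::zero) \<Rightarrow> 'a \<Rightarrow> 'b" where
  "zext S f x = (if x \<in> S then f x else 0)"

lemma L2_zext:
  fixes f :: "'a::euclidean_space \<Rightarrow> 'b::euclidean_space"
  assumes "S \<in> sets lebesgue" "S' \<in> sets lebesgue" "S \<subseteq> S'" "f \<in> L2 S"
  shows "zext S f \<in> L2 S'" "L2_norm S' (zext S f) = L2_norm S f"
proof -
  have "zext S f \<in> borel_measurable (lebesgue_on S')"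
    using borel_measurable_if_lebesgue_on[OF assms(1-3), of f] L2_measurable[OF assms(4)]
    by (simp add: zext_def[abs_def])
  moreover have "integrable (lebesgue_on S) (\<lambda>x. (norm (zext S f x))\<^sup>2)"
    using L2_integrable_norm[OF assms(4)]
    by (rule Bochner_Integration.integrable_cong[THEN iffD1, rotated -1]) (auto simp: zext_def)
  ultimately show "zext S f \<in> L2 S'"
    unfolding L2_def using lebesgue_integral_extend(1)[OF assms(1-3), of "\<lambda>x. (norm (zext S f x))\<^sup>2"]
    by (simp add: zext_def)
  have "(LINT x|lebesgue_on S'. (norm (zext S f x))\<^sup>2) = (LINT x|lebesgue_on S. (norm (zext S f x))\<^sup>2)"
    by (rule lebesgue_integral_extend(2)[OF assms(1-3)]) (simp add: zext_def)
  also have "\<dots> = (LINT x|lebesgue_on S. (norm (f x))\<^sup>2)"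
    by (rule Bochner_Integration.integral_cong) (auto simp: zext_def)
  finally show "L2_norm S' (zext S f) = L2_norm S f" by (simp add: L2_norm_def)
qed

text \<open>The same test functions approximate the extension, because they and their gradients
  vanish outside S.\<close>

lemma h01_zext:
  assumes "S \<in> sets lebesgue" "S' \<in> sets lebesgue" "S \<subseteq> S'" "h01 S u G"
  shows "h01 S' (zext S u) (zext S G)"
proof -
  obtain \<phi> where "h01_seq S u G \<phi>" using assms(4) unfolding h01_def by blast
  note \<phi> = h01_seqD[OF this]
  note t = test_funs_L2[OF assms(1) \<phi>(3)]
  have "(\<lambda>x. zext S u x - \<phi> n x) = zext S (\<lambda>x. u x - \<phi> n x)"
    "(\<lambda>x. zext S G x - sgrad (\<phi> n) x) = zext S (\<lambda>x. G x - sgrad (\<phi> n) x)" for n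
    using test_funs_outside[OF \<phi>(3)] sgrad_outside[OF \<phi>(3)] by (auto simp: zext_def fun_eq_iff)
  then have "L2_norm S' (\<lambda>x. zext S u x - \<phi> n x) = L2_norm S (\<lambda>x. u x - \<phi> n x)"
    "L2_norm S' (\<lambda>x. zext S G x - sgrad (\<phi> n) x) = L2_norm S (\<lambda>x. G x - sgrad (\<phi> n) x)" for n
    using L2_zext(2)[OF assms(1-3) L2_diff[OF \<phi>(1) t(1)]] L2_zext(2)[OF assms(1-3) L2_diff[OF \<phi>(2) t(2)]] by simp_all
  then show ?thesis
    using \<phi> by (intro h01I[of _ _ _ \<phi>] L2_zext(1)[OF assms(1-3)] test_funs_mono[OF assms(3)]) auto
qed

section \<open>Estimates in the plane\<close>

text \<open>Written as a combination of axis vectors, so that continuity, measurability and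
  derivatives along coordinate lines follow from the algebraic rules.\<close>

definition pt :: "real \<Rightarrow> real \<Rightarrow> real^2" where
  "pt a b = a *\<^sub>R axis 1 1 + b *\<^sub>R axis 2 1"

lemma pt_nth [simp]: "pt a b $ 1 = a" "pt a b $ 2 = b"
  by (simp_all add: pt_def axis_def)

lemma box_vec2: "x \<in> box l u \<longleftrightarrow> l$1 < x$1 \<and> x$1 < u$1 \<and> l$2 < x$2 \<and> x$2 < u$2" for x :: "real^2"
  by (auto simp: mem_box_cart forall_2)

lemma borel_measurable_pt [measurable]: "(\<lambda>(a, b). pt a b) \<in> borel \<Otimes>\<^sub>M borel \<rightarrow>\<^sub>M borel"
proof -
  have "continuous_on UNIV (\<lambda>p. pt (fst p) (snd p))"
    unfolding pt_def by (intro continuous_intros)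
  then have "(\<lambda>p. pt (fst p) (snd p)) \<in> borel_measurable borel"
    by (rule borel_measurable_continuous_onI)
  then show ?thesis by (simp add: borel_prod case_prod_beta')
qed

lemma measurable_pt_comp [measurable (raw)]:
  "f \<in> borel_measurable M \<Longrightarrow> g \<in> borel_measurable M \<Longrightarrow> (\<lambda>x. pt (f x) (g x)) \<in> borel_measurable M"
  unfolding pt_def by (intro borel_measurable_add borel_measurable_scaleR borel_measurable_const)

lemma measurable_vec_nth_comp [measurable (raw)]:
  fixes f :: "'a \<Rightarrow> real^'n"
  shows "f \<in> borel_measurable M \<Longrightarrow> (\<lambda>x. f x $ i) \<in> borel_measurable M"
  unfolding cart_eq_inner_axis by (intro borel_measurable_inner borel_measurable_const)

text \<open>\<open>real^2\<close> is not a product type; both measures give boxes the same volume,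
  and this identification makes Fubini's theorem available for vectors.\<close>

lemma lborel_distr_pt: "distr (lborel \<Otimes>\<^sub>M lborel) borel (\<lambda>(a, b). pt a b) = lborel"
proof (rule lborel_eqI[symmetric])
  fix l u :: "real^2"
  assume le: "\<And>b. b \<in> Basis \<Longrightarrow> l \<bullet> b \<le> u \<bullet> b"
  have le': "l $ i \<le> u $ i" for i
    using le[of "axis i 1"] by (simp add: inner_axis)
  have "emeasure (distr (lborel \<Otimes>\<^sub>M lborel) borel (\<lambda>(a, b). pt a b)) (box l u) =
      emeasure (lborel \<Otimes>\<^sub>M lborel) ((\<lambda>(a, b). pt a b) -` box l u \<inter> space (lborel \<Otimes>\<^sub>M lborel))"
    by (rule emeasure_distr) auto
  also have "(\<lambda>(a, b). pt a b) -` box l u \<inter> space (lborel \<Otimes>\<^sub>M lborel) = box (l$1) (u$1) \<times> box (l$2) (u$2)"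
    by (auto simp: space_pair_measure box_vec2)
  also have "emeasure (lborel \<Otimes>\<^sub>M lborel) (box (l$1) (u$1) \<times> box (l$2) (u$2)) = ennreal (u$1 - l$1) * ennreal (u$2 - l$2)"
    using le' by (subst lborel.emeasure_pair_measure_Times) (auto simp: box_real)
  also have "\<dots> = ennreal (\<Prod>b\<in>Basis. (u - l) \<bullet> b)"
    using le' by (simp add: Basis_vec_def UNIV_2 axis_eq_axis inner_axis ennreal_mult mult.commute)
  finally show "emeasure (distr (lborel \<Otimes>\<^sub>M lborel) borel (\<lambda>(a, b). pt a b)) (box l u) = ennreal (\<Prod>b\<in>Basis. (u - l) \<bullet> b)" .
qed simp

lemma nn_integral_pt:
  assumes [measurable]: "f \<in> borel_measurable borel"
  shows "(\<integral>\<^sup>+x. f x \<partial>lborel) = (\<integral>\<^sup>+b. (\<integral>\<^sup>+a. f (pt a b) \<partial>lborel) \<partial>lborel)"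
    "(\<integral>\<^sup>+x. f x \<partial>lborel) = (\<integral>\<^sup>+a. (\<integral>\<^sup>+b. f (pt a b) \<partial>lborel) \<partial>lborel)"
proof -
  have "(\<integral>\<^sup>+x. f x \<partial>lborel) = (\<integral>\<^sup>+p. f ((\<lambda>(a, b). pt a b) p) \<partial>(lborel \<Otimes>\<^sub>M lborel))"
    by (subst lborel_distr_pt[symmetric], subst nn_integral_distr) auto
  also have "\<dots> = (\<integral>\<^sup>+a. (\<integral>\<^sup>+b. f (pt a b) \<partial>lborel) \<partial>lborel)"
    by (subst lborel.nn_integral_fst[symmetric]) auto
  finally show *: "(\<integral>\<^sup>+x. f x \<partial>lborel) = (\<integral>\<^sup>+a. (\<integral>\<^sup>+b. f (pt a b) \<partial>lborel) \<partial>lborel)" .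
  show "(\<integral>\<^sup>+x. f x \<partial>lborel) = (\<integral>\<^sup>+b. (\<integral>\<^sup>+a. f (pt a b) \<partial>lborel) \<partial>lborel)"
    unfolding * by (rule lborel_pair.Fubini'[symmetric]) auto
qed

text \<open>The fundamental theorem of calculus starting from the zero at c. Integrating over the
  whole real line makes the bound independent of the point a, at which F is evaluated.\<close>

lemma le_nn_integral_derivative:
  fixes F F' :: "real \<Rightarrow> real"
  assumes der: "\<And>s. (F has_real_derivative F' s) (at s)" and cont: "continuous_on UNIV F'"
    and zero: "\<And>s. s \<le> c \<Longrightarrow> F s = 0"
  shows "ennreal \<bar>F a\<bar> \<le> (\<integral>\<^sup>+s. ennreal \<bar>F' s\<bar> \<partial>lborel)"
proof (cases "a \<le> c")
  case False
  have i: "integrable lborel (\<lambda>s. indicator {c..a} s *\<^sub>R F' s)"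
    by (rule borel_integrable_compact) (auto intro: continuous_on_subset[OF cont])
  have "(LINT s|lborel. indicator {c..a} s *\<^sub>R F' s) = F a - F c"
    using False der cont
    by (intro integral_FTC_Icc)
       (auto simp: has_real_derivative_iff_has_vector_derivative[symmetric] intro: continuous_on_subset[OF cont subset_UNIV] has_field_derivative_at_within)
  then have "\<bar>F a\<bar> = norm (LINT s|lborel. indicator {c..a} s *\<^sub>R F' s)"
    using zero[of c] by simp
  then have "ennreal \<bar>F a\<bar> \<le> (\<integral>\<^sup>+s. ennreal (norm (indicator {c..a} s *\<^sub>R F' s)) \<partial>lborel)"
    using integral_norm_bound_ennreal[OF i] by simp
  also have "\<dots> \<le> (\<integral>\<^sup>+s. ennreal \<bar>F' s\<bar> \<partial>lborel)"
    by (intro nn_integral_mono ennreal_leI) (auto split: split_indicator)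
  finally show ?thesis .
qed (simp add: zero)

lemma test_funs_bounded_support:
  assumes "\<phi> \<in> test_funs S"
  obtains R where "R > 0" "\<And>x. norm x \<ge> R \<Longrightarrow> \<phi> x = 0"
proof -
  obtain K where K: "compact K" "\<And>x. x \<notin> K \<Longrightarrow> \<phi> x = 0"
    using assms by (meson test_funsE)
  obtain R where "R > 0" "\<And>x. x \<in> K \<Longrightarrow> norm x \<le> R"
    using compact_imp_bounded[OF K(1)] by (auto simp: bounded_pos)
  then show ?thesis using K(2) by (intro that[of "R + 1"]) force+
qed

text \<open>The one-dimensional bound is applied to the square of u along both coordinate
  directions. Each right side no longer depends on the coordinate that is integrated out.\<close>

lemma test_funs_sq_le_line_integral:
  fixes u :: "real^2 \<Rightarrow> real"
  assumes u: "u \<in> test_funs S"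
  shows "ennreal ((u (pt a b))\<^sup>2) \<le> (\<integral>\<^sup>+s. ennreal (2 * \<bar>u (pt s b) * (sgrad u (pt s b) $ 1)\<bar>) \<partial>lborel)"
    "ennreal ((u (pt a b))\<^sup>2) \<le> (\<integral>\<^sup>+s. ennreal (2 * \<bar>u (pt a s) * (sgrad u (pt a s) $ 2)\<bar>) \<partial>lborel)"
proof -
  note s = test_funs_smooth[OF u]
  obtain R where R: "R > 0" "\<And>x. norm x \<ge> R \<Longrightarrow> u x = 0"
    using u by (rule test_funs_bounded_support) (rule that)
  have line: "ennreal ((u (p + t *\<^sub>R axis i 1))\<^sup>2) \<le>
      (\<integral>\<^sup>+r. ennreal (2 * \<bar>u (p + r *\<^sub>R axis i 1) * (sgrad u (p + r *\<^sub>R axis i 1) $ i)\<bar>) \<partial>lborel)"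
    if p: "p $ i = 0" for p t i
  proof -
    have d: "((\<lambda>r. u (p + r *\<^sub>R axis i 1)) has_real_derivative sgrad u (p + r *\<^sub>R axis i 1) $ i) (at r)" for r
    proof -
      have "((\<lambda>r. u (p + r *\<^sub>R axis i 1)) has_derivative (\<lambda>h. sgrad u (p + r *\<^sub>R axis i 1) \<bullet> (h *\<^sub>R axis i 1))) (at r)"
        by (rule has_derivative_compose[OF _ smooth_fun_has_derivative[OF s]]) (auto intro!: derivative_eq_intros)
      then show ?thesis by (simp add: has_field_derivative_def inner_axis mult_commute_abs)
    qed
    have "ennreal \<bar>(u (p + t *\<^sub>R axis i 1))\<^sup>2\<bar> \<le>
      (\<integral>\<^sup>+r. ennreal \<bar>2 * (u (p + r *\<^sub>R axis i 1) * (sgrad u (p + r *\<^sub>R axis i 1) $ i))\<bar> \<partial>lborel)"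
    proof (rule le_nn_integral_derivative[where F="\<lambda>t. (u (p + t *\<^sub>R axis i 1))\<^sup>2" and c="- R"])
      show "((\<lambda>t. (u (p + t *\<^sub>R axis i 1))\<^sup>2) has_real_derivative
          2 * (u (p + r *\<^sub>R axis i 1) * (sgrad u (p + r *\<^sub>R axis i 1) $ i))) (at r)" for r
        by (rule derivative_eq_intros d refl)+ simp
      show "continuous_on UNIV (\<lambda>r. 2 * (u (p + r *\<^sub>R axis i 1) * (sgrad u (p + r *\<^sub>R axis i 1) $ i)))"
        by (intro continuous_intros continuous_on_compose2[OF smooth_fun_continuous[OF s]]
            continuous_on_compose2[OF continuous_on_sgrad[OF s]]) auto
      show "(u (p + r *\<^sub>R axis i 1))\<^sup>2 = 0" if "r \<le> - R" for r
      proof -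
        \<comment> \<open>As p has i-th component 0, the i-th component of the point is r itself,
          and so its norm is at least R, where u vanishes.\<close>
        have "R \<le> \<bar>(p + r *\<^sub>R axis i 1) $ i\<bar>" using that p R by simp
        then have "R \<le> norm (p + r *\<^sub>R axis i 1)" using component_le_norm_cart order_trans by blast
        then show ?thesis using R(2) by simp
      qed
    qed
    then show ?thesis by (simp add: abs_mult)
  qed
  show "ennreal ((u (pt a b))\<^sup>2) \<le> (\<integral>\<^sup>+s. ennreal (2 * \<bar>u (pt s b) * (sgrad u (pt s b) $ 1)\<bar>) \<partial>lborel)"
    using line[of "b *\<^sub>R axis 2 1" 1 a] by (simp add: pt_def add.commute axis_def)
  show "ennreal ((u (pt a b))\<^sup>2) \<le> (\<integral>\<^sup>+s. ennreal (2 * \<bar>u (pt a s) * (sgrad u (pt a s) $ 2)\<bar>) \<partial>lborel)"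
    using line[of "a *\<^sub>R axis 1 1" 2 b] by (simp add: pt_def axis_def)
qed

section \<open>The inequalities of Poincare and Ladyzhenskaya for test functions\<close>

lemma nn_integral_norm_mult_le:
  fixes f :: "real^2 \<Rightarrow> 'b::euclidean_space" and g :: "real^2 \<Rightarrow> 'c::euclidean_space"
  assumes "f \<in> L2 UNIV" "g \<in> L2 UNIV"
  shows "(\<integral>\<^sup>+x. ennreal (norm (f x) * norm (g x)) \<partial>lborel) \<le> ennreal (L2_norm UNIV f * L2_norm UNIV g)"
proof -
  have "(\<integral>\<^sup>+x. ennreal (norm (f x) * norm (g x)) \<partial>lborel) = (\<integral>\<^sup>+x. ennreal (norm (f x) * norm (g x)) \<partial>lebesgue_on UNIV)"
    by (simp add: lebesgue_on_UNIV_eq nn_integral_completion)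
  also have "\<dots> = ennreal (LINT x|lebesgue_on UNIV. norm (f x) * norm (g x))"
    by (rule nn_integral_eq_integral[OF L2_integrable_mult_norm[OF assms]]) simp
  finally show ?thesis using L2_Cauchy_Schwarz_norm[OF assms] by (simp add: ennreal_leI)
qed

lemma nn_integral_norm_sq:
  fixes f :: "real^2 \<Rightarrow> 'b::euclidean_space"
  assumes "f \<in> L2 UNIV"
  shows "(\<integral>\<^sup>+x. ennreal ((norm (f x))\<^sup>2) \<partial>lborel) = ennreal ((L2_norm UNIV f)\<^sup>2)"
proof -
  have "(\<integral>\<^sup>+x. ennreal ((norm (f x))\<^sup>2) \<partial>lborel) = (\<integral>\<^sup>+x. ennreal ((norm (f x))\<^sup>2) \<partial>lebesgue_on UNIV)"
    by (simp add: lebesgue_on_UNIV_eq nn_integral_completion)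
  also have "\<dots> = ennreal (LINT x|lebesgue_on UNIV. (norm (f x))\<^sup>2)"
    by (rule nn_integral_eq_integral[OF L2_integrable_norm[OF assms]]) simp
  finally show ?thesis by (simp add: L2_norm_sq)
qed

lemma nn_integral_partial_le:
  fixes u :: "real^2 \<Rightarrow> real"
  assumes u: "u \<in> test_funs S"
  shows "(\<integral>\<^sup>+x. ennreal (2 * \<bar>u x * (sgrad u x $ i)\<bar>) \<partial>lborel) \<le> ennreal (2 * (L2_norm UNIV u * L2_norm UNIV (sgrad u)))"
proof -
  note L = test_funs_L2[OF _ u, of UNIV]
  note [measurable] = test_funs_smooth[OF u, THEN smooth_fun_continuous, THEN borel_measurable_continuous_onI]
      test_funs_smooth[OF u, THEN continuous_on_sgrad, THEN borel_measurable_continuous_onI]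
  have "(\<integral>\<^sup>+x. ennreal (2 * \<bar>u x * (sgrad u x $ i)\<bar>) \<partial>lborel) \<le> (\<integral>\<^sup>+x. 2 * ennreal (norm (u x) * norm (sgrad u x)) \<partial>lborel)"
    by (intro nn_integral_mono) (auto simp: abs_mult ennreal_mult'[symmetric] ennreal_numeral[symmetric]
        intro!: ennreal_leI mult_left_mono component_le_norm_cart simp del: ennreal_numeral)
  also have "\<dots> = 2 * (\<integral>\<^sup>+x. ennreal (norm (u x) * norm (sgrad u x)) \<partial>lborel)"
    by (intro nn_integral_cmult) measurable
  also have "\<dots> \<le> 2 * ennreal (L2_norm UNIV u * L2_norm UNIV (sgrad u))"
    by (intro mult_left_mono nn_integral_norm_mult_le L) auto
  finally show ?thesis by (simp add: ennreal_mult')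
qed

lemma test_funs_L2_norm_UNIV:
  assumes "S \<in> sets lebesgue" "\<phi> \<in> test_funs S"
  shows "L2_norm UNIV \<phi> = L2_norm S \<phi>" "L2_norm UNIV (sgrad \<phi>) = L2_norm S (sgrad \<phi>)"
  using lebesgue_integral_extend(2)[OF assms(1), of UNIV "\<lambda>x. (norm (\<phi> x))\<^sup>2"]
    lebesgue_integral_extend(2)[OF assms(1), of UNIV "\<lambda>x. (norm (sgrad \<phi> x))\<^sup>2"]
    test_funs_outside[OF assms(2)] sgrad_outside[OF assms(2)]
  by (simp_all add: L2_norm_def)

text \<open>The only geometric information that enters the estimates: width 1 in the first
  coordinate. The resulting constants are therefore the same for all admissible graphs and every
  M.\<close>

abbreviation strip :: "(real^2) set" where
  "strip \<equiv> {x. 0 < x $ 1 \<and> x $ 1 < 1}"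

text \<open>The square of u is bounded by a function of the second coordinate alone. Integration
  over first coordinates in (0,1) costs a factor 1 and gives |u|^2 \<le> 2 |u| |grad u|; dividing by
  |u| leaves the constant 2.\<close>

lemma test_funs_Poincare:
  assumes S: "S \<in> sets lebesgue" "S \<subseteq> strip" and u: "u \<in> test_funs S"
  shows "L2_norm S u \<le> 2 * L2_norm S (sgrad u)"
proof -
  note [measurable] = test_funs_smooth[OF u, THEN smooth_fun_continuous, THEN borel_measurable_continuous_onI]
      test_funs_smooth[OF u, THEN continuous_on_sgrad, THEN borel_measurable_continuous_onI]
  note L = test_funs_L2[OF _ u, of UNIV]
  let ?A = "\<lambda>b. \<integral>\<^sup>+s. ennreal (2 * \<bar>u (pt s b) * (sgrad u (pt s b) $ 1)\<bar>) \<partial>lborel"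
  have "ennreal ((L2_norm UNIV u)\<^sup>2) = (\<integral>\<^sup>+x. ennreal ((u x)\<^sup>2) \<partial>lborel)"
    using nn_integral_norm_sq[OF L(1)] by simp
  also have "\<dots> = (\<integral>\<^sup>+b. (\<integral>\<^sup>+a. ennreal ((u (pt a b))\<^sup>2) \<partial>lborel) \<partial>lborel)"
    by (rule nn_integral_pt(1)) measurable
  also have "\<dots> \<le> (\<integral>\<^sup>+b. (\<integral>\<^sup>+a. ?A b * indicator {0<..<1::real} a \<partial>lborel) \<partial>lborel)"
  proof (intro nn_integral_mono)
    fix b a :: real
    show "ennreal ((u (pt a b))\<^sup>2) \<le> ?A b * indicator {0<..<1} a"
    proof (cases "0 < a \<and> a < 1")
      case True
      then show ?thesis using test_funs_sq_le_line_integral(1)[OF u, of a b] by simp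
    next
      case False
      then have "pt a b \<notin> S" using S(2) by auto
      then show ?thesis using test_funs_outside[OF u] by simp
    qed
  qed
  also have "\<dots> = (\<integral>\<^sup>+b. ?A b \<partial>lborel)"
    by (subst nn_integral_cmult_indicator) auto
  also have "\<dots> = (\<integral>\<^sup>+x. ennreal (2 * \<bar>u x * (sgrad u x $ 1)\<bar>) \<partial>lborel)"
    by (rule nn_integral_pt(1)[symmetric]) measurable
  also have "\<dots> \<le> ennreal (2 * (L2_norm UNIV u * L2_norm UNIV (sgrad u)))"
    by (rule nn_integral_partial_le[OF u])
  finally have "(L2_norm UNIV u)\<^sup>2 \<le> 2 * (L2_norm UNIV u * L2_norm UNIV (sgrad u))"
    by (simp add: ennreal_le_iff)
  then have "L2_norm UNIV u * L2_norm UNIV u \<le> L2_norm UNIV u * (2 * L2_norm UNIV (sgrad u))"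
    by (simp add: power2_eq_square algebra_simps)
  then have "L2_norm UNIV u \<le> 2 * L2_norm UNIV (sgrad u)"
    using L2_norm_nonneg[of UNIV u]
    by (cases "L2_norm UNIV u = 0") (simp, simp only: mult_le_cancel_left_pos less_le[of 0] not_False_eq_True simp_thms eq_commute[of 0])
  then show ?thesis by (simp add: test_funs_L2_norm_UNIV[OF S(1) u])
qed

text \<open>Ladyzhenskaya's argument: \<open>u(a,b)\<^sup>2\<close> is dominated by a function of \<open>b\<close> alone and \<open>w(a,b)\<^sup>2\<close> by a
  function of \<open>a\<close> alone.\<close>

lemma test_funs_product:
  assumes S: "S \<in> sets lebesgue" "S \<subseteq> strip" and u: "u \<in> test_funs S" and w: "w \<in> test_funs S"
  shows "L2_norm S (\<lambda>x. u x * w x) \<le> 4 * L2_norm S (sgrad u) * L2_norm S (sgrad w)"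
proof -
  note [measurable] = test_funs_smooth[OF u, THEN smooth_fun_continuous, THEN borel_measurable_continuous_onI]
      test_funs_smooth[OF u, THEN continuous_on_sgrad, THEN borel_measurable_continuous_onI]
      test_funs_smooth[OF w, THEN smooth_fun_continuous, THEN borel_measurable_continuous_onI]
      test_funs_smooth[OF w, THEN continuous_on_sgrad, THEN borel_measurable_continuous_onI]
  have uw: "(\<lambda>x. u x * w x) \<in> test_funs S"
    by (rule test_funs_mult[OF u test_funs_smooth[OF w]])
  note L = test_funs_L2[OF _ uw, of UNIV]
  let ?A = "\<lambda>b. \<integral>\<^sup>+s. ennreal (2 * \<bar>u (pt s b) * (sgrad u (pt s b) $ 1)\<bar>) \<partial>lborel"
  let ?B = "\<lambda>a. \<integral>\<^sup>+s. ennreal (2 * \<bar>w (pt a s) * (sgrad w (pt a s) $ 2)\<bar>) \<partial>lborel"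
  have [measurable]: "?A \<in> borel_measurable lborel" "?B \<in> borel_measurable lborel"
    by measurable
  have "ennreal ((L2_norm UNIV (\<lambda>x. u x * w x))\<^sup>2) = (\<integral>\<^sup>+x. ennreal ((u x * w x)\<^sup>2) \<partial>lborel)"
    using nn_integral_norm_sq[OF L(1)] by (simp add: power_mult_distrib)
  also have "\<dots> = (\<integral>\<^sup>+b. (\<integral>\<^sup>+a. ennreal ((u (pt a b) * w (pt a b))\<^sup>2) \<partial>lborel) \<partial>lborel)"
    by (rule nn_integral_pt(1)) measurable
  also have "\<dots> \<le> (\<integral>\<^sup>+b. (\<integral>\<^sup>+a. ?A b * ?B a \<partial>lborel) \<partial>lborel)"
    using test_funs_sq_le_line_integral[OF u] test_funs_sq_le_line_integral[OF w]
    by (intro nn_integral_mono) (auto simp: power_mult_distrib ennreal_mult intro!: mult_mono)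
  also have "\<dots> = (\<integral>\<^sup>+b. ?A b * (\<integral>\<^sup>+a. ?B a \<partial>lborel) \<partial>lborel)"
    by (subst nn_integral_cmult) simp_all
  also have "\<dots> = (\<integral>\<^sup>+b. ?A b \<partial>lborel) * (\<integral>\<^sup>+a. ?B a \<partial>lborel)"
    by (rule nn_integral_multc) measurable
  also have "(\<integral>\<^sup>+b. ?A b \<partial>lborel) = (\<integral>\<^sup>+x. ennreal (2 * \<bar>u x * (sgrad u x $ 1)\<bar>) \<partial>lborel)"
    by (rule nn_integral_pt(1)[symmetric]) measurable
  also have "(\<integral>\<^sup>+a. ?B a \<partial>lborel) = (\<integral>\<^sup>+x. ennreal (2 * \<bar>w x * (sgrad w x $ 2)\<bar>) \<partial>lborel)"
    by (rule nn_integral_pt(2)[symmetric]) measurable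
  also have "(\<integral>\<^sup>+x. ennreal (2 * \<bar>u x * (sgrad u x $ 1)\<bar>) \<partial>lborel) * (\<integral>\<^sup>+x. ennreal (2 * \<bar>w x * (sgrad w x $ 2)\<bar>) \<partial>lborel) \<le>
      ennreal (2 * (L2_norm UNIV u * L2_norm UNIV (sgrad u))) * ennreal (2 * (L2_norm UNIV w * L2_norm UNIV (sgrad w)))"
    by (intro mult_mono nn_integral_partial_le[OF u] nn_integral_partial_le[OF w]) auto
  also have "\<dots> = ennreal ((2 * (L2_norm UNIV u * L2_norm UNIV (sgrad u))) * (2 * (L2_norm UNIV w * L2_norm UNIV (sgrad w))))"
    by (rule ennreal_mult[symmetric]) auto
  finally have "(L2_norm UNIV (\<lambda>x. u x * w x))\<^sup>2 \<le>
      (2 * (L2_norm UNIV u * L2_norm UNIV (sgrad u))) * (2 * (L2_norm UNIV w * L2_norm UNIV (sgrad w)))"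
    by (subst (asm) ennreal_le_iff) auto
  then have "(L2_norm S (\<lambda>x. u x * w x))\<^sup>2 \<le>
      (2 * (L2_norm S u * L2_norm S (sgrad u))) * (2 * (L2_norm S w * L2_norm S (sgrad w)))"
    by (simp only: test_funs_L2_norm_UNIV[OF S(1) u] test_funs_L2_norm_UNIV[OF S(1) w] test_funs_L2_norm_UNIV[OF S(1) uw])
  \<comment> \<open>Poincare's inequality trades the remaining norms of u and w for gradients; the
    factor 16 so obtained is the square of the constant 4.\<close>
  also have "\<dots> \<le> (2 * ((2 * L2_norm S (sgrad u)) * L2_norm S (sgrad u))) * (2 * ((2 * L2_norm S (sgrad w)) * L2_norm S (sgrad w)))"
    by (intro mult_mono order_refl test_funs_Poincare[OF S u] test_funs_Poincare[OF S w]) auto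
  also have "\<dots> = (4 * L2_norm S (sgrad u) * L2_norm S (sgrad w))\<^sup>2"
    by (simp add: power2_eq_square)
  finally show ?thesis by (rule power2_le_imp_le) auto
qed

lemma h01_Poincare:
  assumes S: "S \<in> sets lebesgue" "S \<subseteq> strip" and h: "h01 S u G"
  shows "L2_norm S u \<le> 2 * L2_norm S G"
proof -
  obtain \<phi> where "h01_seq S u G \<phi>" using h unfolding h01_def by blast
  note \<phi> = h01_seqD[OF this]
  note t = test_funs_L2[OF S(1) \<phi>(3)]
  have "(\<lambda>n. L2_norm S (\<phi> n)) \<longlonglongrightarrow> L2_norm S u"
    by (rule L2_norm_tendsto[OF t(1) \<phi>(1)]) (use \<phi>(4) L2_norm_minus_commute[of S u] in simp)
  moreover have "(\<lambda>n. 2 * L2_norm S (sgrad (\<phi> n))) \<longlonglongrightarrow> 2 * L2_norm S G"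
    by (intro tendsto_mult_left L2_norm_tendsto[OF t(2) \<phi>(2)]) (use \<phi>(5) L2_norm_minus_commute[of S G] in simp)
  ultimately show ?thesis
    by (rule LIMSEQ_le) (use test_funs_Poincare[OF S \<phi>(3)] in blast)
qed

text \<open>Products of the approximating test functions are only known to converge almost
  everywhere along a subsequence; Fatou's lemma still transfers the bound, whose right side
  converges.\<close>

lemma h01_product:
  assumes S: "S \<in> sets lebesgue" "S \<subseteq> strip" and hu: "h01 S u G" and hw: "h01 S w H"
  shows "(\<lambda>x. u x * w x) \<in> L2 S \<and> L2_norm S (\<lambda>x. u x * w x) \<le> 4 * L2_norm S G * L2_norm S H"
proof -
  obtain \<phi> where "h01_seq S u G \<phi>" using hu unfolding h01_def by blast
  note \<phi> = h01_seqD[OF this]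
  obtain \<psi> where "h01_seq S w H \<psi>" using hw unfolding h01_def by blast
  note \<psi> = h01_seqD[OF this]
  note t = test_funs_L2[OF S(1) \<phi>(3)] test_funs_L2[OF S(1) \<psi>(3)]
  obtain r1 where r1: "strict_mono r1" "AE x in lebesgue_on S. (\<lambda>n. u x - \<phi> (r1 n) x) \<longlonglongrightarrow> 0"
    using L2_AE_subseq[OF L2_diff[OF \<phi>(1) t(1)] \<phi>(4)] by blast
  \<comment> \<open>The second subsequence is extracted from the first, so that one index sequence
    works for both factors.\<close>
  have "(\<lambda>n. L2_norm S (\<lambda>x. w x - \<psi> (r1 n) x)) \<longlonglongrightarrow> 0"
    using LIMSEQ_subseq_LIMSEQ[OF \<psi>(4) r1(1)] by (simp add: o_def)
  then obtain r2 where r2: "strict_mono r2" "AE x in lebesgue_on S. (\<lambda>n. w x - \<psi> (r1 (r2 n)) x) \<longlonglongrightarrow> 0"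
    using L2_AE_subseq[OF L2_diff[OF \<psi>(1) t(3)], of r1] by blast
  define r where "r = r1 \<circ> r2"
  have r: "strict_mono r" unfolding r_def using r1(1) r2(1) by (rule strict_mono_o)
  show ?thesis
  proof (rule L2_Fatou)
    show "(\<lambda>x. \<phi> (r n) x * \<psi> (r n) x) \<in> L2 S" for n
      by (rule test_funs_L2(1)[OF S(1) test_funs_mult[OF \<phi>(3) test_funs_smooth[OF \<psi>(3)]]])
    show "L2_norm S (\<lambda>x. \<phi> (r n) x * \<psi> (r n) x) \<le> 4 * L2_norm S (sgrad (\<phi> (r n))) * L2_norm S (sgrad (\<psi> (r n)))" for n
      by (rule test_funs_product[OF S \<phi>(3) \<psi>(3)])
    have "(\<lambda>n. L2_norm S (sgrad (\<phi> n))) \<longlonglongrightarrow> L2_norm S G"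
      by (rule L2_norm_tendsto[OF t(2) \<phi>(2)]) (use \<phi>(5) L2_norm_minus_commute[of S G] in simp)
    moreover have "(\<lambda>n. L2_norm S (sgrad (\<psi> n))) \<longlonglongrightarrow> L2_norm S H"
      by (rule L2_norm_tendsto[OF t(4) \<psi>(2)]) (use \<psi>(5) L2_norm_minus_commute[of S H] in simp)
    ultimately show "(\<lambda>n. 4 * L2_norm S (sgrad (\<phi> (r n))) * L2_norm S (sgrad (\<psi> (r n)))) \<longlonglongrightarrow> 4 * L2_norm S G * L2_norm S H"
      using LIMSEQ_subseq_LIMSEQ[OF _ r] by (intro tendsto_mult tendsto_const) (auto simp: o_def)
    show "(\<lambda>x. u x * w x) \<in> borel_measurable (lebesgue_on S)"
      using L2_measurable[OF \<phi>(1)] L2_measurable[OF \<psi>(1)] by (rule borel_measurable_times)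
    show "AE x in lebesgue_on S. (\<lambda>n. \<phi> (r n) x * \<psi> (r n) x) \<longlonglongrightarrow> u x * w x"
      using r1(2) r2(2)
    proof eventually_elim
      case (elim x)
      have "(\<lambda>n. u x - \<phi> (r n) x) \<longlonglongrightarrow> 0"
        using LIMSEQ_subseq_LIMSEQ[OF elim(1) r2(1)] by (simp add: o_def r_def)
      from tendsto_diff[OF tendsto_const[of "u x"] this] have "(\<lambda>n. \<phi> (r n) x) \<longlonglongrightarrow> u x" by simp
      moreover have "(\<lambda>n. w x - \<psi> (r n) x) \<longlonglongrightarrow> 0"
        using elim(2) by (simp add: r_def)
      from tendsto_diff[OF tendsto_const[of "w x"] this] have "(\<lambda>n. \<psi> (r n) x) \<longlonglongrightarrow> w x" by simp
      ultimately show ?case by (rule tendsto_mult)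
    qed
  qed
qed


subsection \<open>Vector fields and the transport form\<close>

lemma norm_vec_sq: "(norm (x :: 'a::real_inner ^ 'n))\<^sup>2 = (\<Sum>i\<in>UNIV. (norm (x $ i))\<^sup>2)"
  by (simp add: power2_norm_eq_inner inner_vec_def)

lemma L2_vec:
  fixes f :: "'a::euclidean_space \<Rightarrow> 'b::euclidean_space ^ 'n"
  assumes "\<And>i. (\<lambda>x. f x $ i) \<in> L2 S"
  shows "f \<in> L2 S" "(L2_norm S f)\<^sup>2 = (\<Sum>i\<in>UNIV. (L2_norm S (\<lambda>x. f x $ i))\<^sup>2)"
proof -
  have "f \<in> borel_measurable (lebesgue_on S)"
  proof (subst borel_measurable_euclidean_space, intro ballI)
    fix b :: "'b^'n" assume "b \<in> Basis"
    then obtain i c where "b = axis i c" by (auto simp: Basis_vec_def)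
    then have "(\<lambda>x. f x \<bullet> b) = (\<lambda>x. f x $ i \<bullet> c)" by (simp add: inner_axis)
    then show "(\<lambda>x. f x \<bullet> b) \<in> borel_measurable (lebesgue_on S)"
      using L2_measurable[OF L2_component[OF assms]] by simp
  qed
  moreover have "integrable (lebesgue_on S) (\<lambda>x. (norm (f x))\<^sup>2)"
    unfolding norm_vec_sq by (intro Bochner_Integration.integrable_sum L2_integrable_norm assms)
  ultimately show "f \<in> L2 S" by (simp add: L2_def)
  show "(L2_norm S f)\<^sup>2 = (\<Sum>i\<in>UNIV. (L2_norm S (\<lambda>x. f x $ i))\<^sup>2)"
    unfolding L2_norm_sq norm_vec_sq
    by (intro Bochner_Integration.integral_sum L2_integrable_norm assms)
qed

lemma L2_vec_nth:
  fixes f :: "'a::euclidean_space \<Rightarrow> 'b::euclidean_space ^ 'n"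
  assumes "f \<in> L2 S"
  shows "(\<lambda>x. f x $ i) \<in> L2 S" "L2_norm S (\<lambda>x. f x $ i) \<le> L2_norm S f"
proof -
  have m: "(\<lambda>x. f x $ i) \<in> borel_measurable (lebesgue_on S)"
    by (rule measurable_compose[OF L2_measurable[OF assms]])
       (intro borel_measurable_continuous_onI continuous_intros)
  show "(\<lambda>x. f x $ i) \<in> L2 S"
    by (rule L2_le[OF m assms]) (rule Finite_Cartesian_Product.norm_nth_le)
  show "L2_norm S (\<lambda>x. f x $ i) \<le> L2_norm S f"
    by (rule L2_norm_mono[OF m assms]) (rule Finite_Cartesian_Product.norm_nth_le)
qed

definition h01v :: "(real^2) set \<Rightarrow> (real^2 \<Rightarrow> real^2) \<Rightarrow> (real^2 \<Rightarrow> real^2^2) \<Rightarrow> bool" where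
  "h01v S v W \<longleftrightarrow> (\<forall>j. h01 S (\<lambda>x. v x $ j) (\<lambda>x. W x $ j))"

lemma h01vD: "h01v S v W \<Longrightarrow> h01 S (\<lambda>x. v x $ j) (\<lambda>x. W x $ j)"
  by (simp add: h01v_def)

lemma h01v_L2:
  assumes "h01v S v W"
  shows "v \<in> L2 S" "W \<in> L2 S"
  by (rule L2_vec(1), rule h01_L2[OF h01vD[OF assms]])+

lemma h01v_lincomb:
  assumes "S \<in> sets lebesgue" "h01v S v W" "h01v S v' W'"
  shows "h01v S (\<lambda>x. a *\<^sub>R v x + b *\<^sub>R v' x) (\<lambda>x. a *\<^sub>R W x + b *\<^sub>R W' x)"
  using h01_lincomb[OF assms(1), of "\<lambda>x. v x $ j" "\<lambda>x. W x $ j" "\<lambda>x. v' x $ j" "\<lambda>x. W' x $ j" a b for j] assms(2,3)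
  by (simp add: h01v_def)

lemma h01v_Poincare:
  assumes "S \<in> sets lebesgue" "S \<subseteq> strip" "h01v S v W"
  shows "L2_norm S v \<le> 2 * L2_norm S W"
proof (rule power2_le_imp_le)
  have v: "(\<lambda>x. v x $ j) \<in> L2 S" "(\<lambda>x. W x $ j) \<in> L2 S" for j
    using h01_L2[OF h01vD[OF assms(3)]] by auto
  have "(L2_norm S v)\<^sup>2 = (\<Sum>j\<in>UNIV. (L2_norm S (\<lambda>x. v x $ j))\<^sup>2)"
    by (rule L2_vec(2)[OF v(1)])
  also have "\<dots> \<le> (\<Sum>j\<in>UNIV. (2 * L2_norm S (\<lambda>x. W x $ j))\<^sup>2)"
    using assms(3) by (intro sum_mono power_mono h01_Poincare[OF assms(1,2)]) (auto simp: h01v_def)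
  also have "\<dots> = (2 * L2_norm S W)\<^sup>2"
    by (simp add: power_mult_distrib L2_vec(2)[OF v(2)] sum_distrib_left)
  finally show "(L2_norm S v)\<^sup>2 \<le> (2 * L2_norm S W)\<^sup>2" .
qed simp

text \<open>Squares are summed over the components; the scalar factor is common to them, so the
  constant stays 4.\<close>

lemma h01v_product:
  assumes S: "S \<in> sets lebesgue" "S \<subseteq> strip" and v: "h01v S v W" and \<psi>: "h01 S \<psi> H"
  shows "(\<lambda>x. \<psi> x *\<^sub>R v x) \<in> L2 S" "L2_norm S (\<lambda>x. \<psi> x *\<^sub>R v x) \<le> 4 * L2_norm S W * L2_norm S H"
proof -
  have *: "(\<lambda>x. (\<psi> x *\<^sub>R v x) $ j) \<in> L2 S"
    "L2_norm S (\<lambda>x. (\<psi> x *\<^sub>R v x) $ j) \<le> 4 * L2_norm S H * L2_norm S (\<lambda>x. W x $ j)" for j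
    using h01_product[OF S \<psi>, of "\<lambda>x. v x $ j" "\<lambda>x. W x $ j"] v by (auto simp: h01v_def)
  show "(\<lambda>x. \<psi> x *\<^sub>R v x) \<in> L2 S" by (rule L2_vec(1)[OF *(1)])
  have W: "(\<lambda>x. W x $ j) \<in> L2 S" for j by (rule h01_L2(2)[OF h01vD[OF v]])
  show "L2_norm S (\<lambda>x. \<psi> x *\<^sub>R v x) \<le> 4 * L2_norm S W * L2_norm S H"
  proof (rule power2_le_imp_le)
    have "(L2_norm S (\<lambda>x. \<psi> x *\<^sub>R v x))\<^sup>2 = (\<Sum>j\<in>UNIV. (L2_norm S (\<lambda>x. (\<psi> x *\<^sub>R v x) $ j))\<^sup>2)"
      by (rule L2_vec(2)[OF *(1)])
    also have "\<dots> \<le> (\<Sum>j\<in>UNIV. (4 * L2_norm S H * L2_norm S (\<lambda>x. W x $ j))\<^sup>2)"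
      by (intro sum_mono power_mono *(2)) simp
    also have "\<dots> = (4 * L2_norm S W * L2_norm S H)\<^sup>2"
      by (simp add: power_mult_distrib L2_vec(2)[OF W] sum_distrib_left sum_distrib_right mult_ac)
    finally show "(L2_norm S (\<lambda>x. \<psi> x *\<^sub>R v x))\<^sup>2 \<le> (4 * L2_norm S W * L2_norm S H)\<^sup>2" .
  qed simp
qed

text \<open>G has no regularity beyond L2, so the product estimate is spent on the two factors from
  H_0^1, and Cauchy-Schwarz handles the rest.\<close>

lemma transport_form:
  assumes S: "S \<in> sets lebesgue" "S \<subseteq> strip" and v: "h01v S v W" and \<psi>: "h01 S \<psi> H" and G: "G \<in> L2 S"
  shows "integrable (lebesgue_on S) (\<lambda>x. (v x \<bullet> G x) * \<psi> x)"
    "\<bar>LINT x|lebesgue_on S. (v x \<bullet> G x) * \<psi> x\<bar> \<le> 4 * L2_norm S W * L2_norm S G * L2_norm S H"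
proof -
  have eq: "(\<lambda>x. (v x \<bullet> G x) * \<psi> x) = (\<lambda>x. (\<psi> x *\<^sub>R v x) \<bullet> G x)" by (simp add: mult.commute)
  note p = h01v_product[OF S v \<psi>]
  show "integrable (lebesgue_on S) (\<lambda>x. (v x \<bullet> G x) * \<psi> x)"
    unfolding eq by (rule L2_integrable_inner[OF p(1) G])
  have "\<bar>LINT x|lebesgue_on S. (\<psi> x *\<^sub>R v x) \<bullet> G x\<bar> \<le> L2_norm S (\<lambda>x. \<psi> x *\<^sub>R v x) * L2_norm S G"
    by (rule L2_Cauchy_Schwarz[OF p(1) G])
  also have "\<dots> \<le> (4 * L2_norm S W * L2_norm S H) * L2_norm S G"
    by (intro mult_right_mono p(2)) simp
  finally show "\<bar>LINT x|lebesgue_on S. (v x \<bullet> G x) * \<psi> x\<bar> \<le> 4 * L2_norm S W * L2_norm S G * L2_norm S H"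
    unfolding eq by (simp add: mult_ac)
qed

text \<open>For a test function \<open>\<phi>\<close> the form is half the integral of \<open>v \<cdot> \<nabla>\<phi>\<^sup>2\<close>; density gives the rest.\<close>

lemma transport_form_zero:
  assumes S: "S \<in> sets lebesgue" "S \<subseteq> strip" and v: "h01v S v W"
    and div: "AE x in lebesgue_on S. trace (W x) = 0" and \<theta>: "h01 S \<theta> H"
  shows "(LINT x|lebesgue_on S. (v x \<bullet> H x) * \<theta> x) = 0"
proof -
  have test: "(LINT x|lebesgue_on S. (v x \<bullet> sgrad \<phi> x) * \<phi> x) = 0" if \<phi>: "\<phi> \<in> test_funs S" for \<phi>
  proof -
    note s = test_funs_smooth[OF \<phi>]
    have \<phi>\<phi>: "(\<lambda>x. \<phi> x * \<phi> x) \<in> test_funs S" by (rule test_funs_mult[OF \<phi> s])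
    note t = test_funs_L2[OF S(1) \<phi>\<phi>]
    have vj: "(\<lambda>x. v x $ j) \<in> L2 S" "(\<lambda>x. W x $ j) \<in> L2 S" "is_weak_grad S (\<lambda>x. v x $ j) (\<lambda>x. W x $ j)" for j
      using h01_L2[OF h01vD[OF v]] h01_is_weak_grad[OF S(1) h01vD[OF v]] by auto
    have wj: "(LINT x|lebesgue_on S. v x $ j * (sgrad (\<lambda>x. \<phi> x * \<phi> x) x \<bullet> axis j 1)) =
        - (LINT x|lebesgue_on S. (W x $ j \<bullet> axis j 1) * (\<phi> x * \<phi> x))" for j
      by (rule is_weak_gradD[OF vj(3) \<phi>\<phi>]) simp
    have "2 * (LINT x|lebesgue_on S. (v x \<bullet> sgrad \<phi> x) * \<phi> x) = (LINT x|lebesgue_on S. 2 * ((v x \<bullet> sgrad \<phi> x) * \<phi> x))"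
      by simp
    also have "\<dots> = (LINT x|lebesgue_on S. (\<Sum>j\<in>UNIV. v x $ j * (sgrad (\<lambda>x. \<phi> x * \<phi> x) x \<bullet> axis j 1)))"
      by (intro Bochner_Integration.integral_cong refl)
         (simp add: sgrad_mult[OF s s] inner_axis inner_vec_def sum_2 algebra_simps axis_def)
    also have "\<dots> = (\<Sum>j\<in>UNIV. LINT x|lebesgue_on S. v x $ j * (sgrad (\<lambda>x. \<phi> x * \<phi> x) x \<bullet> axis j 1))"
      by (intro Bochner_Integration.integral_sum L2_integrable_mult vj L2_component t)
    also have "\<dots> = - (\<Sum>j\<in>UNIV. LINT x|lebesgue_on S. (W x $ j \<bullet> axis j 1) * (\<phi> x * \<phi> x))"
      by (simp add: wj sum_negf)
    also have "(\<Sum>j\<in>UNIV. LINT x|lebesgue_on S. (W x $ j \<bullet> axis j 1) * (\<phi> x * \<phi> x)) =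
        (LINT x|lebesgue_on S. (\<Sum>j\<in>UNIV. (W x $ j \<bullet> axis j 1) * (\<phi> x * \<phi> x)))"
      by (intro Bochner_Integration.integral_sum[symmetric] L2_integrable_mult vj L2_component t)
    also have "\<dots> = 0"
    proof (rule integral_eq_zero_AE)
      show "AE x in lebesgue_on S. (\<Sum>j\<in>UNIV. (W x $ j \<bullet> axis j 1) * (\<phi> x * \<phi> x)) = 0"
        using div by eventually_elim (simp add: trace_def inner_axis flip: sum_distrib_right)
    qed
    finally show ?thesis by simp
  qed
  obtain \<phi> where "h01_seq S \<theta> H \<phi>" using \<theta> unfolding h01_def by blast
  note \<phi> = h01_seqD[OF this]
  note t = test_funs_L2[OF S(1) \<phi>(3)]
  let ?d = "\<lambda>n. L2_norm S (\<lambda>x. H x - sgrad (\<phi> n) x)"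
  \<comment> \<open>H and \<theta> are replaced by their approximations one after the other. Each
    replacement costs one application of \<open>transport_form\<close>, and the fully approximated
    term vanishes by \<open>test\<close>.\<close>
  have bd: "\<bar>LINT x|lebesgue_on S. (v x \<bullet> H x) * \<theta> x\<bar> \<le>
      4 * L2_norm S W * ?d n * L2_norm S H + 4 * L2_norm S W * L2_norm S (sgrad (\<phi> n)) * ?d n" for n
  proof -
    have hd: "h01 S (\<lambda>x. \<theta> x - \<phi> n x) (\<lambda>x. H x - sgrad (\<phi> n) x)"
      using h01_lincomb[OF S(1) \<theta> h01_test_funs[OF S(1) \<phi>(3)[of n]], of 1 "-1"] by simp
    note f1 = transport_form[OF S v \<theta> L2_diff[OF \<phi>(2) t(2)[of n]]]
    note f2 = transport_form[OF S v hd t(2)[of n]]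
    note f3 = transport_form(1)[OF S v h01_test_funs[OF S(1) \<phi>(3)[of n]] t(2)[of n]]
    have "(LINT x|lebesgue_on S. (v x \<bullet> H x) * \<theta> x) = (LINT x|lebesgue_on S.
        (v x \<bullet> (H x - sgrad (\<phi> n) x)) * \<theta> x + (v x \<bullet> sgrad (\<phi> n) x) * (\<theta> x - \<phi> n x) + (v x \<bullet> sgrad (\<phi> n) x) * \<phi> n x)"
      by (intro Bochner_Integration.integral_cong refl) (simp add: inner_diff_right algebra_simps)
    also have "\<dots> = (LINT x|lebesgue_on S. (v x \<bullet> (H x - sgrad (\<phi> n) x)) * \<theta> x) +
        (LINT x|lebesgue_on S. (v x \<bullet> sgrad (\<phi> n) x) * (\<theta> x - \<phi> n x))"
      by (simp only: test[OF \<phi>(3)[of n]] f1(1) f2(1) f3 Bochner_Integration.integral_add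
          Bochner_Integration.integrable_add add_0_right)
    finally show ?thesis using f1(2) f2(2) by linarith
  qed
  have "(\<lambda>n. L2_norm S (sgrad (\<phi> n))) \<longlonglongrightarrow> L2_norm S H"
    by (rule L2_norm_tendsto[OF t(2) \<phi>(2)]) (use \<phi>(5) L2_norm_minus_commute[of S H] in simp)
  then have "(\<lambda>n. 4 * L2_norm S W * ?d n * L2_norm S H + 4 * L2_norm S W * L2_norm S (sgrad (\<phi> n)) * ?d n)
      \<longlonglongrightarrow> 4 * L2_norm S W * 0 * L2_norm S H + 4 * L2_norm S W * L2_norm S H * 0"
    by (intro tendsto_intros \<phi>(5))
  then have "\<bar>LINT x|lebesgue_on S. (v x \<bullet> H x) * \<theta> x\<bar> \<le> 4 * L2_norm S W * 0 * L2_norm S H + 4 * L2_norm S W * L2_norm S H * 0"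
    by (rule LIMSEQ_le_const) (use bd in blast)
  then show ?thesis by simp
qed

section \<open>The spaces $V$ and $H_0^1$ as Hilbert spaces\<close>

text \<open>Only the gradients are assumed Cauchy; Poincare's inequality passes this on to the
  functions, and the pair of limits is kept by \<open>h01_limit\<close>.\<close>

lemma L2_Cauchy_limit_h01:
  assumes \<Omega>: "\<Omega> \<in> sets lebesgue" "\<Omega> \<subseteq> strip" and h: "\<And>n. h01 \<Omega> (f n) (F n)"
    and c: "\<And>e. e > 0 \<Longrightarrow> \<exists>N. \<forall>m\<ge>N. \<forall>n\<ge>N. L2_norm \<Omega> (\<lambda>x. F m x - F n x) < e"
  obtains u G where "h01 \<Omega> u G" "(\<lambda>n. L2_norm \<Omega> (\<lambda>x. F n x - G x)) \<longlonglongrightarrow> 0"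
proof -
  obtain G where G: "G \<in> L2 \<Omega>" "(\<lambda>n. L2_norm \<Omega> (\<lambda>x. F n x - G x)) \<longlonglongrightarrow> 0"
    using L2_complete[of F \<Omega>, OF h01_L2(2)[OF h] c] by blast
  have diff: "h01 \<Omega> (\<lambda>x. f m x - f n x) (\<lambda>x. F m x - F n x)" for m n
    using h01_lincomb[OF \<Omega>(1) h[of m] h[of n], of 1 "-1"] by simp
  have "\<exists>N. \<forall>m\<ge>N. \<forall>n\<ge>N. L2_norm \<Omega> (\<lambda>x. f m x - f n x) < e" if e: "e > 0" for e
  proof -
    obtain N where "\<forall>m\<ge>N. \<forall>n\<ge>N. L2_norm \<Omega> (\<lambda>x. F m x - F n x) < e / 2"
      using c[OF half_gt_zero[OF e]] by blast
    then have "L2_norm \<Omega> (\<lambda>x. f m x - f n x) < e" if "m \<ge> N" "n \<ge> N" for m n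
      using h01_Poincare[OF \<Omega> diff[of m n]] that by fastforce
    then show ?thesis by blast
  qed
  then obtain u where u: "u \<in> L2 \<Omega>" "(\<lambda>n. L2_norm \<Omega> (\<lambda>x. f n x - u x)) \<longlonglongrightarrow> 0"
    using L2_complete[of f \<Omega>, OF h01_L2(1)[OF h]] by blast
  have "h01 \<Omega> u G"
    by (rule h01_limit[OF \<Omega>(1) h u(1) G(1) u(2) G(2)])
  then show ?thesis using G(2) that by blast
qed

lemma vgrad_nth [simp]: "vgrad \<Omega> v x $ j = weak_grad \<Omega> (\<lambda>y. v y $ j) x"
  by (simp add: vgrad_def)

lemma V_space_iff:
  assumes "open \<Omega>"
  shows "v \<in> V_space \<Omega> \<longleftrightarrow> h01v \<Omega> v (vgrad \<Omega> v) \<and> (AE x in lebesgue_on \<Omega>. trace (vgrad \<Omega> v x) = 0)"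
  by (simp add: V_space_def h01v_def H01_iff_h01[OF assms])

lemma h01v_vgrad_AE:
  assumes "open \<Omega>" "h01v \<Omega> v W"
  shows "AE x in lebesgue_on \<Omega>. vgrad \<Omega> v x = W x"
proof -
  have "AE x in lebesgue_on \<Omega>. \<forall>j\<in>UNIV. weak_grad \<Omega> (\<lambda>y. v y $ j) x = W x $ j"
    by (subst AE_finite_all) (auto intro: h01_weak_grad_AE(2)[OF assms(1) h01vD[OF assms(2)]])
  then show ?thesis by eventually_elim (simp add: vec_eq_iff)
qed

lemma h01v_imp_V_space:
  assumes "open \<Omega>" "h01v \<Omega> v W" "AE x in lebesgue_on \<Omega>. trace (W x) = 0"
  shows "v \<in> V_space \<Omega>"
proof -
  have "(\<lambda>x. v x $ j) \<in> H01 \<Omega>" for j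
    by (rule h01_imp_H01[OF assms(1) h01vD[OF assms(2)]])
  moreover have "AE x in lebesgue_on \<Omega>. trace (vgrad \<Omega> v x) = 0"
    using h01v_vgrad_AE[OF assms(1,2)] assms(3) by eventually_elim simp
  ultimately show ?thesis by (simp add: V_space_def)
qed

text \<open>A free field G stands where a gradient is meant: since \<open>weak_grad\<close> is
  linear only almost everywhere, linearity in this slot must be stated for fields. The same applies
  to \<open>convection\<close>.\<close>

definition transport :: "(real^2) set \<Rightarrow> (real^2 \<Rightarrow> real^2) \<Rightarrow> (real^2 \<Rightarrow> real^2) \<Rightarrow> (real^2 \<Rightarrow> real) \<Rightarrow> real" where
  "transport \<Omega> v G \<psi> = (LINT x|lebesgue_on \<Omega>. (v x \<bullet> G x) * \<psi> x)"

definition convection :: "(real^2) set \<Rightarrow> (real^2 \<Rightarrow> real^2) \<Rightarrow> (real^2 \<Rightarrow> real^2^2) \<Rightarrow> (real^2 \<Rightarrow> real^2) \<Rightarrow> real" where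
  "convection \<Omega> v G \<phi> = (LINT x|lebesgue_on \<Omega>. (G x *v v x) \<bullet> \<phi> x)"

locale planar_domain =
  fixes \<Omega> :: "(real^2) set"
  assumes open_dom: "open \<Omega>" and dom_strip: "\<Omega> \<subseteq> strip"
begin

abbreviation ngrad :: "(real^2 \<Rightarrow> real) \<Rightarrow> real" where "ngrad u \<equiv> L2_norm \<Omega> (weak_grad \<Omega> u)"
abbreviation nvgrad :: "(real^2 \<Rightarrow> real^2) \<Rightarrow> real" where "nvgrad v \<equiv> L2_norm \<Omega> (vgrad \<Omega> v)"

lemma dom_sets: "\<Omega> \<in> sets lebesgue" using open_dom by simp

lemma H01D: "u \<in> H01 \<Omega> \<Longrightarrow> h01 \<Omega> u (weak_grad \<Omega> u)"
  using H01_iff_h01[OF open_dom] by blast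

lemma V_spaceD: "v \<in> V_space \<Omega> \<Longrightarrow> h01v \<Omega> v (vgrad \<Omega> v)"
  using V_space_iff[OF open_dom] by blast

lemma V_space_nth: "v \<in> V_space \<Omega> \<Longrightarrow> (\<lambda>x. v x $ j) \<in> H01 \<Omega>"
  by (simp add: V_space_def)

lemma H01_L2: "u \<in> H01 \<Omega> \<Longrightarrow> u \<in> L2 \<Omega>" "u \<in> H01 \<Omega> \<Longrightarrow> weak_grad \<Omega> u \<in> L2 \<Omega>"
  using h01_L2[OF H01D] by auto

lemma V_space_L2: "v \<in> V_space \<Omega> \<Longrightarrow> v \<in> L2 \<Omega>" "v \<in> V_space \<Omega> \<Longrightarrow> vgrad \<Omega> v \<in> L2 \<Omega>"
  using h01v_L2[OF V_spaceD] by auto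

lemma H01_lincomb:
  assumes "u \<in> H01 \<Omega>" "w \<in> H01 \<Omega>"
  shows "(\<lambda>x. a * u x + b * w x) \<in> H01 \<Omega>"
    "AE x in lebesgue_on \<Omega>. weak_grad \<Omega> (\<lambda>x. a * u x + b * w x) x = a *\<^sub>R weak_grad \<Omega> u x + b *\<^sub>R weak_grad \<Omega> w x"
proof -
  note h = h01_lincomb[OF dom_sets H01D[OF assms(1)] H01D[OF assms(2)], of a b]
  show "(\<lambda>x. a * u x + b * w x) \<in> H01 \<Omega>" by (rule h01_imp_H01[OF open_dom h])
  show "AE x in lebesgue_on \<Omega>. weak_grad \<Omega> (\<lambda>x. a * u x + b * w x) x = a *\<^sub>R weak_grad \<Omega> u x + b *\<^sub>R weak_grad \<Omega> w x"
    by (rule h01_weak_grad_AE(2)[OF open_dom h])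
qed

lemma V_space_lincomb:
  assumes "v \<in> V_space \<Omega>" "w \<in> V_space \<Omega>"
  shows "(\<lambda>x. a *\<^sub>R v x + b *\<^sub>R w x) \<in> V_space \<Omega>"
    "AE x in lebesgue_on \<Omega>. vgrad \<Omega> (\<lambda>x. a *\<^sub>R v x + b *\<^sub>R w x) x = a *\<^sub>R vgrad \<Omega> v x + b *\<^sub>R vgrad \<Omega> w x"
proof -
  note h = h01v_lincomb[OF dom_sets V_spaceD[OF assms(1)] V_spaceD[OF assms(2)], of a b]
  have tr: "AE x in lebesgue_on \<Omega>. trace (vgrad \<Omega> v x) = 0" "AE x in lebesgue_on \<Omega>. trace (vgrad \<Omega> w x) = 0"
    using assms by (auto simp: V_space_def)
  have "AE x in lebesgue_on \<Omega>. trace (a *\<^sub>R vgrad \<Omega> v x + b *\<^sub>R vgrad \<Omega> w x) = 0"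
    using tr by eventually_elim (simp add: trace_def sum.distrib flip: sum_distrib_left)
  then show "(\<lambda>x. a *\<^sub>R v x + b *\<^sub>R w x) \<in> V_space \<Omega>" by (rule h01v_imp_V_space[OF open_dom h])
  show "AE x in lebesgue_on \<Omega>. vgrad \<Omega> (\<lambda>x. a *\<^sub>R v x + b *\<^sub>R w x) x = a *\<^sub>R vgrad \<Omega> v x + b *\<^sub>R vgrad \<Omega> w x"
    by (rule h01v_vgrad_AE[OF open_dom h])
qed

lemma H01_zero: "(\<lambda>x. 0) \<in> H01 \<Omega>" and weak_grad_zero: "AE x in lebesgue_on \<Omega>. weak_grad \<Omega> (\<lambda>x. 0) x = 0"
proof -
  have "sgrad (\<lambda>x :: real^2. 0) = (\<lambda>x. 0)" by (rule ext, rule sgrad_eqI) simp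
  then have h: "h01 \<Omega> (\<lambda>x. 0) (\<lambda>x. 0)" using h01_test_funs[OF dom_sets test_funs_zero] by simp
  show "(\<lambda>x. 0) \<in> H01 \<Omega>" by (rule h01_imp_H01[OF open_dom h])
  show "AE x in lebesgue_on \<Omega>. weak_grad \<Omega> (\<lambda>x. 0) x = 0" by (rule h01_weak_grad_AE(2)[OF open_dom h])
qed

lemma V_space_zero: "(\<lambda>x. 0) \<in> V_space \<Omega>" and vgrad_zero: "AE x in lebesgue_on \<Omega>. vgrad \<Omega> (\<lambda>x. 0) x = 0"
proof -
  have "h01 \<Omega> (\<lambda>x. 0) (\<lambda>x. 0)"
    by (rule h01_cong_AE[OF H01D[OF H01_zero]]) (use weak_grad_zero dom_sets in auto)
  then have h: "h01v \<Omega> (\<lambda>x. 0) (\<lambda>x. 0)" by (simp add: h01v_def)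
  show "(\<lambda>x. 0) \<in> V_space \<Omega>" by (rule h01v_imp_V_space[OF open_dom h]) (simp add: trace_def)
  show "AE x in lebesgue_on \<Omega>. vgrad \<Omega> (\<lambda>x. 0) x = 0" by (rule h01v_vgrad_AE[OF open_dom h])
qed

lemma Poincare: "u \<in> H01 \<Omega> \<Longrightarrow> L2_norm \<Omega> u \<le> 2 * ngrad u"
  by (rule h01_Poincare[OF dom_sets dom_strip H01D])

lemma Poincare_V: "v \<in> V_space \<Omega> \<Longrightarrow> L2_norm \<Omega> v \<le> 2 * nvgrad v"
  by (rule h01v_Poincare[OF dom_sets dom_strip V_spaceD])


subsection \<open>The trilinear forms\<close>

lemma transport_integrable:
  assumes "v \<in> V_space \<Omega>" "G \<in> L2 \<Omega>" "\<psi> \<in> H01 \<Omega>"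
  shows "integrable (lebesgue_on \<Omega>) (\<lambda>x. (v x \<bullet> G x) * \<psi> x)"
  by (rule transport_form(1)[OF dom_sets dom_strip V_spaceD[OF assms(1)] H01D[OF assms(3)] assms(2)])

lemma transport_bound:
  assumes "v \<in> V_space \<Omega>" "G \<in> L2 \<Omega>" "\<psi> \<in> H01 \<Omega>"
  shows "\<bar>transport \<Omega> v G \<psi>\<bar> \<le> 4 * nvgrad v * L2_norm \<Omega> G * ngrad \<psi>"
  unfolding transport_def
  by (rule transport_form(2)[OF dom_sets dom_strip V_spaceD[OF assms(1)] H01D[OF assms(3)] assms(2)])

lemma transport_zero:
  assumes "v \<in> V_space \<Omega>" "\<psi> \<in> H01 \<Omega>"
  shows "transport \<Omega> v (weak_grad \<Omega> \<psi>) \<psi> = 0"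
  unfolding transport_def
  by (rule transport_form_zero[OF dom_sets dom_strip V_spaceD[OF assms(1)] _ H01D[OF assms(2)]])
     (use assms(1) in \<open>simp add: V_space_def\<close>)

lemma transport_lin1:
  assumes "v \<in> V_space \<Omega>" "v' \<in> V_space \<Omega>" "G \<in> L2 \<Omega>" "\<psi> \<in> H01 \<Omega>"
  shows "transport \<Omega> (\<lambda>x. a *\<^sub>R v x + b *\<^sub>R v' x) G \<psi> = a * transport \<Omega> v G \<psi> + b * transport \<Omega> v' G \<psi>"
proof -
  have "transport \<Omega> (\<lambda>x. a *\<^sub>R v x + b *\<^sub>R v' x) G \<psi> =
      (LINT x|lebesgue_on \<Omega>. a * ((v x \<bullet> G x) * \<psi> x) + b * ((v' x \<bullet> G x) * \<psi> x))"
    unfolding transport_def by (simp add: inner_add_left algebra_simps)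
  then show ?thesis
    using transport_integrable[OF assms(1,3,4)] transport_integrable[OF assms(2,3,4)] by (simp add: transport_def)
qed

text \<open>F may differ from the combination on a null set, which is the form in which gradients of
  linear combinations are available.\<close>

lemma transport_lin2:
  assumes "v \<in> V_space \<Omega>" "G \<in> L2 \<Omega>" "H \<in> L2 \<Omega>" "\<psi> \<in> H01 \<Omega>"
    and F: "F \<in> L2 \<Omega>" "AE x in lebesgue_on \<Omega>. F x = a *\<^sub>R G x + b *\<^sub>R H x"
  shows "transport \<Omega> v F \<psi> = a * transport \<Omega> v G \<psi> + b * transport \<Omega> v H \<psi>"
proof -
  note i = transport_integrable[OF assms(1,2,4)] transport_integrable[OF assms(1,3,4)]
  have "transport \<Omega> v F \<psi> = (LINT x|lebesgue_on \<Omega>. a * ((v x \<bullet> G x) * \<psi> x) + b * ((v x \<bullet> H x) * \<psi> x))"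
    unfolding transport_def
  proof (rule integral_cong_AE)
    show "(\<lambda>x. (v x \<bullet> F x) * \<psi> x) \<in> borel_measurable (lebesgue_on \<Omega>)"
      by (rule borel_measurable_integrable[OF transport_integrable[OF assms(1) F(1) assms(4)]])
    show "(\<lambda>x. a * ((v x \<bullet> G x) * \<psi> x) + b * ((v x \<bullet> H x) * \<psi> x)) \<in> borel_measurable (lebesgue_on \<Omega>)"
      by (intro borel_measurable_integrable Bochner_Integration.integrable_add integrable_mult_right i)
    show "AE x in lebesgue_on \<Omega>. (v x \<bullet> F x) * \<psi> x = a * ((v x \<bullet> G x) * \<psi> x) + b * ((v x \<bullet> H x) * \<psi> x)"
      using F(2) by eventually_elim (simp add: inner_add_right algebra_simps)
  qed
  then show ?thesis using i by (simp add: transport_def)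
qed

lemma transport_lin3:
  assumes "v \<in> V_space \<Omega>" "G \<in> L2 \<Omega>" "\<psi> \<in> H01 \<Omega>" "\<psi>' \<in> H01 \<Omega>"
  shows "transport \<Omega> v G (\<lambda>x. a * \<psi> x + b * \<psi>' x) = a * transport \<Omega> v G \<psi> + b * transport \<Omega> v G \<psi>'"
proof -
  have "transport \<Omega> v G (\<lambda>x. a * \<psi> x + b * \<psi>' x) =
      (LINT x|lebesgue_on \<Omega>. a * ((v x \<bullet> G x) * \<psi> x) + b * ((v x \<bullet> G x) * \<psi>' x))"
    unfolding transport_def by (simp add: algebra_simps)
  then show ?thesis
    using transport_integrable[OF assms(1,2,3)] transport_integrable[OF assms(1,2,4)] by (simp add: transport_def)
qed

text \<open>Row j of G pairs with component j of \<phi>, so every property of the vector form comes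
  from the scalar one; the constant 8 below is two components times 4.\<close>

lemma convection_eq_transport:
  assumes "v \<in> V_space \<Omega>" "G \<in> L2 \<Omega>" "\<phi> \<in> V_space \<Omega>"
  shows "convection \<Omega> v G \<phi> = (\<Sum>j\<in>UNIV. transport \<Omega> v (\<lambda>x. G x $ j) (\<lambda>x. \<phi> x $ j))"
proof -
  have "convection \<Omega> v G \<phi> = (LINT x|lebesgue_on \<Omega>. (\<Sum>j\<in>UNIV. (v x \<bullet> G x $ j) * \<phi> x $ j))"
    unfolding convection_def
  proof (intro Bochner_Integration.integral_cong refl)
    show "(G x *v v x) \<bullet> \<phi> x = (\<Sum>j\<in>UNIV. (v x \<bullet> G x $ j) * \<phi> x $ j)" for x
      unfolding inner_vec_def[of "G x *v v x"] matrix_vector_mul_component inner_real_def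
      by (simp only: inner_commute[of _ "v x"])
  qed
  also have "\<dots> = (\<Sum>j\<in>UNIV. LINT x|lebesgue_on \<Omega>. (v x \<bullet> G x $ j) * \<phi> x $ j)"
    by (intro Bochner_Integration.integral_sum transport_integrable assms L2_vec_nth(1) V_space_nth)
  finally show ?thesis by (simp add: transport_def)
qed

lemma convection_bound:
  assumes "v \<in> V_space \<Omega>" "G \<in> L2 \<Omega>" "\<phi> \<in> V_space \<Omega>"
  shows "\<bar>convection \<Omega> v G \<phi>\<bar> \<le> 8 * nvgrad v * L2_norm \<Omega> G * nvgrad \<phi>"
proof -
  have *: "\<bar>transport \<Omega> v (\<lambda>x. G x $ j) (\<lambda>x. \<phi> x $ j)\<bar> \<le> 4 * nvgrad v * L2_norm \<Omega> G * nvgrad \<phi>" for j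
  proof -
    have "\<bar>transport \<Omega> v (\<lambda>x. G x $ j) (\<lambda>x. \<phi> x $ j)\<bar> \<le> 4 * nvgrad v * L2_norm \<Omega> (\<lambda>x. G x $ j) * ngrad (\<lambda>x. \<phi> x $ j)"
      by (intro transport_bound assms L2_vec_nth(1) V_space_nth)
    also have "\<dots> \<le> 4 * nvgrad v * L2_norm \<Omega> G * nvgrad \<phi>"
      using L2_vec_nth(2)[OF V_space_L2(2)[OF assms(3)], of j] L2_vec_nth(2)[OF assms(2), of j]
      by (intro mult_mono) auto
    finally show ?thesis .
  qed
  show ?thesis
    unfolding convection_eq_transport[OF assms] sum_2 using *[of 1] *[of 2] by linarith
qed

lemma convection_zero:
  assumes "v \<in> V_space \<Omega>" "\<phi> \<in> V_space \<Omega>"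
  shows "convection \<Omega> v (vgrad \<Omega> \<phi>) \<phi> = 0"
  unfolding convection_eq_transport[OF assms(1) V_space_L2(2)[OF assms(2)] assms(2)]
  using transport_zero[OF assms(1) V_space_nth[OF assms(2)]] by simp

lemma convection_lin1:
  assumes "v \<in> V_space \<Omega>" "v' \<in> V_space \<Omega>" "G \<in> L2 \<Omega>" "\<phi> \<in> V_space \<Omega>"
  shows "convection \<Omega> (\<lambda>x. a *\<^sub>R v x + b *\<^sub>R v' x) G \<phi> = a * convection \<Omega> v G \<phi> + b * convection \<Omega> v' G \<phi>"
  using transport_lin1[OF assms(1,2) L2_vec_nth(1)[OF assms(3)] V_space_nth[OF assms(4)], of a b]
  by (simp add: convection_eq_transport V_space_lincomb assms sum_2 algebra_simps)

lemma convection_lin2: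
  assumes "v \<in> V_space \<Omega>" "G \<in> L2 \<Omega>" "H \<in> L2 \<Omega>" "\<phi> \<in> V_space \<Omega>"
    and F: "F \<in> L2 \<Omega>" "AE x in lebesgue_on \<Omega>. F x = a *\<^sub>R G x + b *\<^sub>R H x"
  shows "convection \<Omega> v F \<phi> = a * convection \<Omega> v G \<phi> + b * convection \<Omega> v H \<phi>"
proof -
  have "AE x in lebesgue_on \<Omega>. F x $ j = a *\<^sub>R G x $ j + b *\<^sub>R H x $ j" for j
    using F(2) by eventually_elim simp
  from transport_lin2[OF assms(1) L2_vec_nth(1)[OF assms(2)] L2_vec_nth(1)[OF assms(3)] V_space_nth[OF assms(4)]
      L2_vec_nth(1)[OF F(1)] this]
  show ?thesis
    by (simp add: convection_eq_transport assms sum_2 algebra_simps)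
qed

lemma convection_lin3:
  assumes "v \<in> V_space \<Omega>" "G \<in> L2 \<Omega>" "\<phi> \<in> V_space \<Omega>" "\<phi>' \<in> V_space \<Omega>"
  shows "convection \<Omega> v G (\<lambda>x. a *\<^sub>R \<phi> x + b *\<^sub>R \<phi>' x) = a * convection \<Omega> v G \<phi> + b * convection \<Omega> v G \<phi>'"
  using transport_lin3[OF assms(1) L2_vec_nth(1)[OF assms(2)] V_space_nth[OF assms(3)] V_space_nth[OF assms(4)], where a=a and b=b]
  by (simp add: convection_eq_transport V_space_lincomb assms sum_2 algebra_simps)


subsection \<open>The product space\<close>

definition X :: "((real^2 \<Rightarrow> real^2) \<times> (real^2 \<Rightarrow> real)) set" where
  "X = V_space \<Omega> \<times> H01 \<Omega>"

definition lc :: "real \<Rightarrow> (real^2 \<Rightarrow> real^2) \<times> (real^2 \<Rightarrow> real) \<Rightarrow> real \<Rightarrow> (real^2 \<Rightarrow> real^2) \<times> (real^2 \<Rightarrow> real) \<Rightarrow>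
    (real^2 \<Rightarrow> real^2) \<times> (real^2 \<Rightarrow> real)" where
  "lc a x b y = (\<lambda>p. a *\<^sub>R fst x p + b *\<^sub>R fst y p, \<lambda>p. a * snd x p + b * snd y p)"

definition ip :: "(real^2 \<Rightarrow> real^2) \<times> (real^2 \<Rightarrow> real) \<Rightarrow> (real^2 \<Rightarrow> real^2) \<times> (real^2 \<Rightarrow> real) \<Rightarrow> real" where
  "ip x y = (LINT p|lebesgue_on \<Omega>. vgrad \<Omega> (fst x) p \<bullet> vgrad \<Omega> (fst y) p) +
     (LINT p|lebesgue_on \<Omega>. weak_grad \<Omega> (snd x) p \<bullet> weak_grad \<Omega> (snd y) p)"

lemma L2_inner_lincomb_AE:
  fixes F G H K :: "real^2 \<Rightarrow> 'b::euclidean_space"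
  assumes "F \<in> L2 \<Omega>" "G \<in> L2 \<Omega>" "H \<in> L2 \<Omega>" "K \<in> L2 \<Omega>" "AE x in lebesgue_on \<Omega>. F x = a *\<^sub>R G x + b *\<^sub>R H x"
  shows "(LINT p|lebesgue_on \<Omega>. F p \<bullet> K p) =
    a * (LINT p|lebesgue_on \<Omega>. G p \<bullet> K p) + b * (LINT p|lebesgue_on \<Omega>. H p \<bullet> K p)"
proof -
  note i = L2_integrable_inner[OF assms(1,4)] L2_integrable_inner[OF assms(2,4)] L2_integrable_inner[OF assms(3,4)]
  have "(LINT p|lebesgue_on \<Omega>. F p \<bullet> K p) = (LINT p|lebesgue_on \<Omega>. a * (G p \<bullet> K p) + b * (H p \<bullet> K p))"
  proof (rule integral_cong_AE)
    show "(\<lambda>p. a * (G p \<bullet> K p) + b * (H p \<bullet> K p)) \<in> borel_measurable (lebesgue_on \<Omega>)"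
      by (intro borel_measurable_integrable Bochner_Integration.integrable_add integrable_mult_right i)
    show "AE x in lebesgue_on \<Omega>. F x \<bullet> K x = a * (G x \<bullet> K x) + b * (H x \<bullet> K x)"
      using assms(5) by eventually_elim (simp add: inner_add_left)
  qed (use i in auto)
  then show ?thesis using i by simp
qed

lemma ip_self:
  assumes "x \<in> X"
  shows "ip x x = (nvgrad (fst x))\<^sup>2 + (ngrad (snd x))\<^sup>2"
  by (simp add: ip_def L2_norm_sq power2_norm_eq_inner)

lemma ip_lc_minus:
  assumes "x \<in> X" "y \<in> X"
  shows "ip (lc 1 x (-1) y) (lc 1 x (-1) y) =
    (L2_norm \<Omega> (\<lambda>p. vgrad \<Omega> (fst x) p - vgrad \<Omega> (fst y) p))\<^sup>2 +
    (L2_norm \<Omega> (\<lambda>p. weak_grad \<Omega> (snd x) p - weak_grad \<Omega> (snd y) p))\<^sup>2"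
proof -
  have v: "fst x \<in> V_space \<Omega>" "fst y \<in> V_space \<Omega>" "snd x \<in> H01 \<Omega>" "snd y \<in> H01 \<Omega>"
    using assms by (auto simp: X_def)
  note l = V_space_lincomb[OF v(1,2), of 1 "-1"] H01_lincomb[OF v(3,4), of 1 "-1"]
  have lX: "lc 1 x (-1) y \<in> X" using l unfolding X_def lc_def by simp
  have "nvgrad (fst (lc 1 x (-1) y)) = L2_norm \<Omega> (\<lambda>p. vgrad \<Omega> (fst x) p - vgrad \<Omega> (fst y) p)"
    by (rule L2_norm_cong_AE) (use l(1,2) v in \<open>auto simp: lc_def intro: V_space_L2 L2_diff\<close>)
  moreover have "ngrad (snd (lc 1 x (-1) y)) = L2_norm \<Omega> (\<lambda>p. weak_grad \<Omega> (snd x) p - weak_grad \<Omega> (snd y) p)"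
    by (rule L2_norm_cong_AE) (use l(3,4) v in \<open>auto simp: lc_def intro: H01_L2 L2_diff\<close>)
  ultimately show ?thesis by (simp add: ip_self[OF lX])
qed

text \<open>The limit is built row by row in H_0^1. The divergence constraint is pointwise, so it is
  recovered along a subsequence converging almost everywhere.\<close>

lemma V_space_complete:
  assumes s: "\<And>n. s n \<in> V_space \<Omega>"
    and c: "\<And>e. e > 0 \<Longrightarrow> \<exists>N. \<forall>m\<ge>N. \<forall>n\<ge>N. L2_norm \<Omega> (\<lambda>x. vgrad \<Omega> (s m) x - vgrad \<Omega> (s n) x) < e"
  obtains v where "v \<in> V_space \<Omega>" "(\<lambda>n. L2_norm \<Omega> (\<lambda>x. vgrad \<Omega> (s n) x - vgrad \<Omega> v x)) \<longlonglongrightarrow> 0"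
proof -
  have "\<exists>u G. h01 \<Omega> u G \<and> (\<lambda>n. L2_norm \<Omega> (\<lambda>x. vgrad \<Omega> (s n) x $ j - G x)) \<longlonglongrightarrow> 0" for j
  proof (rule L2_Cauchy_limit_h01[OF dom_sets dom_strip h01vD[OF V_spaceD[OF s], where j=j]])
    fix e :: real assume "e > 0"
    then obtain N where N: "\<forall>m\<ge>N. \<forall>n\<ge>N. L2_norm \<Omega> (\<lambda>x. vgrad \<Omega> (s m) x - vgrad \<Omega> (s n) x) < e"
      using c by blast
    have le: "L2_norm \<Omega> (\<lambda>x. vgrad \<Omega> (s m) x $ j - vgrad \<Omega> (s n) x $ j) \<le> L2_norm \<Omega> (\<lambda>x. vgrad \<Omega> (s m) x - vgrad \<Omega> (s n) x)" for m n
      using L2_vec_nth(2)[OF L2_diff[OF V_space_L2(2)[OF s[of m]] V_space_L2(2)[OF s[of n]]], of j] by simp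
    show "\<exists>N. \<forall>m\<ge>N. \<forall>n\<ge>N. L2_norm \<Omega> (\<lambda>x. vgrad \<Omega> (s m) x $ j - vgrad \<Omega> (s n) x $ j) < e"
      by (intro exI[of _ N] allI impI, rule le_less_trans[OF le]) (use N in blast)
  qed blast
  then have "\<forall>j. \<exists>u G. h01 \<Omega> u G \<and> (\<lambda>n. L2_norm \<Omega> (\<lambda>x. vgrad \<Omega> (s n) x $ j - G x)) \<longlonglongrightarrow> 0" by blast
  from choice[OF this] obtain u where
    "\<forall>j. \<exists>G. h01 \<Omega> (u j) G \<and> (\<lambda>n. L2_norm \<Omega> (\<lambda>x. vgrad \<Omega> (s n) x $ j - G x)) \<longlonglongrightarrow> 0" by blast
  from choice[OF this] obtain G where uG: "\<And>j. h01 \<Omega> (u j) (G j)"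
      "\<And>j. (\<lambda>n. L2_norm \<Omega> (\<lambda>x. vgrad \<Omega> (s n) x $ j - G j x)) \<longlonglongrightarrow> 0" by blast
  define v where "v x = (\<chi> j. u j x)" for x
  define W where "W x = (\<chi> j. G j x)" for x
  have vW: "h01v \<Omega> v W" using uG(1) by (simp add: h01v_def v_def W_def)
  note W2 = h01v_L2(2)[OF vW]
  have dL: "(\<lambda>x. vgrad \<Omega> (s n) x - W x) \<in> L2 \<Omega>" for n
    by (intro L2_diff V_space_L2 s W2)
  have lim: "(\<lambda>n. L2_norm \<Omega> (\<lambda>x. vgrad \<Omega> (s n) x - W x)) \<longlonglongrightarrow> 0"
  proof -
    have "(\<lambda>n. \<Sum>j\<in>UNIV. (L2_norm \<Omega> (\<lambda>x. vgrad \<Omega> (s n) x $ j - G j x))\<^sup>2) \<longlonglongrightarrow> (\<Sum>j\<in>(UNIV::2 set). 0\<^sup>2)"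
      by (intro tendsto_sum tendsto_power uG)
    moreover have "(L2_norm \<Omega> (\<lambda>x. vgrad \<Omega> (s n) x - W x))\<^sup>2 = (\<Sum>j\<in>UNIV. (L2_norm \<Omega> (\<lambda>x. vgrad \<Omega> (s n) x $ j - G j x))\<^sup>2)" for n
      by (subst L2_vec(2)[OF L2_vec_nth(1)[OF dL]]) (simp add: W_def)
    ultimately have "(\<lambda>n. (L2_norm \<Omega> (\<lambda>x. vgrad \<Omega> (s n) x - W x))\<^sup>2) \<longlonglongrightarrow> 0" by simp
    from tendsto_real_sqrt[OF this] show ?thesis by simp
  qed
  obtain r where r: "AE x in lebesgue_on \<Omega>. (\<lambda>n. vgrad \<Omega> (s (r n)) x - W x) \<longlonglongrightarrow> 0"
    using L2_AE_subseq[OF dL lim] by blast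
  \<comment> \<open>Countably many null sets are merged before the pointwise limit is taken.\<close>
  have "AE x in lebesgue_on \<Omega>. \<forall>n. trace (vgrad \<Omega> (s n) x) = 0"
    unfolding AE_all_countable using s by (simp add: V_space_def)
  with r have div: "AE x in lebesgue_on \<Omega>. trace (W x) = 0"
  proof eventually_elim
    case (elim x)
    have "(\<lambda>n. trace (vgrad \<Omega> (s (r n)) x - W x)) \<longlonglongrightarrow> trace (0 :: real^2^2)"
      unfolding trace_def by (intro tendsto_intros elim)
    moreover have "trace (vgrad \<Omega> (s (r n)) x - W x) = - trace (W x)" for n
      using elim(2) by (simp add: trace_sub)
    ultimately show ?case by (simp add: LIMSEQ_const_iff trace_def)
  qed
  have v: "v \<in> V_space \<Omega>" by (rule h01v_imp_V_space[OF open_dom vW div])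
  have "L2_norm \<Omega> (\<lambda>x. vgrad \<Omega> (s n) x - vgrad \<Omega> v x) = L2_norm \<Omega> (\<lambda>x. vgrad \<Omega> (s n) x - W x)" for n
    by (rule L2_norm_cong_AE[OF L2_diff[OF V_space_L2(2)[OF s] V_space_L2(2)[OF v]] dL])
       (use h01v_vgrad_AE[OF open_dom vW] in auto)
  then show ?thesis using that[OF v] lim by simp
qed

lemma H01_complete:
  assumes s: "\<And>n. s n \<in> H01 \<Omega>"
    and c: "\<And>e. e > 0 \<Longrightarrow> \<exists>N. \<forall>m\<ge>N. \<forall>n\<ge>N. L2_norm \<Omega> (\<lambda>x. weak_grad \<Omega> (s m) x - weak_grad \<Omega> (s n) x) < e"
  obtains u where "u \<in> H01 \<Omega>" "(\<lambda>n. L2_norm \<Omega> (\<lambda>x. weak_grad \<Omega> (s n) x - weak_grad \<Omega> u x)) \<longlonglongrightarrow> 0"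
proof -
  obtain u G where uG: "h01 \<Omega> u G" "(\<lambda>n. L2_norm \<Omega> (\<lambda>x. weak_grad \<Omega> (s n) x - G x)) \<longlonglongrightarrow> 0"
    using L2_Cauchy_limit_h01[OF dom_sets dom_strip H01D[OF s] c] by blast
  have u: "u \<in> H01 \<Omega>" by (rule h01_imp_H01[OF open_dom uG(1)])
  have "L2_norm \<Omega> (\<lambda>x. weak_grad \<Omega> (s n) x - weak_grad \<Omega> u x) = L2_norm \<Omega> (\<lambda>x. weak_grad \<Omega> (s n) x - G x)" for n
    by (rule L2_norm_cong_AE[OF L2_diff[OF H01_L2(2)[OF s] H01_L2(2)[OF u]] L2_diff[OF H01_L2(2)[OF s] h01_L2(2)[OF uG(1)]]])
       (use h01_weak_grad_AE(2)[OF open_dom uG(1)] in auto)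
  then show ?thesis using that[OF u] uG(2) by simp
qed

sublocale semi_hilbert X lc ip
proof
  show "X \<noteq> {}" using V_space_zero H01_zero by (auto simp: X_def)
  show "lc a x b y \<in> X" if "x \<in> X" "y \<in> X" for x y a b
    using that V_space_lincomb(1) H01_lincomb(1) by (auto simp: X_def lc_def)
  show "ip (lc a x b y) z = a * ip x z + b * ip y z" if xyz: "x \<in> X" "y \<in> X" "z \<in> X" for x y z a b
  proof -
    have v: "fst x \<in> V_space \<Omega>" "fst y \<in> V_space \<Omega>" "fst z \<in> V_space \<Omega>" "snd x \<in> H01 \<Omega>" "snd y \<in> H01 \<Omega>" "snd z \<in> H01 \<Omega>"
      using xyz by (auto simp: X_def)
    note l = V_space_lincomb[OF v(1,2), of a b] H01_lincomb[OF v(4,5), of a b]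
    show ?thesis
      unfolding ip_def lc_def fst_conv snd_conv
      using L2_inner_lincomb_AE[OF V_space_L2(2)[OF l(1)] V_space_L2(2)[OF v(1)] V_space_L2(2)[OF v(2)] V_space_L2(2)[OF v(3)] l(2)]
        L2_inner_lincomb_AE[OF H01_L2(2)[OF l(3)] H01_L2(2)[OF v(4)] H01_L2(2)[OF v(5)] H01_L2(2)[OF v(6)] l(4)]
      by (simp add: algebra_simps)
  qed
  show "ip x y = ip y x" for x y by (simp add: ip_def inner_commute)
  show "0 \<le> ip x x" if "x \<in> X" for x by (simp add: ip_self[OF that])
  fix s :: "nat \<Rightarrow> (real^2 \<Rightarrow> real^2) \<times> (real^2 \<Rightarrow> real)"
  assume sX: "\<And>n. s n \<in> X"
    and c: "\<And>e. e > 0 \<Longrightarrow> \<exists>N. \<forall>m\<ge>N. \<forall>n\<ge>N. ip (lc 1 (s m) (-1) (s n)) (lc 1 (s m) (-1) (s n)) < e"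
  have s: "fst (s n) \<in> V_space \<Omega>" "snd (s n) \<in> H01 \<Omega>" for n using sX[of n] by (auto simp: X_def)
  have c': "\<exists>N. \<forall>m\<ge>N. \<forall>n\<ge>N. L2_norm \<Omega> (\<lambda>p. vgrad \<Omega> (fst (s m)) p - vgrad \<Omega> (fst (s n)) p) < e \<and>
      L2_norm \<Omega> (\<lambda>p. weak_grad \<Omega> (snd (s m)) p - weak_grad \<Omega> (snd (s n)) p) < e" if e: "e > 0" for e
  proof -
    obtain N where N: "\<And>m n. m \<ge> N \<Longrightarrow> n \<ge> N \<Longrightarrow> ip (lc 1 (s m) (-1) (s n)) (lc 1 (s m) (-1) (s n)) < e\<^sup>2"
      using c[of "e\<^sup>2"] e by auto
    have "L2_norm \<Omega> (\<lambda>p. vgrad \<Omega> (fst (s m)) p - vgrad \<Omega> (fst (s n)) p) < e \<and>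
      L2_norm \<Omega> (\<lambda>p. weak_grad \<Omega> (snd (s m)) p - weak_grad \<Omega> (snd (s n)) p) < e"
      (is "?a < e \<and> ?b < e") if "m \<ge> N" "n \<ge> N" for m n
    proof -
      have "?a\<^sup>2 + ?b\<^sup>2 < e\<^sup>2" using N[OF that] ip_lc_minus[OF sX[of m] sX[of n]] by simp
      moreover have "0 \<le> ?a\<^sup>2" "0 \<le> ?b\<^sup>2" by auto
      ultimately have "?a\<^sup>2 < e\<^sup>2" "?b\<^sup>2 < e\<^sup>2" by linarith+
      then show ?thesis using e by (auto intro: power2_less_imp_less)
    qed
    then show ?thesis by blast
  qed
  obtain v where v: "v \<in> V_space \<Omega>" "(\<lambda>n. L2_norm \<Omega> (\<lambda>x. vgrad \<Omega> (fst (s n)) x - vgrad \<Omega> v x)) \<longlonglongrightarrow> 0"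
    by (rule V_space_complete[of "\<lambda>n. fst (s n)", OF s(1)]) (use c' in blast)+
  obtain u where u: "u \<in> H01 \<Omega>" "(\<lambda>n. L2_norm \<Omega> (\<lambda>x. weak_grad \<Omega> (snd (s n)) x - weak_grad \<Omega> u x)) \<longlonglongrightarrow> 0"
    by (rule H01_complete[of "\<lambda>n. snd (s n)", OF s(2)]) (use c' in blast)+
  have vu: "(v, u) \<in> X" using v(1) u(1) by (simp add: X_def)
  have "(\<lambda>n. ip (lc 1 (s n) (-1) (v, u)) (lc 1 (s n) (-1) (v, u))) \<longlonglongrightarrow> 0"
    unfolding ip_lc_minus[OF sX vu]
    using tendsto_add[OF tendsto_power[OF v(2), of 2] tendsto_power[OF u(2), of 2]] by simp
  then show "\<exists>x\<in>X. (\<lambda>n. ip (lc 1 (s n) (-1) x) (lc 1 (s n) (-1) x)) \<longlonglongrightarrow> 0"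
    using vu by blast
qed

lemma nvgrad_le_nm: "x \<in> X \<Longrightarrow> nvgrad (fst x) \<le> nm x"
  unfolding nm_def by (rule real_le_rsqrt) (simp add: ip_self)

lemma ngrad_le_nm: "x \<in> X \<Longrightarrow> ngrad (snd x) \<le> nm x"
  unfolding nm_def by (rule real_le_rsqrt) (simp add: ip_self)

text \<open>Poincare's inequality turns a vanishing gradient norm into equality almost everywhere,
  the notion of uniqueness in \<open>ex1_ae\<close>.\<close>

lemma nm_diff_zero_AE:
  assumes "x \<in> X" "y \<in> X" "nm (lc 1 x (-1) y) = 0"
  shows "AE p in lebesgue_on \<Omega>. fst x p = fst y p \<and> snd x p = snd y p"
proof -
  let ?d = "lc 1 x (-1) y"
  have d: "?d \<in> X" by (rule lc_in[OF assms(1,2)])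
  then have v: "fst ?d \<in> V_space \<Omega>" "snd ?d \<in> H01 \<Omega>" by (auto simp: X_def)
  have "nvgrad (fst ?d) \<le> 0" "ngrad (snd ?d) \<le> 0"
    using nvgrad_le_nm[OF d] ngrad_le_nm[OF d] assms(3) by auto
  then have "L2_norm \<Omega> (fst ?d) = 0" "L2_norm \<Omega> (snd ?d) = 0"
    using Poincare_V[OF v(1)] Poincare[OF v(2)] L2_norm_nonneg[of \<Omega> "fst ?d"] L2_norm_nonneg[of \<Omega> "snd ?d"] by linarith+
  then have "AE p in lebesgue_on \<Omega>. fst ?d p = 0" "AE p in lebesgue_on \<Omega>. snd ?d p = 0"
    using L2_norm_eq_0_iff[OF V_space_L2(1)[OF v(1)]] L2_norm_eq_0_iff[OF H01_L2(1)[OF v(2)]] by auto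
  then show ?thesis by eventually_elim (simp add: lc_def)
qed

end

section \<open>Dual norms\<close>

text \<open>Homogeneity turns a bound over the unit ball into a bound by the norm. A seminorm may
  vanish, and then arbitrarily large multiples force I = 0.\<close>

lemma abs_le_if_scaled:
  fixes I n \<delta> :: real
  assumes "0 \<le> n" and sc: "\<And>c. c > 0 \<Longrightarrow> c * n \<le> 1 \<Longrightarrow> c * \<bar>I\<bar> \<le> \<delta>"
  shows "\<bar>I\<bar> \<le> \<delta> * n"
proof (cases "n = 0")
  case True
  have \<delta>: "0 \<le> \<delta>" using sc[of 1] True by simp
  have "I = 0"
  proof (rule ccontr)
    assume "I \<noteq> 0"
    \<comment> \<open>This multiple has c |I| = \<delta> + 1, beyond the bound \<delta>.\<close>
    then show False using sc[of "(\<delta> + 1) / \<bar>I\<bar>"] True \<delta> by simp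
  qed
  then show ?thesis using True by simp
next
  case False
  then show ?thesis using sc[of "1 / n"] assms(1) by (simp add: field_simps)
qed

context planar_domain
begin

lemma V_dual_bound:
  assumes "V_dual_norm \<Omega> g \<le> ennreal \<delta>" "0 \<le> \<delta>" "\<phi> \<in> V_space \<Omega>"
  shows "\<bar>LINT x|lebesgue_on \<Omega>. g x \<bullet> \<phi> x\<bar> \<le> \<delta> * nvgrad \<phi>"
proof (rule abs_le_if_scaled)
  fix c :: real assume c: "c > 0" "c * nvgrad \<phi> \<le> 1"
  note l = V_space_lincomb[OF assms(3) V_space_zero, of c 0]
  have "nvgrad (\<lambda>x. c *\<^sub>R \<phi> x) = L2_norm \<Omega> (\<lambda>x. c *\<^sub>R vgrad \<Omega> \<phi> x)"
    by (rule L2_norm_cong_AE) (use l assms(3) in \<open>auto intro: V_space_L2 L2_scaleR\<close>)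
  then have "nvgrad (\<lambda>x. c *\<^sub>R \<phi> x) \<le> 1" using c by (simp add: L2_norm_scaleR)
  with l(1) have "ennreal \<bar>LINT x|lebesgue_on \<Omega>. g x \<bullet> c *\<^sub>R \<phi> x\<bar> \<le> V_dual_norm \<Omega> g"
    unfolding V_dual_norm_def by (intro SUP_upper) simp
  with assms(1,2) have "\<bar>LINT x|lebesgue_on \<Omega>. g x \<bullet> c *\<^sub>R \<phi> x\<bar> \<le> \<delta>"
    using ennreal_le_iff order_trans by blast
  then show "c * \<bar>LINT x|lebesgue_on \<Omega>. g x \<bullet> \<phi> x\<bar> \<le> \<delta>" using c by (simp add: abs_mult)
qed simp

lemma Hm1_bound:
  assumes "Hm1_norm \<Omega> g \<le> ennreal \<delta>" "0 \<le> \<delta>" "\<psi> \<in> H01 \<Omega>"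
  shows "\<bar>LINT x|lebesgue_on \<Omega>. g x * \<psi> x\<bar> \<le> \<delta> * ngrad \<psi>"
proof (rule abs_le_if_scaled)
  fix c :: real assume c: "c > 0" "c * ngrad \<psi> \<le> 1"
  note l = H01_lincomb[OF assms(3) H01_zero, of c 0]
  have "ngrad (\<lambda>x. c * \<psi> x) = L2_norm \<Omega> (\<lambda>x. c *\<^sub>R weak_grad \<Omega> \<psi> x)"
    by (rule L2_norm_cong_AE) (use l assms(3) in \<open>auto intro: H01_L2 L2_scaleR\<close>)
  then have "ngrad (\<lambda>x. c * \<psi> x) \<le> 1" using c by (simp add: L2_norm_scaleR)
  with l(1) have "ennreal \<bar>LINT x|lebesgue_on \<Omega>. g x * (c * \<psi> x)\<bar> \<le> Hm1_norm \<Omega> g"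
    unfolding Hm1_norm_def by (intro SUP_upper) simp
  with assms(1,2) have "\<bar>LINT x|lebesgue_on \<Omega>. g x * (c * \<psi> x)\<bar> \<le> \<delta>"
    using ennreal_le_iff order_trans by blast
  moreover have "(LINT x|lebesgue_on \<Omega>. g x * (c * \<psi> x)) = c * (LINT x|lebesgue_on \<Omega>. g x * \<psi> x)"
    by (simp add: mult.left_commute)
  ultimately show "c * \<bar>LINT x|lebesgue_on \<Omega>. g x * \<psi> x\<bar> \<le> \<delta>" using c by (simp add: abs_mult)
qed simp

end

text \<open>The data are measured on the large domain but act on the small one: test functions are
  extended by zero to use the dual norms, and T_d is restricted.\<close>

locale planar_subdomain = planar_domain \<Omega> + outer: planar_domain \<Omega>' for \<Omega> \<Omega>' +
  assumes sub: "\<Omega> \<subseteq> \<Omega>'"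
begin

lemma H01_zext:
  assumes "u \<in> H01 \<Omega>"
  shows "zext \<Omega> u \<in> H01 \<Omega>'" "outer.ngrad (zext \<Omega> u) = ngrad u"
proof -
  note h = h01_zext[OF dom_sets outer.dom_sets sub H01D[OF assms]]
  show z: "zext \<Omega> u \<in> H01 \<Omega>'" by (rule h01_imp_H01[OF outer.open_dom h])
  have "outer.ngrad (zext \<Omega> u) = L2_norm \<Omega>' (zext \<Omega> (weak_grad \<Omega> u))"
    by (rule L2_norm_cong_AE[OF outer.H01_L2(2)[OF z] h01_L2(2)[OF h] h01_weak_grad_AE(2)[OF outer.open_dom h]])
  then show "outer.ngrad (zext \<Omega> u) = ngrad u"
    by (simp add: L2_zext(2)[OF dom_sets outer.dom_sets sub H01_L2(2)[OF assms]])
qed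

lemma V_space_zext:
  assumes "v \<in> V_space \<Omega>"
  shows "zext \<Omega> v \<in> V_space \<Omega>'" "outer.nvgrad (zext \<Omega> v) = nvgrad v"
proof -
  have nth: "zext \<Omega> f x $ j = zext \<Omega> (\<lambda>x. f x $ j) x" for f :: "real^2 \<Rightarrow> 'b::zero^2" and x j
    by (simp add: zext_def)
  have h: "h01v \<Omega>' (zext \<Omega> v) (zext \<Omega> (vgrad \<Omega> v))"
    unfolding h01v_def nth using h01_zext[OF dom_sets outer.dom_sets sub h01vD[OF V_spaceD[OF assms]]]
    by (simp add: eta_contract_eq)
  have "AE x in lebesgue. x \<in> \<Omega> \<longrightarrow> trace (vgrad \<Omega> v x) = 0"
    using assms dom_sets by (simp add: V_space_def AE_restrict_space_iff)
  then have "AE x in lebesgue. x \<in> \<Omega>' \<longrightarrow> trace (zext \<Omega> (vgrad \<Omega> v) x) = 0"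
    by eventually_elim (simp add: zext_def trace_def)
  then have tr: "AE x in lebesgue_on \<Omega>'. trace (zext \<Omega> (vgrad \<Omega> v) x) = 0"
    using outer.dom_sets by (simp add: AE_restrict_space_iff)
  show z: "zext \<Omega> v \<in> V_space \<Omega>'" by (rule h01v_imp_V_space[OF outer.open_dom h tr])
  have "outer.nvgrad (zext \<Omega> v) = L2_norm \<Omega>' (zext \<Omega> (vgrad \<Omega> v))"
    by (rule L2_norm_cong_AE[OF outer.V_space_L2(2)[OF z] h01v_L2(2)[OF h] h01v_vgrad_AE[OF outer.open_dom h]])
  then show "outer.nvgrad (zext \<Omega> v) = nvgrad v"
    by (simp add: L2_zext(2)[OF dom_sets outer.dom_sets sub V_space_L2(2)[OF assms]])
qed

lemma V_dual_bound_sub: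
  assumes "V_dual_norm \<Omega>' g \<le> ennreal \<delta>" "0 \<le> \<delta>" "\<phi> \<in> V_space \<Omega>"
  shows "\<bar>LINT x|lebesgue_on \<Omega>. g x \<bullet> \<phi> x\<bar> \<le> \<delta> * nvgrad \<phi>"
proof -
  have "(LINT x|lebesgue_on \<Omega>'. g x \<bullet> zext \<Omega> \<phi> x) = (LINT x|lebesgue_on \<Omega>. g x \<bullet> zext \<Omega> \<phi> x)"
    by (rule lebesgue_integral_extend(2)[OF dom_sets outer.dom_sets sub]) (simp add: zext_def)
  also have "\<dots> = (LINT x|lebesgue_on \<Omega>. g x \<bullet> \<phi> x)"
    by (intro Bochner_Integration.integral_cong refl) (simp add: zext_def)
  finally show ?thesis
    using outer.V_dual_bound[OF assms(1,2) V_space_zext(1)[OF assms(3)]] V_space_zext(2)[OF assms(3)] by simp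
qed

lemma Hm1_bound_sub:
  assumes "Hm1_norm \<Omega>' g \<le> ennreal \<delta>" "0 \<le> \<delta>" "\<psi> \<in> H01 \<Omega>"
  shows "\<bar>LINT x|lebesgue_on \<Omega>. g x * \<psi> x\<bar> \<le> \<delta> * ngrad \<psi>"
proof -
  have "(LINT x|lebesgue_on \<Omega>'. g x * zext \<Omega> \<psi> x) = (LINT x|lebesgue_on \<Omega>. g x * zext \<Omega> \<psi> x)"
    by (rule lebesgue_integral_extend(2)[OF dom_sets outer.dom_sets sub]) (simp add: zext_def)
  also have "\<dots> = (LINT x|lebesgue_on \<Omega>. g x * \<psi> x)"
    by (intro Bochner_Integration.integral_cong refl) (simp add: zext_def)
  finally show ?thesis
    using outer.Hm1_bound[OF assms(1,2) H01_zext(1)[OF assms(3)]] H01_zext(2)[OF assms(3)] by simp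
qed

lemma H1_restrict:
  assumes "u \<in> H1 \<Omega>'"
  shows "u \<in> H1 \<Omega>" "L2_norm \<Omega> u \<le> H1_norm \<Omega>' u" "ngrad u \<le> H1_norm \<Omega>' u"
proof -
  note u = H1_L2[OF assms] weak_grad_spec[OF assms]
  note r = L2_restrict[OF dom_sets outer.dom_sets sub u(1)] L2_restrict[OF dom_sets outer.dom_sets sub u(2)]
  note w = weak_grad_eq_AE[OF open_dom r(1) r(3) is_weak_grad_restrict[OF dom_sets outer.dom_sets sub u(3)]]
  show uH: "u \<in> H1 \<Omega>" by (rule w(1))
  show "L2_norm \<Omega> u \<le> H1_norm \<Omega>' u" using r(2) L2_norm_le_H1_norm(1)[of \<Omega>' u] by simp
  have "ngrad u = L2_norm \<Omega> (weak_grad \<Omega>' u)"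
    by (rule L2_norm_cong_AE[OF weak_grad_spec(1)[OF uH] r(3) w(2)])
  then show "ngrad u \<le> H1_norm \<Omega>' u" using r(4) L2_norm_le_H1_norm(2)[of \<Omega>' u] by simp
qed

end

section \<open>The Boussinesq system\<close>

lemma abs_scaled_le: "0 \<le> r \<Longrightarrow> r \<le> q \<Longrightarrow> \<bar>c\<bar> \<le> m \<Longrightarrow> \<bar>r * c\<bar> \<le> q * (m::real)"
  by (simp add: abs_mult mult_mono)

lemma norm_e2 [simp]: "norm e2 = 1"
  by (simp add: e2_def norm_vec_def L2_set_def sum_2)

definition buoyancy :: "(real^2) set \<Rightarrow> (real^2 \<Rightarrow> real) \<Rightarrow> (real^2 \<Rightarrow> real^2) \<Rightarrow> real" where
  "buoyancy \<Omega> T \<phi> = (LINT x|lebesgue_on \<Omega>. (T x *\<^sub>R e2) \<bullet> \<phi> x)"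

context planar_domain
begin

lemma buoyancy_bound:
  assumes "T \<in> L2 \<Omega>" "\<phi> \<in> L2 \<Omega>"
  shows "\<bar>buoyancy \<Omega> T \<phi>\<bar> \<le> L2_norm \<Omega> T * L2_norm \<Omega> \<phi>"
proof -
  have "L2_norm \<Omega> (\<lambda>x. T x *\<^sub>R e2) = L2_norm \<Omega> T" by (simp add: L2_norm_def)
  then show ?thesis
    using L2_Cauchy_Schwarz[OF L2_scaleR_const[OF assms(1), of e2] assms(2)] by (simp add: buoyancy_def)
qed

lemma buoyancy_lin1:
  assumes "T \<in> L2 \<Omega>" "T' \<in> L2 \<Omega>" "\<phi> \<in> L2 \<Omega>"
  shows "buoyancy \<Omega> (\<lambda>x. a * T x + b * T' x) \<phi> = a * buoyancy \<Omega> T \<phi> + b * buoyancy \<Omega> T' \<phi>"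
  unfolding buoyancy_def
  by (rule L2_inner_lincomb_AE)
     (use assms in \<open>auto intro!: L2_scaleR_const L2_add L2_cmult simp: scaleR_add_left\<close>)

lemma buoyancy_lin2:
  assumes "T \<in> L2 \<Omega>" "\<phi> \<in> L2 \<Omega>" "\<phi>' \<in> L2 \<Omega>"
  shows "buoyancy \<Omega> T (\<lambda>x. a *\<^sub>R \<phi> x + b *\<^sub>R \<phi>' x) = a * buoyancy \<Omega> T \<phi> + b * buoyancy \<Omega> T \<phi>'"
  unfolding buoyancy_def inner_commute[of "_ *\<^sub>R e2"]
  by (rule L2_inner_lincomb_AE)
     (use assms in \<open>auto intro!: L2_scaleR_const L2_add L2_scaleR\<close>)

lemma L2_pairing_lincomb:
  fixes K F G :: "real^2 \<Rightarrow> 'b::euclidean_space"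
  assumes "F \<in> L2 \<Omega>" "G \<in> L2 \<Omega>" "K \<in> L2 \<Omega>"
  shows "(LINT p|lebesgue_on \<Omega>. K p \<bullet> (a *\<^sub>R F p + b *\<^sub>R G p)) =
    a * (LINT p|lebesgue_on \<Omega>. K p \<bullet> F p) + b * (LINT p|lebesgue_on \<Omega>. K p \<bullet> G p)"
  using L2_integrable_inner[OF assms(3,1)] L2_integrable_inner[OF assms(3,2)]
  by (simp add: inner_add_right)

lemma L2_grad_pairing_lincomb:
  assumes "K \<in> L2 \<Omega>" "\<psi> \<in> H01 \<Omega>" "\<psi>' \<in> H01 \<Omega>"
  shows "(LINT p|lebesgue_on \<Omega>. K p \<bullet> weak_grad \<Omega> (\<lambda>p. a * \<psi> p + b * \<psi>' p) p) =
    a * (LINT p|lebesgue_on \<Omega>. K p \<bullet> weak_grad \<Omega> \<psi> p) + b * (LINT p|lebesgue_on \<Omega>. K p \<bullet> weak_grad \<Omega> \<psi>' p)"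
  unfolding inner_commute[of "K _"]
  by (rule L2_inner_lincomb_AE)
     (use assms H01_lincomb[OF assms(2,3), of a b] H01_L2 in auto)

lemma L2_grad_pairing_zero: "(LINT p|lebesgue_on \<Omega>. K p \<bullet> weak_grad \<Omega> (\<lambda>p. 0) p) = 0"
  by (rule integral_eq_zero_AE) (use weak_grad_zero in eventually_elim, simp)

lemma L2_vgrad_pairing_zero: "(LINT p|lebesgue_on \<Omega>. K p \<bullet> vgrad \<Omega> (\<lambda>p. 0) p) = 0"
  by (rule integral_eq_zero_AE) (use vgrad_zero in eventually_elim, simp)

lemma X_D:
  assumes "x \<in> X"
  shows "fst x \<in> V_space \<Omega>" "snd x \<in> H01 \<Omega>"
  using assms by (auto simp: X_def)

lemma convection_nm:
  assumes "x \<in> X" "y \<in> X" "z \<in> X"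
  shows "\<bar>convection \<Omega> (fst x) (vgrad \<Omega> (fst y)) (fst z)\<bar> \<le> 8 * nm x * nm y * nm z"
proof -
  have "\<bar>convection \<Omega> (fst x) (vgrad \<Omega> (fst y)) (fst z)\<bar> \<le> 8 * nvgrad (fst x) * nvgrad (fst y) * nvgrad (fst z)"
    by (intro convection_bound X_D V_space_L2 assms)
  also have "\<dots> \<le> 8 * nm x * nm y * nm z"
    using assms by (intro mult_mono nvgrad_le_nm) auto
  finally show ?thesis .
qed

lemma transport_nm:
  assumes "x \<in> X" "G \<in> L2 \<Omega>" "L2_norm \<Omega> G \<le> k" "z \<in> X"
  shows "\<bar>transport \<Omega> (fst x) G (snd z)\<bar> \<le> 4 * nm x * k * nm z"
proof -
  have "\<bar>transport \<Omega> (fst x) G (snd z)\<bar> \<le> 4 * nvgrad (fst x) * L2_norm \<Omega> G * ngrad (snd z)"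
    by (intro transport_bound X_D assms)
  also have "\<dots> \<le> 4 * nm x * k * nm z"
    using assms order_trans[OF L2_norm_nonneg assms(3)] by (intro mult_mono nvgrad_le_nm ngrad_le_nm) auto
  finally show ?thesis .
qed

lemma buoyancy_nm:
  assumes "T \<in> L2 \<Omega>" "x \<in> X"
  shows "\<bar>buoyancy \<Omega> T (fst x)\<bar> \<le> L2_norm \<Omega> T * (2 * nm x)"
proof -
  have "L2_norm \<Omega> (fst x) \<le> 2 * nm x"
    using Poincare_V[OF X_D(1)[OF assms(2)]] nvgrad_le_nm[OF assms(2)] by simp
  then show ?thesis
    using buoyancy_bound[OF assms(1) V_space_L2(1)[OF X_D(1)[OF assms(2)]]]
    by (meson L2_norm_nonneg mult_left_mono order_trans)
qed

lemma L2_norm_snd_nm: "x \<in> X \<Longrightarrow> L2_norm \<Omega> (snd x) \<le> 2 * nm x"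
  using Poincare[OF X_D(2)] ngrad_le_nm[of x] by fastforce

end

text \<open>The smallness of the data enters through the inequalities that it implies on \<Omega>,
  so the larger domain no longer appears.\<close>

locale boussinesq = planar_domain \<Omega> for \<Omega> +
  fixes Rey Pra Gra :: real and g1 :: "real^2 \<Rightarrow> real^2" and g2 Td :: "real^2 \<Rightarrow> real"
  assumes Rey: "0 < Rey" "Rey < 1/100" and Pra: "0 < Pra" "Rey * Pra < 1/100"
    and Gra: "0 < Gra" "Gra < 1/100 * Rey" "Gra < 1/100 * Rey\<^sup>2"
    and g1: "g1 \<in> L2 \<Omega>" "\<And>\<phi>. \<phi> \<in> V_space \<Omega> \<Longrightarrow> \<bar>LINT x|lebesgue_on \<Omega>. g1 x \<bullet> \<phi> x\<bar> \<le> 1/100 * nvgrad \<phi>"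
    and g2: "g2 \<in> L2 \<Omega>" "\<And>\<psi>. \<psi> \<in> H01 \<Omega> \<Longrightarrow> \<bar>LINT x|lebesgue_on \<Omega>. g2 x * \<psi> x\<bar> \<le> 1/100 * ngrad \<psi>"
    and Td: "Td \<in> H1 \<Omega>" "L2_norm \<Omega> Td \<le> 1/100" "ngrad Td \<le> 1/100"
begin

lemma Gra_Rey: "0 \<le> Gra / Rey" "Gra / Rey \<le> 1/100"
  using Gra Rey by (auto simp: field_simps)

lemma Td_L2: "Td \<in> L2 \<Omega>" "weak_grad \<Omega> Td \<in> L2 \<Omega>"
  using H1_L2[OF Td(1)] weak_grad_spec(1)[OF Td(1)] by auto

text \<open>The velocity equation multiplied by \<open>Rey\<close> plus the temperature equation multiplied by
  \<open>Rey * Pra\<close>, for the unknowns \<open>v\<close> and \<open>\<theta> = T - Td\<close>, reads \<open>ip x y + lpart x y + bpart x x y = fpart y\<close>.\<close>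

definition lpart where
  "lpart x y = Rey * Pra * transport \<Omega> (fst x) (weak_grad \<Omega> Td) (snd y) - Gra / Rey * buoyancy \<Omega> (snd x) (fst y)"

definition bpart where
  "bpart x y z = Rey * convection \<Omega> (fst x) (vgrad \<Omega> (fst y)) (fst z)
     + Rey * Pra * transport \<Omega> (fst x) (weak_grad \<Omega> (snd y)) (snd z)"

definition fpart where
  "fpart y = Rey * (LINT p|lebesgue_on \<Omega>. g1 p \<bullet> fst y p) + Gra / Rey * buoyancy \<Omega> Td (fst y)
     + Rey * Pra * (LINT p|lebesgue_on \<Omega>. g2 p * snd y p)
     - (LINT p|lebesgue_on \<Omega>. weak_grad \<Omega> Td p \<bullet> weak_grad \<Omega> (snd y) p)"

lemma fpart_linear: "linear_form fpart"
  unfolding linear_form_def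
proof (intro ballI allI)
  fix x y a b assume x: "x \<in> X" and y: "y \<in> X"
  note v = X_D[OF x] X_D[OF y]
  show "fpart (lc a x b y) = a * fpart x + b * fpart y"
    unfolding fpart_def lc_def fst_conv snd_conv
    using L2_pairing_lincomb[OF V_space_L2(1)[OF v(1)] V_space_L2(1)[OF v(3)] g1(1), of a b]
      L2_pairing_lincomb[OF H01_L2(1)[OF v(2)] H01_L2(1)[OF v(4)] g2(1), of a b]
    by (simp add: L2_grad_pairing_lincomb[OF Td_L2(2) v(2) v(4)]
        buoyancy_lin2[OF Td_L2(1) V_space_L2(1)[OF v(1)] V_space_L2(1)[OF v(3)]] algebra_simps)
qed

text \<open>Three terms carry two small factors each; the pairing with the gradient of T_d carries a
  single 1/100 and decides the size. Together they stay below 1/50.\<close>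

lemma fpart_bound:
  assumes y: "y \<in> X"
  shows "\<bar>fpart y\<bar> \<le> 1/50 * nm y"
proof -
  note v = X_D[OF y]
  have "\<bar>LINT p|lebesgue_on \<Omega>. g1 p \<bullet> fst y p\<bar> \<le> 1/100 * nm y"
    using g1(2)[OF v(1)] nvgrad_le_nm[OF y] by simp
  then have 1: "\<bar>Rey * (LINT p|lebesgue_on \<Omega>. g1 p \<bullet> fst y p)\<bar> \<le> 1/100 * (1/100 * nm y)"
    using Rey by (intro abs_scaled_le) auto
  have "\<bar>buoyancy \<Omega> Td (fst y)\<bar> \<le> L2_norm \<Omega> Td * (2 * nm y)"
    by (rule buoyancy_nm[OF Td_L2(1) y])
  also have "\<dots> \<le> 1/100 * (2 * nm y)"
    using Td(2) y by (intro mult_right_mono) auto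
  finally have 2: "\<bar>Gra / Rey * buoyancy \<Omega> Td (fst y)\<bar> \<le> 1/100 * (1/100 * (2 * nm y))"
    using Gra_Rey by (intro abs_scaled_le)
  have "\<bar>LINT p|lebesgue_on \<Omega>. g2 p * snd y p\<bar> \<le> 1/100 * nm y"
    using g2(2)[OF v(2)] ngrad_le_nm[OF y] by simp
  then have 3: "\<bar>Rey * Pra * (LINT p|lebesgue_on \<Omega>. g2 p * snd y p)\<bar> \<le> 1/100 * (1/100 * nm y)"
    using Rey Pra by (intro abs_scaled_le) auto
  have "\<bar>LINT p|lebesgue_on \<Omega>. weak_grad \<Omega> Td p \<bullet> weak_grad \<Omega> (snd y) p\<bar> \<le> ngrad Td * ngrad (snd y)"
    by (rule L2_Cauchy_Schwarz[OF Td_L2(2) H01_L2(2)[OF v(2)]])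
  also have "\<dots> \<le> 1/100 * nm y"
    using Td(3) ngrad_le_nm[OF y] by (intro mult_mono) auto
  finally have 4: "\<bar>LINT p|lebesgue_on \<Omega>. weak_grad \<Omega> Td p \<bullet> weak_grad \<Omega> (snd y) p\<bar> \<le> 1/100 * nm y" .
  have "0 \<le> nm y" using y by simp
  then show ?thesis unfolding fpart_def using 1 2 3 4 by linarith
qed

lemma lpart_linear:
  "x \<in> X \<Longrightarrow> linear_form (lpart x)" "y \<in> X \<Longrightarrow> linear_form (\<lambda>x. lpart x y)"
proof -
  show "linear_form (lpart x)" if x: "x \<in> X"
    unfolding linear_form_def
  proof (intro ballI allI)
    fix y z a b assume y: "y \<in> X" and z: "z \<in> X"
    note v = X_D[OF x] X_D[OF y] X_D[OF z]
    show "lpart x (lc a y b z) = a * lpart x y + b * lpart x z"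
      unfolding lpart_def lc_def fst_conv snd_conv
      by (simp add: transport_lin3[OF v(1) Td_L2(2) v(4) v(6)]
          buoyancy_lin2[OF H01_L2(1)[OF v(2)] V_space_L2(1)[OF v(3)] V_space_L2(1)[OF v(5)]] algebra_simps)
  qed
  show "linear_form (\<lambda>x. lpart x y)" if y: "y \<in> X"
    unfolding linear_form_def
  proof (intro ballI allI)
    fix x z a b assume x: "x \<in> X" and z: "z \<in> X"
    note v = X_D[OF x] X_D[OF y] X_D[OF z]
    show "lpart (lc a x b z) y = a * lpart x y + b * lpart z y"
      unfolding lpart_def lc_def fst_conv snd_conv
      by (simp add: transport_lin1[OF v(1) v(5) Td_L2(2) v(4)]
          buoyancy_lin1[OF H01_L2(1)[OF v(2)] H01_L2(1)[OF v(6)] V_space_L2(1)[OF v(3)]] algebra_simps)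
  qed
qed

text \<open>Buoyancy dominates: Poincare's inequality is used for temperature and for velocity,
  which gives 4/100. The total 101/2500 is well within the required 1/4.\<close>

lemma lpart_bound:
  assumes x: "x \<in> X" and y: "y \<in> X"
  shows "\<bar>lpart x y\<bar> \<le> 1/4 * nm x * nm y"
proof -
  have "\<bar>transport \<Omega> (fst x) (weak_grad \<Omega> Td) (snd y)\<bar> \<le> 4 * nm x * (1/100) * nm y"
    by (rule transport_nm[OF x Td_L2(2) Td(3) y])
  then have 1: "\<bar>Rey * Pra * transport \<Omega> (fst x) (weak_grad \<Omega> Td) (snd y)\<bar> \<le> 1/100 * (4 * nm x * (1/100) * nm y)"
    using Rey Pra by (intro abs_scaled_le) auto
  have "\<bar>buoyancy \<Omega> (snd x) (fst y)\<bar> \<le> L2_norm \<Omega> (snd x) * (2 * nm y)"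
    by (rule buoyancy_nm[OF H01_L2(1)[OF X_D(2)[OF x]] y])
  also have "\<dots> \<le> (2 * nm x) * (2 * nm y)"
    using y by (intro mult_right_mono L2_norm_snd_nm[OF x]) auto
  finally have 2: "\<bar>Gra / Rey * buoyancy \<Omega> (snd x) (fst y)\<bar> \<le> 1/100 * ((2 * nm x) * (2 * nm y))"
    using Gra_Rey by (intro abs_scaled_le)
  have "\<bar>lpart x y\<bar> \<le> 1/100 * (4 * nm x * (1/100) * nm y) + 1/100 * ((2 * nm x) * (2 * nm y))"
    unfolding lpart_def using 1 2 by linarith
  also have "\<dots> = 101/2500 * (nm x * nm y)" by simp
  also have "\<dots> \<le> 1/4 * (nm x * nm y)" using x y by (intro mult_right_mono) auto
  finally show ?thesis by simp
qed

lemma bpart_linear: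
  assumes x: "x \<in> X" and y: "y \<in> X"
  shows "linear_form (bpart x y)" "linear_form (\<lambda>z. bpart x z y)" "linear_form (\<lambda>z. bpart z x y)"
proof -
  show "linear_form (bpart x y)"
    unfolding linear_form_def
  proof (intro ballI allI)
    fix z z' a b assume z: "z \<in> X" and z': "z' \<in> X"
    note v = X_D[OF x] X_D[OF y] X_D[OF z] X_D[OF z']
    show "bpart x y (lc a z b z') = a * bpart x y z + b * bpart x y z'"
      unfolding bpart_def lc_def fst_conv snd_conv
      by (simp add: transport_lin3[OF v(1) H01_L2(2)[OF v(4)] v(6) v(8)]
          convection_lin3[OF v(1) V_space_L2(2)[OF v(3)] v(5) v(7)] algebra_simps)
  qed
  show "linear_form (\<lambda>z. bpart x z y)"
    unfolding linear_form_def
  proof (intro ballI allI)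
    fix z z' a b assume z: "z \<in> X" and z': "z' \<in> X"
    note v = X_D[OF x] X_D[OF y] X_D[OF z] X_D[OF z']
    note l = V_space_lincomb[OF v(5) v(7), of a b] H01_lincomb[OF v(6) v(8), of a b]
    show "bpart x (lc a z b z') y = a * bpart x z y + b * bpart x z' y"
      unfolding bpart_def lc_def fst_conv snd_conv
      by (simp add: transport_lin2[OF v(1) H01_L2(2)[OF v(6)] H01_L2(2)[OF v(8)] v(4) H01_L2(2)[OF l(3)] l(4)]
          convection_lin2[OF v(1) V_space_L2(2)[OF v(5)] V_space_L2(2)[OF v(7)] v(3) V_space_L2(2)[OF l(1)] l(2)]
          algebra_simps)
  qed
  show "linear_form (\<lambda>z. bpart z x y)"
    unfolding linear_form_def
  proof (intro ballI allI)
    fix z z' a b assume z: "z \<in> X" and z': "z' \<in> X"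
    note v = X_D[OF x] X_D[OF y] X_D[OF z] X_D[OF z']
    show "bpart (lc a z b z') x y = a * bpart z x y + b * bpart z' x y"
      unfolding bpart_def lc_def fst_conv snd_conv
      by (simp add: transport_lin1[OF v(5) v(7) H01_L2(2)[OF v(2)] v(4)]
          convection_lin1[OF v(5) v(7) V_space_L2(2)[OF v(1)] v(3)] algebra_simps)
  qed
qed

text \<open>8/100 from convection and 4/100 from transport give 3/25, rounded up to 1/5.\<close>

lemma bpart_bound:
  assumes x: "x \<in> X" and y: "y \<in> X" and z: "z \<in> X"
  shows "\<bar>bpart x y z\<bar> \<le> 1/5 * nm x * nm y * nm z"
proof -
  have 1: "\<bar>Rey * convection \<Omega> (fst x) (vgrad \<Omega> (fst y)) (fst z)\<bar> \<le> 1/100 * (8 * nm x * nm y * nm z)"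
    using Rey by (intro abs_scaled_le convection_nm x y z) auto
  have 2: "\<bar>Rey * Pra * transport \<Omega> (fst x) (weak_grad \<Omega> (snd y)) (snd z)\<bar> \<le> 1/100 * (4 * nm x * nm y * nm z)"
    using Rey Pra by (intro abs_scaled_le transport_nm x z H01_L2 X_D y ngrad_le_nm) auto
  have "\<bar>bpart x y z\<bar> \<le> 1/100 * (8 * nm x * nm y * nm z) + 1/100 * (4 * nm x * nm y * nm z)"
    unfolding bpart_def using 1 2 by linarith
  also have "\<dots> = 3/25 * (nm x * nm y * nm z)" by simp
  also have "\<dots> \<le> 1/5 * (nm x * nm y * nm z)" using x y z by (intro mult_right_mono) auto
  finally show ?thesis by simp
qed

lemma bpart_zero: "x \<in> X \<Longrightarrow> y \<in> X \<Longrightarrow> bpart x y y = 0"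
  unfolding bpart_def using convection_zero transport_zero X_D by simp

lemma weak_grad_add_Td:
  assumes "\<theta> \<in> H01 \<Omega>"
  shows "(\<lambda>x. \<theta> x + Td x) \<in> H1 \<Omega>"
    "AE x in lebesgue_on \<Omega>. weak_grad \<Omega> (\<lambda>x. \<theta> x + Td x) x = 1 *\<^sub>R weak_grad \<Omega> \<theta> x + 1 *\<^sub>R weak_grad \<Omega> Td x"
proof -
  have "is_weak_grad \<Omega> (\<lambda>x. 1 * \<theta> x + 1 * Td x) (\<lambda>x. 1 *\<^sub>R weak_grad \<Omega> \<theta> x + 1 *\<^sub>R weak_grad \<Omega> Td x)"
    by (rule is_weak_grad_lincomb[OF dom_sets H01_L2(1)[OF assms] Td_L2(1) H01_L2(2)[OF assms] Td_L2(2)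
          h01_is_weak_grad[OF dom_sets H01D[OF assms]] weak_grad_spec(2)[OF Td(1)]])
  then have w: "is_weak_grad \<Omega> (\<lambda>x. \<theta> x + Td x) (\<lambda>x. 1 *\<^sub>R weak_grad \<Omega> \<theta> x + 1 *\<^sub>R weak_grad \<Omega> Td x)"
    by simp
  have L: "(\<lambda>x. \<theta> x + Td x) \<in> L2 \<Omega>" "(\<lambda>x. 1 *\<^sub>R weak_grad \<Omega> \<theta> x + 1 *\<^sub>R weak_grad \<Omega> Td x) \<in> L2 \<Omega>"
    using H01_L2[OF assms] Td_L2 by (auto intro: L2_add)
  show "(\<lambda>x. \<theta> x + Td x) \<in> H1 \<Omega>"
    "AE x in lebesgue_on \<Omega>. weak_grad \<Omega> (\<lambda>x. \<theta> x + Td x) x = 1 *\<^sub>R weak_grad \<Omega> \<theta> x + 1 *\<^sub>R weak_grad \<Omega> Td x"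
    by (rule weak_grad_eq_AE[OF open_dom L w])+
qed

text \<open>Test pairs with one component zero separate the combined equation into the two original
  ones, as the multipliers are positive. Additivity of the gradient in T = \<theta> + T_d holds
  almost everywhere and is used under the integrals.\<close>

lemma weak_sol_iff:
  assumes v: "v \<in> V_space \<Omega>" and \<theta>: "\<theta> \<in> H01 \<Omega>"
  shows "boussinesq_weak_sol \<Omega> Rey Pra Gra g1 g2 Td v (\<lambda>x. \<theta> x + Td x) \<longleftrightarrow>
    (\<forall>y\<in>X. ip (v, \<theta>) y + lpart (v, \<theta>) y + bpart (v, \<theta>) (v, \<theta>) y = fpart y)"
proof -
  let ?T = "\<lambda>x. \<theta> x + Td x"
  note T = weak_grad_add_Td[OF \<theta>]
  note T2 = weak_grad_spec(1)[OF T(1)]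
  define E1 where "E1 \<phi> = convection \<Omega> v (vgrad \<Omega> v) \<phi>
      + 1 / Rey * (LINT x|lebesgue_on \<Omega>. vgrad \<Omega> v x \<bullet> vgrad \<Omega> \<phi> x)
      - Gra / Rey\<^sup>2 * buoyancy \<Omega> ?T \<phi> - (LINT x|lebesgue_on \<Omega>. g1 x \<bullet> \<phi> x)" for \<phi>
  define E2 where "E2 \<psi> = transport \<Omega> v (weak_grad \<Omega> ?T) \<psi>
      + 1 / (Rey * Pra) * (LINT x|lebesgue_on \<Omega>. weak_grad \<Omega> ?T x \<bullet> weak_grad \<Omega> \<psi> x)
      - (LINT x|lebesgue_on \<Omega>. g2 x * \<psi> x)" for \<psi>
  have sol: "boussinesq_weak_sol \<Omega> Rey Pra Gra g1 g2 Td v ?T \<longleftrightarrow> (\<forall>\<phi>\<in>V_space \<Omega>. E1 \<phi> = 0) \<and> (\<forall>\<psi>\<in>H01 \<Omega>. E2 \<psi> = 0)"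
    using v \<theta> T(1) by (simp add: boussinesq_weak_sol_def E1_def E2_def convection_def transport_def buoyancy_def)
  have E1_0: "E1 (\<lambda>x. 0) = 0"
    by (simp add: E1_def convection_def buoyancy_def L2_vgrad_pairing_zero)
  have E2_0: "E2 (\<lambda>x. 0) = 0"
    by (simp add: E2_def transport_def L2_grad_pairing_zero)
  have comb: "Rey * E1 (fst y) + Rey * Pra * E2 (snd y) =
      ip (v, \<theta>) y + lpart (v, \<theta>) y + bpart (v, \<theta>) (v, \<theta>) y - fpart y" if y: "y \<in> X" for y
  proof -
    note y' = X_D[OF y]
    have b: "buoyancy \<Omega> ?T (fst y) = buoyancy \<Omega> \<theta> (fst y) + buoyancy \<Omega> Td (fst y)"
      using buoyancy_lin1[OF H01_L2(1)[OF \<theta>] Td_L2(1) V_space_L2(1)[OF y'(1)], of 1 1] by simp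
    have t: "transport \<Omega> v (weak_grad \<Omega> ?T) (snd y) =
        transport \<Omega> v (weak_grad \<Omega> \<theta>) (snd y) + transport \<Omega> v (weak_grad \<Omega> Td) (snd y)"
      using transport_lin2[OF v H01_L2(2)[OF \<theta>] Td_L2(2) y'(2) T2 T(2)] by simp
    have g: "(LINT x|lebesgue_on \<Omega>. weak_grad \<Omega> ?T x \<bullet> weak_grad \<Omega> (snd y) x) =
        (LINT x|lebesgue_on \<Omega>. weak_grad \<Omega> \<theta> x \<bullet> weak_grad \<Omega> (snd y) x) +
        (LINT x|lebesgue_on \<Omega>. weak_grad \<Omega> Td x \<bullet> weak_grad \<Omega> (snd y) x)"
      using L2_inner_lincomb_AE[OF T2 H01_L2(2)[OF \<theta>] Td_L2(2) H01_L2(2)[OF y'(2)] T(2)] by simp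
    show ?thesis
      unfolding E1_def E2_def b t g ip_def lpart_def bpart_def fpart_def fst_conv snd_conv
      using Rey Pra by (simp add: field_simps power2_eq_square)
  qed
  show ?thesis
    unfolding sol
  proof safe
    fix p q assume "\<forall>\<phi>\<in>V_space \<Omega>. E1 \<phi> = 0" "\<forall>\<psi>\<in>H01 \<Omega>. E2 \<psi> = 0" and y: "(p, q) \<in> X"
    then show "ip (v, \<theta>) (p, q) + lpart (v, \<theta>) (p, q) + bpart (v, \<theta>) (v, \<theta>) (p, q) = fpart (p, q)"
      using comb[OF y] X_D[OF y] by simp
  next
    fix \<phi> assume eq: "\<forall>y\<in>X. ip (v, \<theta>) y + lpart (v, \<theta>) y + bpart (v, \<theta>) (v, \<theta>) y = fpart y" and \<phi>: "\<phi> \<in> V_space \<Omega>"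
    then have y: "(\<phi>, \<lambda>x. 0) \<in> X" by (simp add: X_def H01_zero)
    show "E1 \<phi> = 0" using comb[OF y] bspec[OF eq y] E2_0 Rey by simp
  next
    fix \<psi> assume eq: "\<forall>y\<in>X. ip (v, \<theta>) y + lpart (v, \<theta>) y + bpart (v, \<theta>) (v, \<theta>) y = fpart y" and \<psi>: "\<psi> \<in> H01 \<Omega>"
    then have y: "(\<lambda>x. 0, \<psi>) \<in> X" by (simp add: X_def V_space_zero)
    show "E2 \<psi> = 0" using comb[OF y] bspec[OF eq y] E1_0 Rey Pra by simp
  qed
qed

text \<open>The bounds in the second claim hold for every weak solution and supply the small
  coefficients of the adjoint system. The abstract result bounds v and \<theta> by 2/50 = 1/25; the
  lift adds 1/100 to the gradient of T, which makes 1/20.\<close>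

theorem boussinesq_ex1:
  shows "ex1_ae \<Omega> (boussinesq_weak_sol \<Omega> Rey Pra Gra g1 g2 Td)"
    and "boussinesq_weak_sol \<Omega> Rey Pra Gra g1 g2 Td v T \<Longrightarrow> nvgrad v \<le> 1/20 \<and> ngrad T \<le> 1/20"
proof -
  obtain x where x: "x \<in> X" "\<And>y. y \<in> X \<Longrightarrow> ip x y + lpart x y + bpart x x y = fpart y"
    "\<And>x'. x' \<in> X \<Longrightarrow> (\<And>y. y \<in> X \<Longrightarrow> ip x' y + lpart x' y + bpart x' x' y = fpart y) \<Longrightarrow>
       nm x' \<le> 2 * (1/50) \<and> nm (lc 1 x' (-1) x) = 0"
    \<comment> \<open>With \<beta> = 1/5 and \<rho> = 1/50 the product 8 \<beta> \<rho> is 4/125,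
      below 1.\<close>
    by (rule quadratic_perturbation[OF fpart_linear fpart_bound lpart_linear lpart_bound bpart_linear bpart_bound bpart_zero]) auto
  have sol: "boussinesq_weak_sol \<Omega> Rey Pra Gra g1 g2 Td (fst x) (\<lambda>p. snd x p + Td p)"
    using weak_sol_iff[OF X_D[OF x(1)]] x(2) by simp
  \<comment> \<open>An arbitrary weak solution is recast in the unknowns v and T - T_d, so that the
    a priori bound and uniqueness apply to it.\<close>
  have any: "(v, \<lambda>p. T p - Td p) \<in> X \<and> nm (v, \<lambda>p. T p - Td p) \<le> 2 * (1/50) \<and>
      nm (lc 1 (v, \<lambda>p. T p - Td p) (-1) x) = 0"
    if s: "boussinesq_weak_sol \<Omega> Rey Pra Gra g1 g2 Td v T" for v T
  proof -
    have vT: "v \<in> V_space \<Omega>" "(\<lambda>p. T p - Td p) \<in> H01 \<Omega>" using s by (auto simp: boussinesq_weak_sol_def)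
    then have X: "(v, \<lambda>p. T p - Td p) \<in> X" by (simp add: X_def)
    have "boussinesq_weak_sol \<Omega> Rey Pra Gra g1 g2 Td v (\<lambda>p. (T p - Td p) + Td p)" using s by simp
    then show ?thesis using weak_sol_iff[OF vT] x(3)[OF X] X by blast
  qed
  show "ex1_ae \<Omega> (boussinesq_weak_sol \<Omega> Rey Pra Gra g1 g2 Td)"
    unfolding ex1_ae_def
  proof (intro exI conjI allI impI)
    show "boussinesq_weak_sol \<Omega> Rey Pra Gra g1 g2 Td (fst x) (\<lambda>p. snd x p + Td p)" by (rule sol)
    fix v T assume "boussinesq_weak_sol \<Omega> Rey Pra Gra g1 g2 Td v T"
    from any[OF this] show "AE p in lebesgue_on \<Omega>. v p = fst x p \<and> T p = snd x p + Td p"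
      using nm_diff_zero_AE[OF _ x(1), of "(v, \<lambda>p. T p - Td p)"] by (auto simp: algebra_simps)
  qed
  assume s: "boussinesq_weak_sol \<Omega> Rey Pra Gra g1 g2 Td v T"
  define \<theta> where "\<theta> p = T p - Td p" for p
  have X: "(v, \<theta>) \<in> X" and n: "nm (v, \<theta>) \<le> 1/25"
    using any[OF s] by (simp_all add: \<theta>_def[abs_def])
  note \<theta> = X_D(2)[OF X, unfolded snd_conv]
  have T: "T = (\<lambda>p. \<theta> p + Td p)" by (simp add: \<theta>_def)
  have "ngrad T = L2_norm \<Omega> (\<lambda>x. 1 *\<^sub>R weak_grad \<Omega> \<theta> x + 1 *\<^sub>R weak_grad \<Omega> Td x)"
    unfolding T by (rule L2_norm_cong_AE[OF weak_grad_spec(1)[OF weak_grad_add_Td(1)[OF \<theta>]] _ weak_grad_add_Td(2)[OF \<theta>]])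
       (use H01_L2(2)[OF \<theta>] Td_L2 in \<open>auto intro: L2_add\<close>)
  also have "\<dots> \<le> ngrad \<theta> + ngrad Td"
    using L2_norm_triangle[OF H01_L2(2)[OF \<theta>] Td_L2(2)] by simp
  finally show "nvgrad v \<le> 1/20 \<and> ngrad T \<le> 1/20"
    using nvgrad_le_nm[OF X] ngrad_le_nm[OF X] n Td(3) by simp
qed

end

section \<open>The adjoint system\<close>

text \<open>The adjoint source contains the constant mean of T, which is square integrable because
  the domain is bounded.\<close>

lemma L2_const:
  assumes "bounded \<Omega>" "\<Omega> \<in> sets lebesgue"
  shows "(\<lambda>x. c :: real) \<in> L2 \<Omega>"
proof -
  interpret finite_measure "lebesgue_on \<Omega>"
    by (rule finite_measure_lebesgue_on) (simp add: assms bounded_set_imp_lmeasurable)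
  show ?thesis by (simp add: L2_def)
qed

text \<open>The state (v, T) enters as a given pair of coefficients, known only through its spaces
  and the bounds 1/20.\<close>

locale boussinesq_adjoint = planar_domain \<Omega> for \<Omega> +
  fixes Rey Pra Gra :: real and v :: "real^2 \<Rightarrow> real^2" and T :: "real^2 \<Rightarrow> real"
  assumes Rey: "0 < Rey" "Rey < 1/100" and Pra: "0 < Pra" "Rey * Pra < 1/100"
    and Gra: "0 < Gra" "Gra < 1/100 * Rey\<^sup>2"
    and v: "v \<in> V_space \<Omega>" "nvgrad v \<le> 1/20"
    and T: "T \<in> H1 \<Omega>" "ngrad T \<le> 1/20"
    and bdd: "bounded \<Omega>"
begin

text \<open>This coefficient is Rey Pra times Gra / Rey^2, the buoyancy factor of the S-equation
  after scaling. The bound of Gra by a multiple of the square of Rey reduces it to a multiple of Rey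
  Pra.\<close>

lemma Gra_Pra_Rey: "0 \<le> Gra * Pra / Rey" "Gra * Pra / Rey \<le> 1/100"
proof -
  show "0 \<le> Gra * Pra / Rey" using Rey Pra Gra by simp
  have "Gra * Pra \<le> (1/100 * Rey\<^sup>2) * Pra" using Gra Pra by (intro mult_right_mono) auto
  also have "\<dots> = 1/100 * Rey * (Rey * Pra)" by (simp add: power2_eq_square)
  also have "\<dots> \<le> 1/100 * Rey * 1" using Rey Pra by (intro mult_left_mono) auto
  finally show "Gra * Pra / Rey \<le> 1/100" using Rey by (simp add: field_simps)
qed

lemma T_L2: "T \<in> L2 \<Omega>" "weak_grad \<Omega> T \<in> L2 \<Omega>"
  using H1_L2[OF T(1)] weak_grad_spec(1)[OF T(1)] by auto

lemma source_L2: "(\<lambda>x. T x - mean \<Omega> T) \<in> L2 \<Omega>"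
  by (intro L2_diff T_L2 L2_const bdd dom_sets)

text \<open>Compared with the state system buoyancy acts in the reverse direction: it is driven by
  the unknown w and tested with the scalar component, hence
  \<open>buoyancy \<Omega> (snd y) (fst x)\<close>.\<close>

definition lpart where
  "lpart x y = Rey * convection \<Omega> (fst x) (vgrad \<Omega> v) (fst y) - Rey * convection \<Omega> v (vgrad \<Omega> (fst x)) (fst y)
     + Rey * transport \<Omega> (fst y) (weak_grad \<Omega> T) (snd x)
     - Rey * Pra * transport \<Omega> v (weak_grad \<Omega> (snd x)) (snd y)
     - Gra * Pra / Rey * buoyancy \<Omega> (snd y) (fst x)"

definition fpart where
  "fpart y = Rey * Pra * (LINT p|lebesgue_on \<Omega>. (T p - mean \<Omega> T) * snd y p)"

lemma fpart_linear: "linear_form fpart"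
  unfolding linear_form_def
proof (intro ballI allI)
  fix x y a b assume x: "x \<in> X" and y: "y \<in> X"
  note w = X_D[OF x] X_D[OF y]
  show "fpart (lc a x b y) = a * fpart x + b * fpart y"
    unfolding fpart_def lc_def fst_conv snd_conv
    using L2_pairing_lincomb[OF H01_L2(1)[OF w(2)] H01_L2(1)[OF w(4)] source_L2, of a b]
    by (simp add: algebra_simps del: Bochner_Integration.integral_diff)
qed

lemma fpart_bound:
  assumes y: "y \<in> X"
  shows "\<bar>fpart y\<bar> \<le> 1/50 * L2_norm \<Omega> (\<lambda>x. T x - mean \<Omega> T) * nm y"
proof -
  have "\<bar>LINT p|lebesgue_on \<Omega>. (T p - mean \<Omega> T) * snd y p\<bar> \<le> L2_norm \<Omega> (\<lambda>x. T x - mean \<Omega> T) * L2_norm \<Omega> (snd y)"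
    by (rule L2_Cauchy_Schwarz_mult[OF source_L2 H01_L2(1)[OF X_D(2)[OF y]]])
  also have "\<dots> \<le> L2_norm \<Omega> (\<lambda>x. T x - mean \<Omega> T) * (2 * nm y)"
    by (intro mult_left_mono L2_norm_snd_nm y) simp
  finally have "\<bar>fpart y\<bar> \<le> 1/100 * (L2_norm \<Omega> (\<lambda>x. T x - mean \<Omega> T) * (2 * nm y))"
    unfolding fpart_def using Rey Pra by (intro abs_scaled_le) auto
  then show ?thesis by (simp add: mult_ac)
qed

lemma lpart_linear:
  "x \<in> X \<Longrightarrow> linear_form (lpart x)" "y \<in> X \<Longrightarrow> linear_form (\<lambda>x. lpart x y)"
proof -
  show "linear_form (lpart x)" if x: "x \<in> X"
    unfolding linear_form_def
  proof (intro ballI allI)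
    fix y z a b assume y: "y \<in> X" and z: "z \<in> X"
    note w = X_D[OF x] X_D[OF y] X_D[OF z]
    show "lpart x (lc a y b z) = a * lpart x y + b * lpart x z"
      unfolding lpart_def lc_def fst_conv snd_conv
      by (simp add: convection_lin3[OF w(1) V_space_L2(2)[OF v(1)] w(3) w(5)]
          convection_lin3[OF v(1) V_space_L2(2)[OF w(1)] w(3) w(5)]
          transport_lin1[OF w(3) w(5) T_L2(2) w(2)]
          transport_lin3[OF v(1) H01_L2(2)[OF w(2)] w(4) w(6)]
          buoyancy_lin1[OF H01_L2(1)[OF w(4)] H01_L2(1)[OF w(6)] V_space_L2(1)[OF w(1)]] algebra_simps)
  qed
  show "linear_form (\<lambda>x. lpart x y)" if y: "y \<in> X"
    unfolding linear_form_def
  proof (intro ballI allI)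
    fix x z a b assume x: "x \<in> X" and z: "z \<in> X"
    note w = X_D[OF x] X_D[OF y] X_D[OF z]
    note l = V_space_lincomb[OF w(1) w(5), of a b] H01_lincomb[OF w(2) w(6), of a b]
    show "lpart (lc a x b z) y = a * lpart x y + b * lpart z y"
      unfolding lpart_def lc_def fst_conv snd_conv
      by (simp add: convection_lin1[OF w(1) w(5) V_space_L2(2)[OF v(1)] w(3)]
          convection_lin2[OF v(1) V_space_L2(2)[OF w(1)] V_space_L2(2)[OF w(5)] w(3) V_space_L2(2)[OF l(1)] l(2)]
          transport_lin3[OF w(3) T_L2(2) w(2) w(6)]
          transport_lin2[OF v(1) H01_L2(2)[OF w(2)] H01_L2(2)[OF w(6)] w(4) H01_L2(2)[OF l(3)] l(4)]
          buoyancy_lin2[OF H01_L2(1)[OF w(4)] V_space_L2(1)[OF w(1)] V_space_L2(1)[OF w(5)]] algebra_simps)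
  qed
qed

text \<open>The four terms containing the state each have a factor 1/20 besides 1/100; buoyancy with
  its 4/100 dominates, and the sum is 13/250.\<close>

lemma lpart_bound:
  assumes x: "x \<in> X" and y: "y \<in> X"
  shows "\<bar>lpart x y\<bar> \<le> 1/4 * nm x * nm y"
proof -
  note w = X_D[OF x] X_D[OF y]
  note n = nvgrad_le_nm[OF x] ngrad_le_nm[OF x] nvgrad_le_nm[OF y] ngrad_le_nm[OF y]
  have "\<bar>convection \<Omega> (fst x) (vgrad \<Omega> v) (fst y)\<bar> \<le> 8 * nvgrad (fst x) * nvgrad v * nvgrad (fst y)"
    by (rule convection_bound[OF w(1) V_space_L2(2)[OF v(1)] w(3)])
  also have "\<dots> \<le> 8 * nm x * (1/20) * nm y"
    using n x y v by (intro mult_mono) auto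
  finally have 1: "\<bar>Rey * convection \<Omega> (fst x) (vgrad \<Omega> v) (fst y)\<bar> \<le> 1/100 * (8 * nm x * (1/20) * nm y)"
    using Rey by (intro abs_scaled_le) auto
  have "\<bar>convection \<Omega> v (vgrad \<Omega> (fst x)) (fst y)\<bar> \<le> 8 * nvgrad v * nvgrad (fst x) * nvgrad (fst y)"
    by (rule convection_bound[OF v(1) V_space_L2(2)[OF w(1)] w(3)])
  also have "\<dots> \<le> 8 * (1/20) * nm x * nm y"
    using n x y v by (intro mult_mono) auto
  finally have 2: "\<bar>Rey * convection \<Omega> v (vgrad \<Omega> (fst x)) (fst y)\<bar> \<le> 1/100 * (8 * (1/20) * nm x * nm y)"
    using Rey by (intro abs_scaled_le) auto
  have 3: "\<bar>Rey * transport \<Omega> (fst y) (weak_grad \<Omega> T) (snd x)\<bar> \<le> 1/100 * (4 * nm y * (1/20) * nm x)"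
    using Rey by (intro abs_scaled_le transport_nm x y T_L2 T) auto
  have "\<bar>transport \<Omega> v (weak_grad \<Omega> (snd x)) (snd y)\<bar> \<le> 4 * nvgrad v * ngrad (snd x) * ngrad (snd y)"
    by (rule transport_bound[OF v(1) H01_L2(2)[OF w(2)] w(4)])
  also have "\<dots> \<le> 4 * (1/20) * nm x * nm y"
    using n x y v by (intro mult_mono) auto
  finally have 4: "\<bar>Rey * Pra * transport \<Omega> v (weak_grad \<Omega> (snd x)) (snd y)\<bar> \<le> 1/100 * (4 * (1/20) * nm x * nm y)"
    using Rey Pra by (intro abs_scaled_le) auto
  have "\<bar>buoyancy \<Omega> (snd y) (fst x)\<bar> \<le> L2_norm \<Omega> (snd y) * (2 * nm x)"
    by (rule buoyancy_nm[OF H01_L2(1)[OF w(4)] x])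
  also have "\<dots> \<le> (2 * nm y) * (2 * nm x)"
    using x by (intro mult_right_mono L2_norm_snd_nm[OF y]) auto
  finally have 5: "\<bar>Gra * Pra / Rey * buoyancy \<Omega> (snd y) (fst x)\<bar> \<le> 1/100 * ((2 * nm y) * (2 * nm x))"
    using Gra_Pra_Rey by (intro abs_scaled_le)
  have "\<bar>lpart x y\<bar> \<le> 1/100 * (8 * nm x * (1/20) * nm y) + 1/100 * (8 * (1/20) * nm x * nm y) +
      1/100 * (4 * nm y * (1/20) * nm x) + 1/100 * (4 * (1/20) * nm x * nm y) + 1/100 * ((2 * nm y) * (2 * nm x))"
    unfolding lpart_def using 1 2 3 4 5 by linarith
  also have "\<dots> = 13/250 * (nm x * nm y)" by simp
  also have "\<dots> \<le> 1/4 * (nm x * nm y)" using x y by (intro mult_right_mono) auto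
  finally show ?thesis by simp
qed

lemma weak_sol_iff:
  assumes w: "w \<in> V_space \<Omega>" and S: "S \<in> H01 \<Omega>"
  shows "adjoint_weak_sol \<Omega> Rey Pra Gra v T w S \<longleftrightarrow> (\<forall>y\<in>X. ip (w, S) y + lpart (w, S) y = fpart y)"
proof -
  define E1 where "E1 \<phi> = - convection \<Omega> v (vgrad \<Omega> w) \<phi> + convection \<Omega> w (vgrad \<Omega> v) \<phi>
      + transport \<Omega> \<phi> (weak_grad \<Omega> T) S
      + 1 / Rey * (LINT x|lebesgue_on \<Omega>. vgrad \<Omega> w x \<bullet> vgrad \<Omega> \<phi> x)" for \<phi>
  define E2 where "E2 \<psi> = - transport \<Omega> v (weak_grad \<Omega> S) \<psi>
      + 1 / (Rey * Pra) * (LINT x|lebesgue_on \<Omega>. weak_grad \<Omega> S x \<bullet> weak_grad \<Omega> \<psi> x)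
      - Gra / Rey\<^sup>2 * buoyancy \<Omega> \<psi> w
      - (LINT x|lebesgue_on \<Omega>. (T x - mean \<Omega> T) * \<psi> x)" for \<psi>
  have b: "(LINT x|lebesgue_on \<Omega>. (w x \<bullet> e2) * \<psi> x) = buoyancy \<Omega> \<psi> w" for \<psi>
    unfolding buoyancy_def by (simp add: inner_commute mult.commute)
  have sol: "adjoint_weak_sol \<Omega> Rey Pra Gra v T w S \<longleftrightarrow> (\<forall>\<phi>\<in>V_space \<Omega>. E1 \<phi> = 0) \<and> (\<forall>\<psi>\<in>H01 \<Omega>. E2 \<psi> = 0)"
    using w S by (simp add: adjoint_weak_sol_def E1_def E2_def convection_def transport_def b)
  have E1_0: "E1 (\<lambda>x. 0) = 0"
    by (simp add: E1_def convection_def transport_def L2_vgrad_pairing_zero)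
  have E2_0: "E2 (\<lambda>x. 0) = 0"
    by (simp add: E2_def transport_def buoyancy_def L2_grad_pairing_zero)
  \<comment> \<open>The source integral is kept whole: the right side of the equation is the
    functional of T minus its mean, and splitting it would break the match with
    \<open>fpart\<close>.\<close>
  have comb: "Rey * E1 (fst y) + Rey * Pra * E2 (snd y) = ip (w, S) y + lpart (w, S) y - fpart y" for y
    unfolding E1_def E2_def ip_def lpart_def fpart_def fst_conv snd_conv
    using Rey Pra by (simp add: field_simps power2_eq_square del: Bochner_Integration.integral_diff)
  show ?thesis
    unfolding sol
  proof safe
    fix p q assume "\<forall>\<phi>\<in>V_space \<Omega>. E1 \<phi> = 0" "\<forall>\<psi>\<in>H01 \<Omega>. E2 \<psi> = 0" and y: "(p, q) \<in> X"
    then show "ip (w, S) (p, q) + lpart (w, S) (p, q) = fpart (p, q)"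
      using comb[of "(p, q)"] X_D[OF y] by simp
  next
    fix \<phi> assume eq: "\<forall>y\<in>X. ip (w, S) y + lpart (w, S) y = fpart y" and \<phi>: "\<phi> \<in> V_space \<Omega>"
    then have y: "(\<phi>, \<lambda>x. 0) \<in> X" by (simp add: X_def H01_zero)
    show "E1 \<phi> = 0" using comb[of "(\<phi>, \<lambda>x. 0)"] bspec[OF eq y] E2_0 Rey by simp
  next
    fix \<psi> assume eq: "\<forall>y\<in>X. ip (w, S) y + lpart (w, S) y = fpart y" and \<psi>: "\<psi> \<in> H01 \<Omega>"
    then have y: "(\<lambda>x. 0, \<psi>) \<in> X" by (simp add: X_def V_space_zero)
    show "E2 \<psi> = 0" using comb[of "(\<lambda>x. 0, \<psi>)"] bspec[OF eq y] E1_0 Rey Pra by simp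
  qed
qed

theorem adjoint_ex1: "ex1_ae \<Omega> (adjoint_weak_sol \<Omega> Rey Pra Gra v T)"
proof -
  have zero: "linear_form (\<lambda>z. 0)" by (simp add: linear_form_def)
  obtain x where x: "x \<in> X" "\<And>y. y \<in> X \<Longrightarrow> ip x y + lpart x y + 0 = fpart y"
    "\<And>x'. x' \<in> X \<Longrightarrow> (\<And>y. y \<in> X \<Longrightarrow> ip x' y + lpart x' y + 0 = fpart y) \<Longrightarrow>
       nm x' \<le> 2 * (1/50 * L2_norm \<Omega> (\<lambda>x. T x - mean \<Omega> T)) \<and> nm (lc 1 x' (-1) x) = 0"
    \<comment> \<open>For \<beta> = 0 the condition 8 \<beta> \<rho> \<le> 1 holds for every \<rho>,
      so \<rho> can be proportional to the norm of the source.\<close>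
    by (rule quadratic_perturbation[OF fpart_linear fpart_bound lpart_linear lpart_bound,
          where B = "\<lambda>x y z. 0" and \<beta> = 0]) (auto simp: zero)
  show ?thesis
    unfolding ex1_ae_def
  proof (intro exI conjI allI impI)
    show "adjoint_weak_sol \<Omega> Rey Pra Gra v T (fst x) (snd x)"
      using weak_sol_iff[OF X_D[OF x(1)]] x(2) by simp
    fix w S assume s: "adjoint_weak_sol \<Omega> Rey Pra Gra v T w S"
    then have wS: "w \<in> V_space \<Omega>" "S \<in> H01 \<Omega>" by (auto simp: adjoint_weak_sol_def)
    then have X: "(w, S) \<in> X" by (simp add: X_def)
    have "nm (lc 1 (w, S) (-1) x) = 0"
      using x(3)[OF X] weak_sol_iff[OF wS] s by simp
    from nm_diff_zero_AE[OF X x(1) this]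
    show "AE p in lebesgue_on \<Omega>. w p = fst x p \<and> S p = snd x p" by simp
  qed
qed

end

section \<open>Traces\<close>

text \<open>The chosen weak gradient of the zero function vanishes only almost everywhere, so the
  double integral is evaluated by discarding a null set in each variable.\<close>

lemma zero_in_H32:
  assumes "open J"
  shows "(\<lambda>t. 0) \<in> H32 J"
proof -
  have w: "is_weak_grad J (\<lambda>t. 0) (\<lambda>t. 0)" by (simp add: is_weak_grad_def)
  note z = weak_grad_eq_AE[OF assms L2_zero L2_zero w]
  have "(\<integral>\<^sup>+ t. (\<integral>\<^sup>+ s. ennreal (((weak_grad J (\<lambda>t. 0) t - weak_grad J (\<lambda>t. 0) s) / (t - s))\<^sup>2)
        \<partial>lebesgue_on J) \<partial>lebesgue_on J) = (\<integral>\<^sup>+ t. 0 \<partial>lebesgue_on J)"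
  proof (rule nn_integral_cong_AE)
    show "AE t in lebesgue_on J. (\<integral>\<^sup>+ s. ennreal (((weak_grad J (\<lambda>t. 0) t - weak_grad J (\<lambda>t. 0) s) / (t - s))\<^sup>2)
        \<partial>lebesgue_on J) = 0"
      using z(2)
    proof eventually_elim
      case (elim t)
      have "(\<integral>\<^sup>+ s. ennreal (((weak_grad J (\<lambda>t. 0) t - weak_grad J (\<lambda>t. 0) s) / (t - s))\<^sup>2) \<partial>lebesgue_on J) =
          (\<integral>\<^sup>+ s. 0 \<partial>lebesgue_on J)"
        by (rule nn_integral_cong_AE, rule eventually_mono[OF z(2)]) (simp add: elim)
      then show ?case by simp
    qed
  qed
  then show ?thesis using z(1) by (simp add: H32_def)
qed

lemma graph_pt_nth [simp]: "graph_pt \<gamma> t $ 1 = t" "graph_pt \<gamma> t $ 2 = \<gamma> t"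
  by (simp_all add: graph_pt_def vector_2)

text \<open>\<open>Dom\<close> is cut out by strict inequalities, so the graph lies outside it and
  the approximating test functions vanish there; their restrictions to the graph are identically
  zero.\<close>

lemma H01_trace_zero:
  assumes "u \<in> H01 (Dom \<gamma>)"
  shows "is_trace_on_Gam \<gamma> u (\<lambda>t. 0)"
proof -
  obtain \<phi> where \<phi>: "u \<in> H1 (Dom \<gamma>)" "\<And>n. \<phi> n \<in> test_funs (Dom \<gamma>)"
      "(\<lambda>n. H1_norm (Dom \<gamma>) (\<lambda>x. u x - \<phi> n x)) \<longlonglongrightarrow> 0"
    using assms unfolding H01_def by blast
  have "graph_pt \<gamma> t \<notin> Dom \<gamma>" for t by (simp add: Dom_def)
  then have "\<phi> n (graph_pt \<gamma> t) = 0" for n t using test_funs_outside[OF \<phi>(2)] by blast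
  then show ?thesis
    unfolding is_trace_on_Gam_def using \<phi> test_funs_smooth[OF \<phi>(2)]
    by (intro conjI exI[of _ \<phi>]) (auto simp: L2_norm_def)
qed

section \<open>The domain above the graph and the boundary portion formed by the graph\<close>

lemma open_Dom:
  assumes "continuous_on {0<..<1} \<gamma>"
  shows "open (Dom \<gamma>)"
proof -
  let ?S = "{x :: real^2. x $ 1 \<in> {0<..<1}}"
  have S: "open ?S"
    by (rule open_vimage[of "{0<..<1}" "\<lambda>x :: real^2. x $ 1", unfolded vimage_def]) (auto intro: continuous_intros)
  have "continuous_on ?S (\<lambda>x. \<gamma> (x $ 1) - x $ 2)"
    by (intro continuous_intros continuous_on_compose2[OF assms]) auto
  then have "open (?S \<inter> (\<lambda>x. \<gamma> (x $ 1) - x $ 2) -` {..<0})"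
    using S by (intro continuous_open_preimage) auto
  moreover have "open {x :: real^2. x $ 2 < 1}"
    by (rule open_halfspace_component_lt_cart)
  ultimately have "open ((?S \<inter> (\<lambda>x. \<gamma> (x $ 1) - x $ 2) -` {..<0}) \<inter> {x. x $ 2 < 1})"
    by (rule open_Int)
  also have "(?S \<inter> (\<lambda>x. \<gamma> (x $ 1) - x $ 2) -` {..<0}) \<inter> {x. x $ 2 < 1} = Dom \<gamma>"
    by (auto simp: Dom_def)
  finally show ?thesis .
qed

text \<open>By continuity a violation at one point persists on a nonempty open set, which is not
  negligible; this contradicts the bound almost everywhere.\<close>

lemma admissible_less:
  assumes "admissible L \<nu> \<gamma>" "0 < t" "t < 1"
  shows "\<gamma> t \<le> 1 - \<nu>"
proof (rule ccontr)
  assume gt: "\<not> \<gamma> t \<le> 1 - \<nu>"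
  define U where "U = {0<..<1} \<inter> \<gamma> -` {1 - \<nu><..}"
  have cont: "continuous_on {0<..<1} \<gamma>"
    using assms(1) by (auto simp: admissible_def intro: continuous_on_subset)
  have "open U" unfolding U_def by (intro continuous_open_preimage cont) auto
  moreover have "t \<in> U" using gt assms by (simp add: U_def)
  ultimately have "\<not> negligible U" using open_not_negligible by blast
  have "AE t in lebesgue. t \<in> {0<..<1} \<longrightarrow> \<gamma> t \<le> 1 - \<nu>"
    using assms(1) by (simp add: admissible_def AE_restrict_space_iff)
  then have "AE t in lebesgue. t \<notin> U"
    by eventually_elim (auto simp: U_def)
  then have "U \<in> null_sets lebesgue"
    using \<open>open U\<close> by (subst AE_iff_null_sets) auto
  then show False using \<open>\<not> negligible U\<close> by (simp add: negligible_iff_null_sets)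
qed

text \<open>The graph stays a distance \<nu> below the top edge, so the points slightly above it
  belong to the domain.\<close>

lemma graph_pt_frontier:
  assumes adm: "admissible L \<nu> \<gamma>" and \<nu>: "0 < \<nu>" and t: "0 < t" "t < 1"
  shows "graph_pt \<gamma> t \<in> frontier (Dom \<gamma>)"
proof -
  have cont: "continuous_on {0<..<1} \<gamma>"
    using adm by (auto simp: admissible_def intro: continuous_on_subset)
  have "graph_pt \<gamma> t \<in> closure (Dom \<gamma>)"
    unfolding closure_approachable
  proof (intro allI impI)
    fix e :: real assume e: "e > 0"
    \<comment> \<open>e/2 keeps the shifted point close to the graph, and \<nu>/2 keeps it below
      height 1.\<close>
    define r where "r = min (e / 2) (\<nu> / 2)"
    have r: "0 < r" "r < e" "r < \<nu>" using e \<nu> by (auto simp: r_def)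
    let ?y = "graph_pt \<gamma> t + r *\<^sub>R axis 2 1"
    have "?y \<in> Dom \<gamma>"
      using admissible_less[OF adm t] t r by (simp add: Dom_def axis_def)
    moreover have "dist ?y (graph_pt \<gamma> t) < e" using r by (simp add: dist_norm)
    ultimately show "\<exists>y\<in>Dom \<gamma>. dist y (graph_pt \<gamma> t) < e" by blast
  qed
  moreover have "graph_pt \<gamma> t \<notin> Dom \<gamma>" by (simp add: Dom_def)
  ultimately show ?thesis
    using open_Dom[OF cont] by (simp add: frontier_def interior_open)
qed

text \<open>Weak derivatives require an open parameter set. As the whole graph lies in the frontier,
  membership in the relatively open portion reduces to the preimage of an open set of the plane
  under the continuous chart.\<close>

lemma H01_trace_in_H32:
  assumes adm: "admissible L \<nu> \<gamma>" and \<nu>: "0 < \<nu>"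
    and \<Gamma>: "openin (top_of_set (frontier (Dom \<gamma>))) \<Gamma>e" and u: "u \<in> H01 (Dom \<gamma>)"
  shows "trace_in_H32 \<gamma> \<Gamma>e u"
proof -
  obtain W where W: "open W" "\<Gamma>e = frontier (Dom \<gamma>) \<inter> W"
    using \<Gamma> by (auto simp: openin_open)
  have cont: "continuous_on {0<..<1} \<gamma>"
    using adm by (auto simp: admissible_def intro: continuous_on_subset)
  have "continuous_on {0<..<1} (\<lambda>t. t *\<^sub>R axis 1 1 + \<gamma> t *\<^sub>R axis 2 1 :: real^2)"
    by (intro continuous_intros cont)
  moreover have "graph_pt \<gamma> = (\<lambda>t. t *\<^sub>R axis 1 1 + \<gamma> t *\<^sub>R axis 2 1)"
    by (simp add: fun_eq_iff vec_eq_iff forall_2 axis_def)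
  ultimately have "open ({0<..<1} \<inter> graph_pt \<gamma> -` W)"
    using W(1) by (intro continuous_open_preimage) auto
  moreover have "{t \<in> {0<..<1}. graph_pt \<gamma> t \<in> \<Gamma>e} = {0<..<1} \<inter> graph_pt \<gamma> -` W"
    using graph_pt_frontier[OF adm \<nu>] W(2) by auto
  ultimately have "open {t \<in> {0<..<1}. graph_pt \<gamma> t \<in> \<Gamma>e}" by simp
  from zero_in_H32[OF this] H01_trace_zero[OF u] show ?thesis
    unfolding trace_in_H32_def by blast
qed

lemma bounded_Dom:
  assumes "Dom \<gamma> \<subseteq> DomM M"
  shows "bounded (Dom \<gamma>)"
proof (rule bounded_subset[OF bounded_cbox])
  show "Dom \<gamma> \<subseteq> cbox (vector [0, - M]) (vector [1, 1])"
    using assms by (force simp: DomM_def mem_box_cart forall_2 vector_2)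
qed

lemma planar_domain_DomM: "planar_domain (DomM M)"
proof
  have "DomM M = box (vector [0, - M]) (vector [1, 1])"
    by (auto simp: DomM_def mem_box_cart forall_2 vector_2)
  then show "open (DomM M)" by (simp add: open_box)
qed (auto simp: DomM_def)


theorem lemma4p2:
  fixes L \<nu> M :: real and \<gamma> :: "real \<Rightarrow> real"
  assumes "L > 0" and "0 < \<nu>" and "\<nu> < 1"
    and "M > 0" and "\<And>\<eta>. admissible L \<nu> \<eta> \<Longrightarrow> Dom \<eta> \<subseteq> DomM M"
    and "admissible L \<nu> \<gamma>"
  shows "\<exists>\<epsilon>1 \<epsilon>2 \<epsilon>3 \<delta> :: real. \<epsilon>1 > 0 \<and> \<epsilon>2 > 0 \<and> \<epsilon>3 > 0 \<and> \<delta> > 0 \<and>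
    (\<forall>(g1 :: real^2 \<Rightarrow> real^2) (g2 :: real^2 \<Rightarrow> real) (Td :: real^2 \<Rightarrow> real)
        (Rey :: real) (Pra :: real) (Gra :: real).
       g1 \<in> L2 (DomM M) \<and> g2 \<in> L2 (DomM M) \<and> Td \<in> H1 (DomM M) \<inter> Cc (DomM M) \<and>
       0 < Rey \<and> Rey < \<epsilon>1 \<and>
       0 < Pra \<and> Pra < \<epsilon>2 / Rey \<and>
       0 < Gra \<and> Gra < \<epsilon>3 * min Rey (Rey\<^sup>2) \<and>
       V_dual_norm (DomM M) g1 \<le> ennreal \<delta> \<and>
       Hm1_norm (DomM M) g2 \<le> ennreal \<delta> \<and>
       H1_norm (DomM M) Td \<le> \<delta> \<longrightarrow>
       ex1_ae (Dom \<gamma>) (boussinesq_weak_sol (Dom \<gamma>) Rey Pra Gra g1 g2 Td) \<and>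
       (\<forall>v T. boussinesq_weak_sol (Dom \<gamma>) Rey Pra Gra g1 g2 Td v T \<longrightarrow>
          ex1_ae (Dom \<gamma>) (adjoint_weak_sol (Dom \<gamma>) Rey Pra Gra v T) \<and>
          (Td \<in> H2 (DomM M) \<and> C2_boundary_portion (Dom \<gamma>) (Gam \<gamma>) \<longrightarrow>
             (\<forall>w S \<Gamma>e.
                adjoint_weak_sol (Dom \<gamma>) Rey Pra Gra v T w S \<and>
                openin (top_of_set (frontier (Dom \<gamma>))) \<Gamma>e \<and> closure \<Gamma>e \<subseteq> Gam \<gamma> \<longrightarrow>
                (\<forall>j. trace_in_H32 \<gamma> \<Gamma>e (\<lambda>x. w x $ j)) \<and> trace_in_H32 \<gamma> \<Gamma>e S))))"
proof -
  have cont: "continuous_on {0<..<1} \<gamma>"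
    using assms(6) by (auto simp: admissible_def intro: continuous_on_subset)
  have sub: "Dom \<gamma> \<subseteq> DomM M" by (rule assms(5)[OF assms(6)])
  interpret outer: planar_domain "DomM M" by (rule planar_domain_DomM)
  \<comment> \<open>From here on norms of data on \<open>DomM M\<close> can be used for test
    functions on \<open>Dom \<gamma>\<close>.\<close>
  interpret planar_subdomain "Dom \<gamma>" "DomM M"
    by unfold_locales (use sub open_Dom[OF cont] in \<open>auto simp: Dom_def\<close>)
  show ?thesis
  \<comment> \<open>All four thresholds take the value that the locale \<open>boussinesq\<close>
    assumes.\<close>
  proof (rule exI[of _ "1/100"], rule exI[of _ "1/100"], rule exI[of _ "1/100"], rule exI[of _ "1/100"],
      intro conjI allI impI; (elim conjE)?)
    fix g1 :: "real^2 \<Rightarrow> real^2" and g2 Td :: "real^2 \<Rightarrow> real" and Rey Pra Gra :: real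
    assume data: "g1 \<in> L2 (DomM M)" "g2 \<in> L2 (DomM M)" "Td \<in> H1 (DomM M) \<inter> Cc (DomM M)"
      and Rey: "0 < Rey" "Rey < 1/100" and Pra: "0 < Pra" "Pra < 1/100 / Rey"
      and Gra: "0 < Gra" "Gra < 1/100 * min Rey (Rey\<^sup>2)"
      and small: "V_dual_norm (DomM M) g1 \<le> ennreal (1/100)" "Hm1_norm (DomM M) g2 \<le> ennreal (1/100)"
        "H1_norm (DomM M) Td \<le> 1/100"
    have RP: "Rey * Pra < 1/100" using Rey Pra by (simp add: field_simps)
    have GR: "Gra < 1/100 * Rey" "Gra < 1/100 * Rey\<^sup>2" using Gra by auto
    have Td: "Td \<in> H1 (DomM M)" using data by blast
    interpret boussinesq "Dom \<gamma>" Rey Pra Gra g1 g2 Td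
      using Rey Pra RP Gra GR small H1_restrict[OF Td] data
        V_dual_bound_sub[OF small(1)] Hm1_bound_sub[OF small(2)]
        L2_restrict(1)[OF dom_sets outer.dom_sets sub data(1)] L2_restrict(1)[OF dom_sets outer.dom_sets sub data(2)]
      by unfold_locales auto
    show "ex1_ae (Dom \<gamma>) (boussinesq_weak_sol (Dom \<gamma>) Rey Pra Gra g1 g2 Td)"
      by (rule boussinesq_ex1(1))
    fix v T assume sol: "boussinesq_weak_sol (Dom \<gamma>) Rey Pra Gra g1 g2 Td v T"
    \<comment> \<open>The state is an arbitrary weak solution; the second part of
      \<open>boussinesq_ex1\<close> supplies the two bounds by 1/20.\<close>
    interpret adj: boussinesq_adjoint "Dom \<gamma>" Rey Pra Gra v T
      using Rey Pra RP Gra GR sol boussinesq_ex1(2)[OF sol] bounded_Dom[OF sub]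
      by unfold_locales (auto simp: boussinesq_weak_sol_def)
    show "ex1_ae (Dom \<gamma>) (adjoint_weak_sol (Dom \<gamma>) Rey Pra Gra v T)"
      by (rule adj.adjoint_ex1)
    fix w S \<Gamma>e
    assume adj: "adjoint_weak_sol (Dom \<gamma>) Rey Pra Gra v T w S"
      and \<Gamma>e: "openin (top_of_set (frontier (Dom \<gamma>))) \<Gamma>e"
    then have wS: "w \<in> V_space (Dom \<gamma>)" "S \<in> H01 (Dom \<gamma>)" by (auto simp: adjoint_weak_sol_def)
    show "trace_in_H32 \<gamma> \<Gamma>e S"
      by (rule H01_trace_in_H32[OF assms(6) assms(2) \<Gamma>e wS(2)])
    show "trace_in_H32 \<gamma> \<Gamma>e (\<lambda>x. w x $ j)" for j
      by (rule H01_trace_in_H32[OF assms(6) assms(2) \<Gamma>e V_space_nth[OF wS(1)]])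
  qed auto
qed

end
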